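(* For $\delta>0$ let $\Omega_\delta=\{x\in\Omega:\operatorname{dist}(x,\partial\Omega)>\delta\}$. For every sufficiently small $\delta>0$ there exists a constant $c_0=c_0(\delta,a)>0$, independent of $\varepsilon$ and $\psi$, such that if $$\max_{\partial\Omega}\psi+\int_{\Omega\setminus\Omega_\delta}G(|\nabla\psi|)\,dx\le c_0$$ (which in particular holds whenever $\|\psi\|_{C^{0,1}(\Omega)}$ is sufficiently small), then $$\mathcal{J}_\varepsilon[u_2]<\mathcal{J}_\varepsilon[u_0],$$ and consequently $u_2\neq u_0$.
   Context: $\Omega\subset\mathbb{R}^n$ is a smooth bounded domain. $G:[0,\infty)\to[0,\infty)$ is an N-function (convex, $G(t)/t\to0$ as $t\to0^+$, $G(t)/t\to\infty$ as $t\to\infty$, $G(t)>0$ for $t>0$) satisfying the Lieberman conditions: $G'=g$ with $g\in C^0([0,\infty))\cap C^1((0,\infty))$, and there are constants $0<\delta_0\le g_0$ with $\delta_0\le \frac{t g'(t)}{g(t)}\le g_0$ for all $t>0$. The $g$-Laplacian is $\Delta_g u=\operatorname{div}\left(\frac{g(|\nabla u|)}{|\nabla u|}\nabla u\right)$. $W^{1,G}(\Omega)$ is the Orlicz--Sobolev space associated with $G$ and $W^{1,G}_0(\Omega)$ its subspace of functions with zero boundary values. The weight $a$ is continuous, positive and bounded in $\Omega$ with $\inf_\Omega a>0$. For each $\varepsilon>0$, $\Gamma_\varepsilon\in C^\infty(\mathbb{R};[0,1])$ satisfies $\Gamma_\varepsilon(s)=0$ for $s\le0$ and $\Gamma_\varepsilon(s)=1$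 for $s\ge\varepsilon$. The boundary datum is $\psi\in C^{1,\alpha}(\overline\Omega)\cap W^{1,G}(\Omega)$ with $\min_{\partial\Omega}\psi>\varepsilon>0$. The energy is $\mathcal{J}_\varepsilon[u]=\int_\Omega (G(|\nabla u|)+a(x)\Gamma_\varepsilon(u))\,dx$. $u_0$ is the weak solution of $-\Delta_g u_0=0$ in $\Omega$, $u_0=\psi$ on $\partial\Omega$. $u_2$ is a minimizer of $\mathcal{J}_\varepsilon$ on $\mathcal{K}_\varepsilon=\{v\in W^{1,G}(\Omega): v-\psi\in W^{1,G}_0(\Omega)\}$. The constant $c_0$ may also depend on the fixed data $n$, $\Omega$, $g_0$, $\delta_0$, $G(1)$. *)

theory Defs
  imports "HOL-Analysis.Analysis"
begin

section \<open>Smooth functions and smooth bounded domains\<close>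

text \<open>\<open>C\<^sup>k\<close> on an open set \<open>S\<close>, by recursion on directional derivatives.\<close>

primrec Ck_on :: "nat \<Rightarrow> 'a::euclidean_space set \<Rightarrow> ('a \<Rightarrow> real) \<Rightarrow> bool" where
  "Ck_on 0 S f \<longleftrightarrow> continuous_on S f"
| "Ck_on (Suc k) S f \<longleftrightarrow>
     (\<forall>x\<in>S. f differentiable (at x)) \<and> (\<forall>v. Ck_on k S (\<lambda>x. frechet_derivative f (at x) v))"

definition smooth_on :: "'a::euclidean_space set \<Rightarrow> ('a \<Rightarrow> real) \<Rightarrow> bool" where
  "smooth_on S f \<longleftrightarrow> (\<forall>k. Ck_on k S f)"

definition gradient :: "('a::euclidean_space \<Rightarrow> real) \<Rightarrow> 'a \<Rightarrow> 'a" where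
  "gradient f x = (\<Sum>b\<in>Basis. frechet_derivative f (at x) b *\<^sub>R b)"

text \<open>Near each boundary point the domain is, after a rotation of the axes taking the last
  coordinate direction to \<open>e\<close>, the part of a ball above the graph of a smooth function of the other
  coordinates. That function is the restriction of \<open>h\<close> to the hyperplane orthogonal to \<open>e\<close>.\<close>

definition smooth_bounded_domain :: "'a::euclidean_space set \<Rightarrow> bool" where
  "smooth_bounded_domain \<Omega> \<longleftrightarrow>
     open \<Omega> \<and> connected \<Omega> \<and> \<Omega> \<noteq> {} \<and> bounded \<Omega> \<and>
     (\<forall>p\<in>frontier \<Omega>. \<exists>r>0. \<exists>e h. norm e = 1 \<and> smooth_on UNIV h \<and>
        \<Omega> \<inter> ball p r = {x \<in> ball p r. h (x - (x \<bullet> e) *\<^sub>R e) < x \<bullet> e})"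

definition inner_domain :: "'a::euclidean_space set \<Rightarrow> real \<Rightarrow> 'a set" where
  "inner_domain \<Omega> \<delta> = {x\<in>\<Omega>. infdist x (frontier \<Omega>) > \<delta>}"


section \<open>N-functions and the Lieberman conditions\<close>

text \<open>Functions on \<open>[0, \<infinity>)\<close> are total functions on the reals whose values at negative arguments
  are never used.\<close>

definition N_function :: "(real \<Rightarrow> real) \<Rightarrow> bool" where
  "N_function G \<longleftrightarrow>
     (\<forall>t\<ge>0. 0 \<le> G t) \<and> (\<forall>t>0. 0 < G t) \<and> convex_on {0..} G \<and>
     ((\<lambda>t. G t / t) \<longlongrightarrow> 0) (at_right 0) \<and> filterlim (\<lambda>t. G t / t) at_top at_top"

definition lieberman :: "real \<Rightarrow> real \<Rightarrow> (real \<Rightarrow> real) \<Rightarrow> (real \<Rightarrow> real) \<Rightarrow> bool" where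
  "lieberman \<delta>0 g0 G g \<longleftrightarrow>
     (\<forall>t\<ge>0. (G has_real_derivative g t) (at t within {0..})) \<and>
     continuous_on {0..} g \<and> g C1_differentiable_on {0<..} \<and>
     (\<forall>t>0. \<delta>0 \<le> t * deriv g t / g t \<and> t * deriv g t / g t \<le> g0)"


section \<open>Orlicz and Orlicz--Sobolev spaces\<close>

text \<open>Elements of these spaces are represented by functions on the whole space; only the
  almost-everywhere class of the restriction to \<open>\<Omega>\<close> matters. The norms take values in
  \<open>[0, \<infinity>]\<close>, so that they are meaningful without a prior membership proof.\<close>

definition luxemburg_norm ::
    "(real \<Rightarrow> real) \<Rightarrow> 'a::euclidean_space set \<Rightarrow> ('a \<Rightarrow> 'b::euclidean_space) \<Rightarrow> ennreal" where
  "luxemburg_norm G \<Omega> u =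
     Inf {ennreal l | l. 0 < l \<and> (\<integral>\<^sup>+x\<in>\<Omega>. ennreal (G (norm (u x) / l)) \<partial>lebesgue) \<le> 1}"

definition orlicz_space ::
    "(real \<Rightarrow> real) \<Rightarrow> 'a::euclidean_space set \<Rightarrow> ('a \<Rightarrow> 'b::euclidean_space) set" where
  "orlicz_space G \<Omega> = {u \<in> borel_measurable (lebesgue_on \<Omega>). luxemburg_norm G \<Omega> u < \<infinity>}"

definition test_function :: "'a::euclidean_space set \<Rightarrow> ('a \<Rightarrow> real) \<Rightarrow> bool" where
  "test_function \<Omega> \<phi> \<longleftrightarrow>
     smooth_on UNIV \<phi> \<and> (\<exists>K. compact K \<and> K \<subseteq> \<Omega> \<and> (\<forall>x. x \<notin> K \<longrightarrow> \<phi> x = 0))"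

definition has_weak_gradient ::
    "'a::euclidean_space set \<Rightarrow> ('a \<Rightarrow> real) \<Rightarrow> ('a \<Rightarrow> 'a) \<Rightarrow> bool" where
  "has_weak_gradient \<Omega> u V \<longleftrightarrow>
     (\<forall>K. compact K \<and> K \<subseteq> \<Omega> \<longrightarrow> set_integrable lebesgue K u \<and> set_integrable lebesgue K V) \<and>
     (\<forall>\<phi>. test_function \<Omega> \<phi> \<longrightarrow>
        (LINT x:\<Omega>|lebesgue. u x *\<^sub>R gradient \<phi> x) = - (LINT x:\<Omega>|lebesgue. \<phi> x *\<^sub>R V x))"

text \<open>A representative of the weak gradient, which is unique up to null sets when it exists.\<close>

definition weak_gradient :: "'a::euclidean_space set \<Rightarrow> ('a \<Rightarrow> real) \<Rightarrow> 'a \<Rightarrow> 'a" where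
  "weak_gradient \<Omega> u = (SOME V. has_weak_gradient \<Omega> u V)"

definition orlicz_sobolev ::
    "(real \<Rightarrow> real) \<Rightarrow> 'a::euclidean_space set \<Rightarrow> ('a \<Rightarrow> real) set" where
  "orlicz_sobolev G \<Omega> =
     {u \<in> orlicz_space G \<Omega>. \<exists>V. has_weak_gradient \<Omega> u V \<and> V \<in> orlicz_space G \<Omega>}"

definition orlicz_sobolev_norm ::
    "(real \<Rightarrow> real) \<Rightarrow> 'a::euclidean_space set \<Rightarrow> ('a \<Rightarrow> real) \<Rightarrow> ennreal" where
  "orlicz_sobolev_norm G \<Omega> u = luxemburg_norm G \<Omega> u + luxemburg_norm G \<Omega> (weak_gradient \<Omega> u)"

text \<open>Zero boundary values: the closure of the test functions in the Orlicz--Sobolev norm.\<close>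

definition orlicz_sobolev_0 ::
    "(real \<Rightarrow> real) \<Rightarrow> 'a::euclidean_space set \<Rightarrow> ('a \<Rightarrow> real) set" where
  "orlicz_sobolev_0 G \<Omega> =
     {u \<in> orlicz_sobolev G \<Omega>. \<exists>\<phi>. (\<forall>k::nat. test_function \<Omega> (\<phi> k)) \<and>
        (\<lambda>k. orlicz_sobolev_norm G \<Omega> (\<lambda>x. u x - \<phi> k x)) \<longlonglongrightarrow> 0}"


section \<open>The weight, the cut-off and the boundary datum\<close>

definition admissible_weight :: "'a::euclidean_space set \<Rightarrow> ('a \<Rightarrow> real) \<Rightarrow> bool" where
  "admissible_weight \<Omega> a \<longleftrightarrow>
     continuous_on \<Omega> a \<and> (\<forall>x\<in>\<Omega>. 0 < a x) \<and> bounded (a ` \<Omega>) \<and> 0 < (INF x\<in>\<Omega>. a x)"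

definition smooth_cutoff :: "real \<Rightarrow> (real \<Rightarrow> real) \<Rightarrow> bool" where
  "smooth_cutoff \<epsilon> \<Gamma> \<longleftrightarrow>
     smooth_on UNIV \<Gamma> \<and> range \<Gamma> \<subseteq> {0..1} \<and> (\<forall>s\<le>0. \<Gamma> s = 0) \<and> (\<forall>s\<ge>\<epsilon>. \<Gamma> s = 1)"

text \<open>\<open>C\<^sup>1\<^sup>,\<^sup>\<alpha>\<close> up to the boundary of a bounded domain. The uniform Hoelder bound in the interior makes the
  gradient extend continuously to the closure.\<close>

definition C1_holder_closure :: "real \<Rightarrow> 'a::euclidean_space set \<Rightarrow> ('a \<Rightarrow> real) \<Rightarrow> bool" where
  "C1_holder_closure \<alpha> \<Omega> \<psi> \<longleftrightarrow>
     continuous_on (closure \<Omega>) \<psi> \<and> (\<forall>x\<in>\<Omega>. \<psi> differentiable (at x)) \<and>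
     (\<exists>C. \<forall>x\<in>\<Omega>. \<forall>y\<in>\<Omega>. norm (gradient \<psi> x - gradient \<psi> y) \<le> C * dist x y powr \<alpha>)"

definition C01_norm :: "'a::euclidean_space set \<Rightarrow> ('a \<Rightarrow> real) \<Rightarrow> ennreal" where
  "C01_norm \<Omega> \<psi> =
     (SUP x\<in>\<Omega>. ennreal \<bar>\<psi> x\<bar>) +
     (SUP (x, y)\<in>{(x, y). x \<in> \<Omega> \<and> y \<in> \<Omega> \<and> x \<noteq> y}. ennreal (\<bar>\<psi> x - \<psi> y\<bar> / dist x y))"

text \<open>On the compact boundary the infimum and supremum of the continuous datum are its minimum and
  maximum.\<close>

definition admissible_datum ::
    "(real \<Rightarrow> real) \<Rightarrow> 'a::euclidean_space set \<Rightarrow> real \<Rightarrow> ('a \<Rightarrow> real) \<Rightarrow> bool" where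
  "admissible_datum G \<Omega> \<epsilon> \<psi> \<longleftrightarrow>
     (\<exists>\<alpha>. 0 < \<alpha> \<and> \<alpha> \<le> 1 \<and> C1_holder_closure \<alpha> \<Omega> \<psi>) \<and> \<psi> \<in> orlicz_sobolev G \<Omega> \<and>
     \<epsilon> < (INF x\<in>frontier \<Omega>. \<psi> x)"

definition boundary_layer_size ::
    "(real \<Rightarrow> real) \<Rightarrow> 'a::euclidean_space set \<Rightarrow> real \<Rightarrow> ('a \<Rightarrow> real) \<Rightarrow> ennreal" where
  "boundary_layer_size G \<Omega> \<delta> \<psi> =
     ennreal (SUP x\<in>frontier \<Omega>. \<psi> x) +
     (\<integral>\<^sup>+x\<in>\<Omega> - inner_domain \<Omega> \<delta>. ennreal (G (norm (gradient \<psi> x))) \<partial>lebesgue)"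


section \<open>The variational problem\<close>

definition energy ::
    "(real \<Rightarrow> real) \<Rightarrow> 'a::euclidean_space set \<Rightarrow> ('a \<Rightarrow> real) \<Rightarrow> (real \<Rightarrow> real) \<Rightarrow> ('a \<Rightarrow> real) \<Rightarrow> ennreal" where
  "energy G \<Omega> a \<Gamma> u =
     (\<integral>\<^sup>+x\<in>\<Omega>. ennreal (G (norm (weak_gradient \<Omega> u x)) + a x * \<Gamma> (u x)) \<partial>lebesgue)"

definition dirichlet_class ::
    "(real \<Rightarrow> real) \<Rightarrow> 'a::euclidean_space set \<Rightarrow> ('a \<Rightarrow> real) \<Rightarrow> ('a \<Rightarrow> real) set" where
  "dirichlet_class G \<Omega> \<psi> =
     {v \<in> orlicz_sobolev G \<Omega>. (\<lambda>x. v x - \<psi> x) \<in> orlicz_sobolev_0 G \<Omega>}"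

definition energy_minimizer ::
    "(real \<Rightarrow> real) \<Rightarrow> 'a::euclidean_space set \<Rightarrow> ('a \<Rightarrow> real) \<Rightarrow> (real \<Rightarrow> real) \<Rightarrow> ('a \<Rightarrow> real) \<Rightarrow> ('a \<Rightarrow> real) \<Rightarrow> bool"
  where
  "energy_minimizer G \<Omega> a \<Gamma> \<psi> u \<longleftrightarrow>
     u \<in> dirichlet_class G \<Omega> \<psi> \<and> (\<forall>v\<in>dirichlet_class G \<Omega> \<psi>. energy G \<Omega> a \<Gamma> u \<le> energy G \<Omega> a \<Gamma> v)"

text \<open>Weak solution of \<open>- div (g(|\<nabla>u|)/|\<nabla>u| \<nabla>u) = 0\<close> in \<open>\<Omega>\<close>, \<open>u = \<psi>\<close> on the boundary. The flux is
  \<open>0\<close> where the gradient vanishes.\<close>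

definition g_harmonic_solution ::
    "(real \<Rightarrow> real) \<Rightarrow> (real \<Rightarrow> real) \<Rightarrow> 'a::euclidean_space set \<Rightarrow> ('a \<Rightarrow> real) \<Rightarrow> ('a \<Rightarrow> real) \<Rightarrow> bool" where
  "g_harmonic_solution G g \<Omega> \<psi> u \<longleftrightarrow>
     u \<in> dirichlet_class G \<Omega> \<psi> \<and>
     (\<forall>\<phi>. test_function \<Omega> \<phi> \<longrightarrow>
        (LINT x:\<Omega>|lebesgue.
           ((g (norm (weak_gradient \<Omega> u x)) / norm (weak_gradient \<Omega> u x)) *\<^sub>R weak_gradient \<Omega> u x)
             \<bullet> gradient \<phi> x) = 0)"

end

theory Submission
  imports Defs
begin

text \<open>
  Why a minimizer beats the \<open>g\<close>-harmonic function. All boundary values exceed \<open>\<epsilon>\<close>, and a comparison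
  argument shows that the \<open>g\<close>-harmonic \<open>u0\<close> then stays above \<open>\<epsilon>\<close> almost everywhere
  (\<open>g_harmonic_lower_bound\<close>). There the cut-off \<open>\<Gamma>\<close> equals \<open>1\<close>, so \<open>u0\<close> pays at least the whole integral of
  \<open>a\<close> (\<open>energy_solution_ge\<close>). A function that vanishes on the inner domain pays the weight only in the
  boundary layer and saves at least \<open>inf a\<close> times the volume of the inner domain, an amount that is
  independent of \<open>\<epsilon>\<close> and \<open>\<psi>\<close> (\<open>integral_gap\<close>). Such a function with the right boundary values is \<open>\<eta>\<close> times
  \<open>\<psi>\<close>, where \<open>\<eta>\<close> is a fixed cut-off supported in the layer and \<open>\<psi>\<close> is first truncated smoothly
  at \<open>0\<close> and at the maximum of its boundary values. The truncation makes the maximum over the boundary, the only pointwise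
  control on \<open>\<psi>\<close>, sufficient: the gradient of the product is at most \<open>|\<nabla>\<psi>|\<close> plus a constant times that
  maximum (\<open>competitor\<close>), and doubling of \<open>G\<close> bounds its energy by a multiple of \<open>c0\<close>
  (\<open>energy_competitor_le\<close>).

  Membership of the competitor in the Dirichlet class and the use of non-smooth test
  functions rest on a calculus of \<open>C\<^sup>1\<close> functions. Mollification approximates compactly supported \<open>C\<^sup>1\<close>
  functions by test functions together with their gradients (\<open>test_function_approximation\<close>). A \<open>C\<^sup>1\<close>
  function with bounded gradient that vanishes on the boundary has zero boundary values in the
  Orlicz--Sobolev sense (\<open>C1_on_orlicz_sobolev_0\<close>): cutting off its values near zero leaves a compact
  support, and the discarded part has small gradient because the gradient vanishes almost
  everywhere on the zero set. Everything built from \<open>\<psi>\<close> stays \<open>C\<^sup>1\<close> in \<open>\<Omega>\<close>, because truncations are done by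
  the \<open>C\<^sup>1\<close> functions \<open>ramp\<close> and \<open>trunc\<close> of the values.
\<close>

section \<open>Smooth bumps and mollification\<close>

text \<open>Smoothness is a statement about all iterated directional derivatives, so membership in a class
that is closed under differentiation proves it without any formula for higher derivatives. The
bump and the convolutions below are handled in this way.\<close>

lemma smooth_on_coinduct:
  fixes f :: "'a::euclidean_space \<Rightarrow> real"
  assumes "P f"
    and diff: "\<And>f x. P f \<Longrightarrow> f differentiable (at x)"
    and step: "\<And>f v. P f \<Longrightarrow> P (\<lambda>x. frechet_derivative f (at x) v)"
  shows "smooth_on UNIV f"
proof -
  have "P f \<Longrightarrow> Ck_on k UNIV f" for k f
  proof (induction k arbitrary: f)
    case 0
    then show ?case
      using diff by (simp add: differentiable_on_def differentiable_imp_continuous_on)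
  next
    case (Suc k)
    then show ?case using diff step by simp
  qed
  with \<open>P f\<close> show ?thesis by (simp add: smooth_on_def)
qed

lemma
  assumes "smooth_on UNIV f"
  shows smooth_on_differentiable: "f differentiable (at x)"
    and smooth_on_continuous: "continuous_on S f"
    and smooth_on_derivative: "smooth_on UNIV (\<lambda>x. frechet_derivative f (at x) v)"
proof -
  have *: "Ck_on k UNIV f" for k using assms by (simp add: smooth_on_def)
  show "f differentiable (at x)" using *[of 1] by simp
  have "continuous_on UNIV f" using *[of 0] by simp
  then show "continuous_on S f" by (rule continuous_on_subset) simp
  show "smooth_on UNIV (\<lambda>x. frechet_derivative f (at x) v)"
    unfolding smooth_on_def
  proof
    fix k show "Ck_on k UNIV (\<lambda>x. frechet_derivative f (at x) v)"
      using *[of "Suc k"] by simp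
  qed
qed

text \<open>The classical flat function \<open>exp (- 1 / s)\<close> together with its quotients by powers of \<open>s\<close>: the derivative of
one of them is a combination of two others.\<close>

definition flat :: "nat \<Rightarrow> real \<Rightarrow> real" where
  "flat m s = (if 0 < s then exp (- 1 / s) / s ^ m else 0)"

lemma flat_tendsto_0: "(flat m \<longlongrightarrow> 0) (at 0)"
proof -
  have "((\<lambda>s. (inverse s) ^ m / exp (inverse s)) \<longlongrightarrow> (0::real)) (at_right 0)"
    by (rule filterlim_compose[OF tendsto_power_div_exp_0 filterlim_inverse_at_top_right])
  moreover have "\<forall>\<^sub>F s::real in at_right 0. (inverse s) ^ m / exp (inverse s) = flat m s"
    by (auto simp: eventually_at_filter flat_def exp_minus field_simps)
  ultimately have "(flat m \<longlongrightarrow> 0) (at_right 0)" by (rule Lim_transform_eventually)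
  moreover have "(flat m \<longlongrightarrow> 0) (at_left 0)"
    by (rule Lim_transform_eventually[OF tendsto_const])
       (auto simp: eventually_at_filter flat_def)
  ultimately show ?thesis by (simp add: filterlim_split_at_real)
qed

lemma flat_has_derivative:
  "(flat m has_real_derivative (flat (m + 2) s - m * flat (m + 1) s)) (at s)"
proof (cases s "0::real" rule: linorder_cases)
  case less
  have "((\<lambda>s. 0) has_real_derivative 0) (at s)" by simp
  then show ?thesis
    using less by (subst DERIV_cong_ev[where g = "\<lambda>s. 0" and y = s and v = 0])
      (auto simp: flat_def intro!: eventually_mono[OF eventually_nhds_in_open[of "{..<0}"]])
next
  case equal
  have "(\<lambda>h. (flat m (0 + h) - flat m 0) / h) = flat (m + 1)"
    by (auto simp: flat_def fun_eq_iff)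
  then show ?thesis
    using flat_tendsto_0[of "m + 1"] equal by (simp add: DERIV_def flat_def)
next
  case greater
  have ev: "\<forall>\<^sub>F x in nhds s. flat m x = exp (- 1 / x) / x ^ m"
    using greater by (auto simp: flat_def intro!: eventually_mono[OF eventually_nhds_in_open[of "{0<..}"]])
  have *: "((\<lambda>x. exp (- 1 / x) / x ^ m) has_real_derivative
      (exp (- 1 / s) * (1 / s\<^sup>2) * s ^ m - exp (- 1 / s) * (m * s ^ (m - 1))) / (s ^ m * s ^ m)) (at s)"
    using greater by (auto intro!: derivative_eq_intros simp: power2_eq_square)
  have "(exp (- 1 / s) * (1 / s\<^sup>2) * s ^ m - exp (- 1 / s) * (m * s ^ (m - 1))) / (s ^ m * s ^ m)
     = exp (- 1 / s) / s ^ (m + 2) - m * (exp (- 1 / s) / s ^ (m + 1))"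
    using greater by (cases m) (auto simp: field_simps power2_eq_square)
  then show ?thesis
    using * greater by (subst DERIV_cong_ev[OF refl ev refl]) (auto simp: flat_def)
qed

text \<open>The algebra generated by the linear functions and the bumps \<open>flat m (s - |x|\<^sup>2)\<close>, which are supported in
the ball of radius \<open>sqrt s\<close>. It is closed under directional derivatives, hence consists of smooth
functions.\<close>

inductive_set bump_algebra :: "real \<Rightarrow> ('a::euclidean_space \<Rightarrow> real) set" for s where
  const: "(\<lambda>x. c) \<in> bump_algebra s"
| linear: "(\<lambda>x. x \<bullet> v) \<in> bump_algebra s"
| flat: "(\<lambda>x. flat m (s - x \<bullet> x)) \<in> bump_algebra s"
| add: "f \<in> bump_algebra s \<Longrightarrow> h \<in> bump_algebra s \<Longrightarrow> (\<lambda>x. f x + h x) \<in> bump_algebra s"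
| mult: "f \<in> bump_algebra s \<Longrightarrow> h \<in> bump_algebra s \<Longrightarrow> (\<lambda>x. f x * h x) \<in> bump_algebra s"

lemma bump_algebra_derivative:
  assumes "f \<in> bump_algebra s"
  shows "\<exists>D. (\<forall>x. (f has_derivative D x) (at x)) \<and> (\<forall>v. (\<lambda>x. D x v) \<in> bump_algebra s)"
  using assms
proof induction
  case (const c)
  show ?case by (rule exI[of _ "\<lambda>x v. 0"]) (auto intro: bump_algebra.const)
next
  case (linear w)
  show ?case
    by (rule exI[of _ "\<lambda>x v. v \<bullet> w"])
       (auto intro!: derivative_eq_intros bump_algebra.const)
next
  case (flat m)
  let ?d = "\<lambda>t. flat (m + 2) t + (- real m) * flat (m + 1) t"
  show ?case
  proof (rule exI[of _ "\<lambda>x v. ?d (s - x \<bullet> x) * ((-2) * (x \<bullet> v))"], intro conjI allI)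
    fix x
    have 1: "((\<lambda>x::'a. s - x \<bullet> x) has_derivative (\<lambda>v. (-2) * (x \<bullet> v))) (at x)"
      by (auto intro!: derivative_eq_intros simp: inner_commute)
    have 2: "(flat m has_derivative (\<lambda>t. ?d (s - x \<bullet> x) * t)) (at (s - x \<bullet> x))"
      using flat_has_derivative[of m "s - x \<bullet> x"] by (simp add: has_field_derivative_def)
    show "((\<lambda>x. flat m (s - x \<bullet> x)) has_derivative
            (\<lambda>v. ?d (s - x \<bullet> x) * ((-2) * (x \<bullet> v)))) (at x)"
      using diff_chain_at[OF 1 2] by (simp only: o_def)
  next
    fix v
    show "(\<lambda>x. ?d (s - x \<bullet> x) * ((-2) * (x \<bullet> v))) \<in> bump_algebra s"
      by (intro bump_algebra.intros)
  qed
next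
  case (add f h)
  then obtain D E where "\<And>x. (f has_derivative D x) (at x)" "\<And>v. (\<lambda>x. D x v) \<in> bump_algebra s"
    "\<And>x. (h has_derivative E x) (at x)" "\<And>v. (\<lambda>x. E x v) \<in> bump_algebra s" by blast
  then show ?case
    by (intro exI[of _ "\<lambda>x v. D x v + E x v"])
       (auto intro!: derivative_eq_intros bump_algebra.add)
next
  case (mult f h)
  then obtain D E where "\<And>x. (f has_derivative D x) (at x)" "\<And>v. (\<lambda>x. D x v) \<in> bump_algebra s"
    "\<And>x. (h has_derivative E x) (at x)" "\<And>v. (\<lambda>x. E x v) \<in> bump_algebra s" by blast
  then show ?case using mult
    by (intro exI[of _ "\<lambda>x v. f x * E x v + D x v * h x"])
       (auto intro!: derivative_eq_intros bump_algebra.intros)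
qed

lemma bump_algebra_smooth:
  assumes "f \<in> bump_algebra s"
  shows "smooth_on UNIV f"
proof (rule smooth_on_coinduct[where P = "\<lambda>f. f \<in> bump_algebra s", OF assms])
  fix f :: "'a \<Rightarrow> real" and x v assume "f \<in> bump_algebra s"
  then obtain D where D: "\<And>x. (f has_derivative D x) (at x)" "\<And>v. (\<lambda>x. D x v) \<in> bump_algebra s"
    using bump_algebra_derivative by blast
  show "f differentiable at x" using D(1) differentiable_def by blast
  have "(\<lambda>x. frechet_derivative f (at x) v) = (\<lambda>x. D x v)"
    using frechet_derivative_at[OF D(1)] by simp
  then show "(\<lambda>x. frechet_derivative f (at x) v) \<in> bump_algebra s" using D(2) by simp
qed

lemma continuous_compact_support_integrable:
  fixes f :: "'a::euclidean_space \<Rightarrow> 'b::euclidean_space"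
  assumes "continuous_on UNIV f" "compact K" "\<And>x. x \<notin> K \<Longrightarrow> f x = 0"
  shows "integrable lborel f"
proof -
  have "integrable lborel (\<lambda>x. indicator K x *\<^sub>R f x)"
    using assms(1,2) by (intro borel_integrable_compact) (auto intro: continuous_on_subset)
  also have "(\<lambda>x. indicator K x *\<^sub>R f x) = f"
    using assms(3) by (auto simp: indicator_def)
  finally show ?thesis .
qed

lemma lborel_integral_translate:
  fixes f :: "'a::euclidean_space \<Rightarrow> 'b::euclidean_space"
  assumes "f \<in> borel_measurable borel"
  shows "(LINT x|lborel. f (x + c)) = (LINT x|lborel. f x)"
proof -
  have "(LINT x|lborel. f x) = (LINT x|distr lborel borel ((+) c). f x)"
    by (simp add: lborel_distr_plus)
  also have "\<dots> = (LINT x|lborel. f (c + x))"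
    using assms by (subst integral_distr) auto
  finally show ?thesis by (simp add: add.commute)
qed

definition mollifier :: "real \<Rightarrow> 'a::euclidean_space \<Rightarrow> real" where
  "mollifier \<sigma> x = flat 0 (\<sigma>\<^sup>2 - x \<bullet> x) / (LINT y|lborel. flat 0 (\<sigma>\<^sup>2 - (y::'a) \<bullet> y))"

lemma
  fixes x :: "'a::euclidean_space"
  assumes "0 < \<sigma>"
  shows mollifier_smooth: "smooth_on UNIV (mollifier \<sigma> :: 'a \<Rightarrow> real)"
    and mollifier_nonneg: "0 \<le> mollifier \<sigma> x"
    and mollifier_even: "mollifier \<sigma> (- x) = mollifier \<sigma> x"
    and mollifier_support: "\<sigma> < norm x \<Longrightarrow> mollifier \<sigma> x = 0"
    and mollifier_integral: "(LINT y|lborel. mollifier \<sigma> (y::'a)) = 1"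
proof -
  let ?b = "\<lambda>y::'a. flat 0 (\<sigma>\<^sup>2 - y \<bullet> y)"
  let ?c = "LINT y|lborel. ?b y"
  have b_smooth: "smooth_on UNIV ?b"
    by (rule bump_algebra_smooth[of _ "\<sigma>\<^sup>2"]) (rule bump_algebra.flat)
  have b_cont: "continuous_on UNIV ?b" by (rule smooth_on_continuous[OF b_smooth])
  have b_pos: "0 < ?b y \<longleftrightarrow> norm y < \<sigma>" for y
    using assms by (simp add: flat_def dot_square_norm power_mono_iff) (smt (verit) norm_ge_zero power2_less_imp_less power_strict_mono pos2)
  have b_nonneg: "0 \<le> ?b y" for y by (simp add: flat_def)
  have b_int: "integrable lborel ?b"
    using b_cont by (rule continuous_compact_support_integrable[where K = "cball 0 \<sigma>"])
      (use b_pos b_nonneg in \<open>auto, metis less_eq_real_def\<close>)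
  have "?c \<noteq> 0"
  proof
    assume "?c = 0"
    then have "AE y in lborel. ?b y = 0"
      using b_int b_nonneg by (subst (asm) integral_nonneg_eq_0_iff_AE) auto
    then have "AE y in lborel. y \<notin> ball (0::'a) \<sigma>"
      by eventually_elim (metis b_pos less_irrefl mem_ball_0)
    then have "emeasure lborel (ball (0::'a) \<sigma>) = 0"
      by (subst (asm) AE_iff_measurable[where N = "ball (0::'a) \<sigma>"]) auto
    then show False
      using content_ball_pos[OF assms, of "0::'a"]
      by (simp add: measure_def)
  qed
  then have c: "0 < ?c" using Bochner_Integration.integral_nonneg[of lborel ?b] b_nonneg by (simp add: less_le)
  have eq: "(mollifier \<sigma> :: 'a \<Rightarrow> real) = (\<lambda>y. (1 / ?c) * ?b y)"
    by (auto simp: mollifier_def fun_eq_iff)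
  show "smooth_on UNIV (mollifier \<sigma> :: 'a \<Rightarrow> real)"
    unfolding eq by (rule bump_algebra_smooth[of _ "\<sigma>\<^sup>2"]) (intro bump_algebra.intros)
  show "0 \<le> mollifier \<sigma> x" using c b_nonneg by (simp add: mollifier_def)
  show "mollifier \<sigma> (- x) = mollifier \<sigma> x" by (simp add: mollifier_def)
  show "\<sigma> < norm x \<Longrightarrow> mollifier \<sigma> x = 0"
    using b_pos[of x] b_nonneg[of x] by (auto simp: mollifier_def)
  show "(LINT y|lborel. mollifier \<sigma> (y::'a)) = 1"
    unfolding eq using c by simp
qed

text \<open>Convolution; the difference is in the argument of the kernel, so that all derivatives fall on the
smooth factor.\<close>

definition mollify :: "('a \<Rightarrow> real) \<Rightarrow> ('a::euclidean_space \<Rightarrow> real) \<Rightarrow> 'a \<Rightarrow> real" where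
  "mollify \<rho> f x = (LINT y|lborel. f y * \<rho> (x - y))"

lemma mollify_has_derivative:
  fixes f :: "'a::euclidean_space \<Rightarrow> real"
  assumes "continuous_on UNIV f" "compact K" "\<And>x. x \<notin> K \<Longrightarrow> f x = 0" "smooth_on UNIV \<rho>"
  shows "(mollify \<rho> f has_derivative (\<lambda>v. mollify (\<lambda>z. frechet_derivative \<rho> (at z) v) f x)) (at x)"
proof -
  obtain c where c: "K \<subseteq> cbox (- c) c"
    using bounded_subset_cbox_symmetric[OF compact_imp_bounded[OF assms(2)]] by blast
  have f0: "f y = 0" if "y \<notin> cbox (- c) c" for y using that assms(3) c by blast
  have mol: "mollify r f z = integral (cbox (- c) c) (\<lambda>y. f y * r (z - y))"
    if "continuous_on UNIV r" for r z
  proof -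
    have "integrable lborel (\<lambda>y. f y * r (z - y))"
      by (rule continuous_compact_support_integrable[where K = K])
         (use assms that in \<open>auto intro!: continuous_intros intro: continuous_on_compose2\<close>)
    then have "mollify r f z = integral UNIV (\<lambda>y. f y * r (z - y))"
      by (simp add: mollify_def integral_lborel)
    also have "\<dots> = integral (cbox (- c) c) (\<lambda>y. f y * r (z - y))"
      by (rule integral_spike_set) (auto intro!: negligible_subset[of "{}"] simp: f0)
    finally show ?thesis .
  qed
  let ?D = "\<lambda>z. frechet_derivative \<rho> (at z)"
  let ?B = "\<lambda>z y. f y *\<^sub>R Blinfun (?D (z - y))"
  have D: "(\<rho> has_derivative ?D z) (at z)" for z
    using smooth_on_differentiable[OF assms(4)] frechet_derivative_works by blast
  have DB: "blinfun_apply (Blinfun (?D z)) = ?D z" for z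
    using D has_derivative_bounded_linear bounded_linear_Blinfun_apply by blast
  have contD: "continuous_on UNIV (\<lambda>z. ?D z v)" for v
    using smooth_on_derivative[OF assms(4)] by (rule smooth_on_continuous)
  have contB: "continuous_on UNIV (\<lambda>z. Blinfun (?D z))"
    by (rule continuous_on_blinfun_componentwise) (simp add: DB contD)
  have contF: "continuous_on (UNIV \<times> cbox (- c) c) (\<lambda>(z, y). ?B z y)"
    unfolding case_prod_beta
    by (intro continuous_intros continuous_on_compose2[OF contB]
         continuous_on_compose2[OF assms(1)]) auto
  have cont1: "continuous_on (cbox (- c) c) (?B z)" for z
    by (intro continuous_intros continuous_on_compose2[OF contB]
         continuous_on_subset[OF assms(1)]) auto
  have "((\<lambda>z. integral (cbox (- c) c) (\<lambda>y. f y * \<rho> (z - y))) has_derivative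
     blinfun_apply (integral (cbox (- c) c) (?B x))) (at x within UNIV)"
  proof (rule leibniz_rule[OF _ _ contF])
    fix z y :: 'a
    have "((\<lambda>z. \<rho> (z - y)) has_derivative ?D (z - y)) (at z)"
      by (rule has_derivative_compose[of "\<lambda>z. z - y" "\<lambda>h. h" z UNIV \<rho>, OF _ D])
         (auto intro!: derivative_eq_intros)
    then show "((\<lambda>z. f y * \<rho> (z - y)) has_derivative blinfun_apply (?B z y)) (at z within UNIV)"
      by (auto intro!: derivative_eq_intros simp: DB blinfun.scaleR_left)
  next
    fix z :: 'a
    show "(\<lambda>y. f y * \<rho> (z - y)) integrable_on cbox (- c) c"
      by (intro integrable_continuous continuous_intros continuous_on_compose2[OF smooth_on_continuous[OF assms(4), of UNIV]]
           continuous_on_subset[OF assms(1)]) auto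
  qed auto
  moreover have "blinfun_apply (integral (cbox (- c) c) (?B x)) = (\<lambda>v. mollify (\<lambda>z. ?D z v) f x)"
  proof
    fix v
    have "blinfun_apply (integral (cbox (- c) c) (?B x)) v = integral (cbox (- c) c) (\<lambda>y. blinfun_apply (?B x y) v)"
      by (rule blinfun_apply_integral) (intro integrable_continuous cont1)
    also have "\<dots> = mollify (\<lambda>z. ?D z v) f x"
      by (simp add: mol[OF contD] blinfun.scaleR_left DB)
    finally show "blinfun_apply (integral (cbox (- c) c) (?B x)) v = mollify (\<lambda>z. ?D z v) f x" .
  qed
  ultimately show ?thesis
    unfolding mol[OF smooth_on_continuous[OF assms(4)], abs_def] by simp
qed

lemma mollify_smooth:
  assumes "continuous_on UNIV f" "compact K" "\<And>x. x \<notin> K \<Longrightarrow> f x = 0" "smooth_on UNIV \<rho>"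
  shows "smooth_on UNIV (mollify \<rho> f)"
proof (rule smooth_on_coinduct[where P = "\<lambda>g. \<exists>\<rho>. smooth_on UNIV \<rho> \<and> g = mollify \<rho> f"])
  show "\<exists>\<rho>'. smooth_on UNIV \<rho>' \<and> mollify \<rho> f = mollify \<rho>' f" using assms(4) by blast
next
  fix g x assume "\<exists>\<rho>. smooth_on UNIV \<rho> \<and> g = mollify \<rho> f"
  then show "g differentiable at x"
    using mollify_has_derivative[OF assms(1-3)] differentiable_def by blast
next
  fix g v assume "\<exists>\<rho>. smooth_on UNIV \<rho> \<and> g = mollify \<rho> f"
  then obtain \<rho> where \<rho>: "smooth_on UNIV \<rho>" "g = mollify \<rho> f" by blast
  have "(\<lambda>x. frechet_derivative g (at x) v) = mollify (\<lambda>z. frechet_derivative \<rho> (at z) v) f"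
    using frechet_derivative_at[OF mollify_has_derivative[OF assms(1-3) \<rho>(1)]]
    by (auto simp: \<rho>(2) fun_eq_iff)
  then show "\<exists>\<rho>. smooth_on UNIV \<rho> \<and> (\<lambda>x. frechet_derivative g (at x) v) = mollify \<rho> f"
    using smooth_on_derivative[OF \<rho>(1)] by blast
qed

text \<open>Near \<open>x\<close> the mollification is an average of values of \<open>f\<close> over a ball of radius \<open>\<sigma>\<close>. Besides uniform
convergence this gives, with \<open>e = 0\<close>, exact values wherever \<open>f\<close> is constant on such a ball; supports and
plateaus are controlled by this case.\<close>

lemma mollify_close:
  fixes f :: "'a::euclidean_space \<Rightarrow> real"
  assumes "continuous_on UNIV f" "0 < \<sigma>" and e: "\<And>y. dist x y \<le> \<sigma> \<Longrightarrow> \<bar>f y - c\<bar> \<le> e"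
  shows "\<bar>mollify (mollifier \<sigma>) f x - c\<bar> \<le> e"
proof -
  let ?m = "\<lambda>y. mollifier \<sigma> (x - y)"
  have m: "mollifier \<sigma> (x - y) = mollifier \<sigma> (y + - x)" for y
    using mollifier_even[OF assms(2), of "x - y"] by simp
  have cm: "continuous_on UNIV (mollifier \<sigma> :: 'a \<Rightarrow> real)"
    by (rule smooth_on_continuous[OF mollifier_smooth[OF assms(2)]])
  have cm': "continuous_on UNIV ?m"
    by (intro continuous_intros continuous_on_compose2[OF cm]) auto
  have m0: "?m y = 0" if "y \<notin> cball x \<sigma>" for y
    using that mollifier_support[OF assms(2), of "x - y"] by (auto simp: dist_norm)
  have int_m: "integrable lborel ?m"
    by (rule continuous_compact_support_integrable[OF cm' compact_cball m0])
  have one: "(LINT y|lborel. ?m y) = 1"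
    unfolding m using cm
    by (subst lborel_integral_translate) (auto simp: mollifier_integral assms borel_measurable_continuous_onI)
  have int_f: "integrable lborel (\<lambda>y. f y * ?m y)"
    by (rule continuous_compact_support_integrable[where K = "cball x \<sigma>"])
       (use m0 in \<open>auto intro!: continuous_intros assms(1) cm'\<close>)
  have "mollify (mollifier \<sigma>) f x - c = (LINT y|lborel. f y * ?m y) - (LINT y|lborel. c * ?m y)"
    by (simp add: mollify_def one)
  also have "\<dots> = (LINT y|lborel. (f y - c) * ?m y)"
    by (subst Bochner_Integration.integral_diff[symmetric]) (auto simp: int_f int_m algebra_simps)
  finally have "\<bar>mollify (mollifier \<sigma>) f x - c\<bar> \<le> (LINT y|lborel. \<bar>(f y - c) * ?m y\<bar>)"
    by simp
  also have "\<dots> \<le> (LINT y|lborel. e * ?m y)"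
  proof (rule integral_mono)
    have "integrable lborel (\<lambda>y. f y * ?m y - c * ?m y)" using int_f int_m by simp
    then show "integrable lborel (\<lambda>y. \<bar>(f y - c) * ?m y\<bar>)" by (simp add: algebra_simps)
    show "\<bar>(f y - c) * ?m y\<bar> \<le> e * ?m y" for y
    proof (cases "dist x y \<le> \<sigma>")
      case True
      then show ?thesis using e[OF True] mollifier_nonneg[OF assms(2), of "x - y"]
        by (simp add: abs_mult mult_right_mono)
    next
      case False then show ?thesis using m0[of y] by auto
    qed
  qed (use int_m in simp)
  also have "\<dots> = e" by (simp add: one)
  finally show ?thesis .
qed


section \<open>Continuously differentiable functions and weak gradients\<close>

text \<open>The gradient is an argument, because the functions in question are differentiated by explicit
rules and their values outside the open set \<open>S\<close> are irrelevant.\<close>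

definition C1_on :: "'a::euclidean_space set \<Rightarrow> ('a \<Rightarrow> real) \<Rightarrow> ('a \<Rightarrow> 'a) \<Rightarrow> bool" where
  "C1_on S f V \<longleftrightarrow> (\<forall>x\<in>S. GDERIV f x :> V x) \<and> continuous_on S V"

lemma GDERIV_frechet:
  assumes "GDERIV f x :> D"
  shows "frechet_derivative f (at x) v = v \<bullet> D" "gradient f x = D"
proof -
  have *: "frechet_derivative f (at x) = (\<lambda>h. h \<bullet> D)"
    using frechet_derivative_at[of f] assms by (metis gderiv_def)
  then show "frechet_derivative f (at x) v = v \<bullet> D" by simp
  show "gradient f x = D"
    unfolding gradient_def * by (simp add: inner_commute[of _ D] euclidean_representation)
qed

lemma GDERIV_gradient:
  assumes "f differentiable at x"
  shows "GDERIV f x :> gradient f x"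
proof -
  let ?D = "frechet_derivative f (at x)"
  have D: "(f has_derivative ?D) (at x)" using assms frechet_derivative_works by blast
  have lin: "linear ?D" using D has_derivative_linear by blast
  have "?D h = h \<bullet> gradient f x" for h
  proof -
    have "?D h = ?D (\<Sum>b\<in>Basis. (h \<bullet> b) *\<^sub>R b)" by (simp add: euclidean_representation)
    also have "\<dots> = (\<Sum>b\<in>Basis. (h \<bullet> b) * ?D b)"
      using lin by (simp add: linear_sum linear_scale)
    also have "\<dots> = h \<bullet> gradient f x"
      unfolding gradient_def inner_sum_right by (simp add: mult.commute)
    finally show ?thesis .
  qed
  then have "?D = (\<lambda>h. h \<bullet> gradient f x)" by auto
  with D show ?thesis unfolding gderiv_def by simp
qed

lemma C1_on_GDERIV: "C1_on S f V \<Longrightarrow> x \<in> S \<Longrightarrow> GDERIV f x :> V x"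
  and C1_on_continuous_gradient: "C1_on S f V \<Longrightarrow> continuous_on S V"
  by (auto simp: C1_on_def)

lemma C1_on_continuous:
  assumes "C1_on S f V"
  shows "continuous_on S f"
proof -
  have "f differentiable at x" if "x \<in> S" for x
    using assms that by (auto simp: C1_on_def gderiv_def differentiable_def)
  then show ?thesis
    by (intro differentiable_imp_continuous_on)
       (auto simp: differentiable_on_def differentiable_at_withinI)
qed

lemma C1_on_mult:
  assumes "C1_on S f V" "C1_on S h W"
  shows "C1_on S (\<lambda>x. f x * h x) (\<lambda>x. f x *\<^sub>R W x + h x *\<^sub>R V x)"
  using assms C1_on_continuous[OF assms(1)] C1_on_continuous[OF assms(2)]
  unfolding C1_on_def by (auto intro!: GDERIV_mult continuous_intros)

lemma C1_on_diff:
  assumes "C1_on S f V" "C1_on S h W"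
  shows "C1_on S (\<lambda>x. f x - h x) (\<lambda>x. V x - W x)"
  using assms unfolding C1_on_def by (auto intro!: GDERIV_diff continuous_intros)

lemma C1_on_add:
  assumes "C1_on S f V" "C1_on S h W"
  shows "C1_on S (\<lambda>x. f x + h x) (\<lambda>x. V x + W x)"
  using assms unfolding C1_on_def by (auto intro!: GDERIV_add continuous_intros)

lemma C1_on_compose:
  assumes "C1_on S f V" "\<And>s. (T has_real_derivative T' s) (at s)" "continuous_on UNIV T'"
  shows "C1_on S (\<lambda>x. T (f x)) (\<lambda>x. T' (f x) *\<^sub>R V x)"
proof -
  have "continuous_on S (\<lambda>x. T' (f x))"
    by (rule continuous_on_compose2[OF assms(3) C1_on_continuous[OF assms(1)]]) auto
  then show ?thesis
    using assms(1) GDERIV_DERIV_compose[OF _ assms(2)] unfolding C1_on_def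
    by (auto intro!: continuous_intros)
qed

lemma C1_on_subset: "C1_on S f V \<Longrightarrow> T \<subseteq> S \<Longrightarrow> C1_on T f V"
  unfolding C1_on_def by (auto intro: continuous_on_subset)

lemma smooth_on_C1_on:
  assumes "smooth_on UNIV \<phi>"
  shows "C1_on S \<phi> (gradient \<phi>)"
  unfolding C1_on_def gradient_def[abs_def]
  using GDERIV_gradient[OF smooth_on_differentiable[OF assms]]
    smooth_on_continuous[OF smooth_on_derivative[OF assms]]
  by (auto intro!: continuous_intros simp: gradient_def)

lemma C1_on_gradient_zero:
  assumes "C1_on S f V" "open U" "x \<in> U" "x \<in> S" "\<And>y. y \<in> U \<Longrightarrow> f y = 0"
  shows "V x = 0"
proof -
  have "GDERIV (\<lambda>y. 0) x :> V x"
    using C1_on_GDERIV[OF assms(1,4)] unfolding gderiv_def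
    by (rule has_derivative_transform_within_open[OF _ assms(2,3)]) (use assms(5) in auto)
  then show ?thesis using GDERIV_frechet(2) GDERIV_const by metis
qed

lemma C1_on_zero_extension:
  assumes "C1_on S f V" "open S" "compact K" "K \<subseteq> S" "\<And>x. x \<in> S - K \<Longrightarrow> f x = 0"
  shows "C1_on UNIV (\<lambda>x. indicator S x *\<^sub>R f x) (\<lambda>x. indicator S x *\<^sub>R V x)"
    and "\<And>x. x \<in> S - K \<Longrightarrow> V x = 0"
proof -
  show V0: "V x = 0" if "x \<in> S - K" for x
    using C1_on_gradient_zero[OF assms(1), of "S - K" x] assms that
    by (auto intro: open_Diff compact_imp_closed)
  have "closed K" using assms(3) by (rule compact_imp_closed)
  have UN: "UNIV = S \<union> - K" using assms(4) by blast
  have "continuous_on (S \<union> - K) (\<lambda>x. indicator S x *\<^sub>R V x)"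
  proof (rule continuous_on_open_Un)
    show "continuous_on S (\<lambda>x. indicator S x *\<^sub>R V x)"
      using C1_on_continuous_gradient[OF assms(1)] by (rule continuous_on_eq) auto
    show "continuous_on (- K) (\<lambda>x. indicator S x *\<^sub>R V x)"
      by (rule continuous_on_eq[OF continuous_on_const[of _ 0]])
         (use V0 in \<open>auto simp: indicator_def\<close>)
  qed (use assms(2) \<open>closed K\<close> in auto)
  moreover have "GDERIV (\<lambda>x. indicator S x *\<^sub>R f x) x :> indicator S x *\<^sub>R V x" for x
  proof (cases "x \<in> S")
    case True
    have "GDERIV (\<lambda>x. indicator S x *\<^sub>R f x) x :> V x"
      using C1_on_GDERIV[OF assms(1) True] unfolding gderiv_def
      by (rule has_derivative_transform_within_open[OF _ assms(2) True]) auto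
    with True show ?thesis by simp
  next
    case False
    have "GDERIV (\<lambda>x. indicator S x *\<^sub>R f x) x :> 0"
      using GDERIV_const[of 0 x] unfolding gderiv_def
      by (rule has_derivative_transform_within_open[where s = "- K"])
         (use False assms \<open>closed K\<close> in \<open>auto simp: indicator_def\<close>)
    with False show ?thesis by simp
  qed
  ultimately show "C1_on UNIV (\<lambda>x. indicator S x *\<^sub>R f x) (\<lambda>x. indicator S x *\<^sub>R V x)"
    unfolding C1_on_def UN[symmetric] by blast
qed

lemma C1_on_compact_support_gradient:
  assumes "C1_on UNIV f V" "compact K" "\<And>x. x \<notin> K \<Longrightarrow> f x = 0" "x \<notin> K"
  shows "V x = 0"
  using C1_on_zero_extension(2)[OF assms(1) open_UNIV assms(2)] assms by auto

lemma compact_support_bounded: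
  fixes V :: "'a::euclidean_space \<Rightarrow> 'b::euclidean_space"
  assumes "continuous_on UNIV V" "compact K" "\<And>x. x \<notin> K \<Longrightarrow> V x = 0"
  obtains L where "0 \<le> L" "\<And>x. norm (V x) \<le> L"
proof -
  have "bounded (V ` K)"
    using assms by (intro compact_imp_bounded compact_continuous_image) (auto intro: continuous_on_subset)
  then obtain L where L: "\<And>x. x \<in> K \<Longrightarrow> norm (V x) \<le> L"
    by (auto simp: bounded_iff)
  have "norm (V x) \<le> \<bar>L\<bar>" for x using L[of x] assms(3)[of x] by (cases "x \<in> K") auto
  then show ?thesis using that[of "\<bar>L\<bar>"] by auto
qed

lemma compact_neighbourhood:
  fixes K :: "'a::euclidean_space set"
  assumes "compact K" "K \<noteq> {}" "open U" "K \<subseteq> U"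
  obtains r where "0 < r" "compact {x. infdist x K \<le> r}" "{x. infdist x K \<le> r} \<subseteq> U"
proof -
  obtain r where r: "0 < r" "(\<Union>x\<in>K. cball x r) \<subseteq> U"
    using compact_subset_open_imp_cball_epsilon_subset[OF assms(1,3,4)] by blast
  have "x \<in> U" if x: "infdist x K \<le> r" for x
  proof -
    obtain a where "a \<in> K" "infdist x K = dist x a"
      using infdist_attains_inf[OF compact_imp_closed[OF assms(1)] assms(2)] by blast
    then have "x \<in> cball a r" using x by (simp add: dist_commute)
    then show ?thesis using r(2) \<open>a \<in> K\<close> by blast
  qed
  then show ?thesis using that[of r] r(1) compact_infdist_le[OF assms(2,1)] by auto
qed

text \<open>Integration by parts in its simplest form: by translation invariance every difference quotient of
a compactly supported function has integral zero, and the quotients converge boundedly to the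
directional derivative.\<close>

lemma integral_gradient_eq_0:
  fixes f :: "'a::euclidean_space \<Rightarrow> real"
  assumes f: "C1_on UNIV f V" and K: "compact K" "\<And>x. x \<notin> K \<Longrightarrow> f x = 0"
  shows "(LINT x|lborel. V x) = 0"
proof (cases "K = {}")
  case True
  then have "V = (\<lambda>x. 0)" using C1_on_compact_support_gradient[OF f K] by auto
  then show ?thesis by simp
next
  case False
  have V0: "V x = 0" if "x \<notin> K" for x using C1_on_compact_support_gradient[OF f K that] by simp
  have cont: "continuous_on UNIV f" "continuous_on UNIV V"
    using f C1_on_continuous C1_on_continuous_gradient by auto
  have int: "integrable lborel f" "integrable lborel V"
    using continuous_compact_support_integrable[OF _ K(1)] cont K V0 by auto
  obtain L where L: "0 \<le> L" "\<And>x. norm (V x) \<le> L"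
    using compact_support_bounded[OF cont(2) K(1) V0] by blast
  have Lip: "\<bar>f x - f y\<bar> \<le> L * norm (x - y)" for x y
  proof -
    have "norm (f x - f y) \<le> L * norm (x - y)"
    proof (rule differentiable_bound[where S = UNIV and f' = "\<lambda>x h. h \<bullet> V x"])
      fix x show "(f has_derivative (\<lambda>h. h \<bullet> V x)) (at x within UNIV)"
        using C1_on_GDERIV[OF f] by (simp add: gderiv_def)
      show "onorm (\<lambda>h. h \<bullet> V x) \<le> L"
      proof (rule onorm_le)
        fix h
        have "norm (h \<bullet> V x) \<le> norm h * norm (V x)" by (simp add: Cauchy_Schwarz_ineq2)
        also have "\<dots> \<le> norm h * L" by (intro mult_left_mono L(2)) simp
        finally show "norm (h \<bullet> V x) \<le> L * norm h" by (simp add: mult.commute)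
      qed
    qed auto
    then show ?thesis by simp
  qed
  have zero: "(LINT x|lborel. V x \<bullet> b) = 0" for b
  proof -
    let ?q = "\<lambda>n x. (f (x + (1 / Suc n) *\<^sub>R b) - f x) * Suc n"
    have "(\<lambda>n. LINT x|lborel. ?q n x) \<longlonglongrightarrow> (LINT x|lborel. V x \<bullet> b)"
    proof (rule integral_dominated_convergence[where w = "\<lambda>x. indicator {x. infdist x K \<le> norm b + 1} x *\<^sub>R (L * norm b)"])
      show "(\<lambda>x. V x \<bullet> b) \<in> borel_measurable lborel"
        using cont(2) by (auto intro!: borel_measurable_continuous_onI continuous_intros)
      show "?q n \<in> borel_measurable lborel" for n
        using cont(1) by (auto intro!: borel_measurable_continuous_onI continuous_intros
            continuous_on_compose2[OF cont(1)])
      have "0 < norm b + 1" by (simp add: add_nonneg_pos)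
      then show "integrable lborel (\<lambda>x. indicator {x. infdist x K \<le> norm b + 1} x *\<^sub>R (L * norm b))"
        by (intro borel_integrable_compact compact_infdist_le[OF False K(1)]) auto
      show "AE x in lborel. (\<lambda>n. ?q n x) \<longlonglongrightarrow> V x \<bullet> b"
      proof (rule AE_I2)
        fix x
        have "((\<lambda>t. f (x + t *\<^sub>R b)) has_derivative (\<lambda>t. (t *\<^sub>R b) \<bullet> V x)) (at 0)"
          by (rule has_derivative_compose[of "\<lambda>t. x + t *\<^sub>R b" "\<lambda>t. t *\<^sub>R b" 0 UNIV f])
             (use C1_on_GDERIV[OF f, of x] in \<open>auto intro!: derivative_eq_intros simp: gderiv_def\<close>)
        then have "((\<lambda>t. f (x + t *\<^sub>R b)) has_real_derivative V x \<bullet> b) (at 0)"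
          by (simp add: has_field_derivative_def inner_commute mult.commute[of _ "b \<bullet> V x"])
        then have "((\<lambda>h. (f (x + h *\<^sub>R b) - f x) / h) \<longlongrightarrow> V x \<bullet> b) (at 0)"
          by (simp add: DERIV_def)
        moreover have "filterlim (\<lambda>n. 1 / real (Suc n)) (at 0) sequentially"
          unfolding filterlim_at using LIMSEQ_inverse_real_of_nat
          by (auto simp: inverse_eq_divide)
        ultimately have "(\<lambda>n. (f (x + (1 / real (Suc n)) *\<^sub>R b) - f x) / (1 / real (Suc n))) \<longlonglongrightarrow> V x \<bullet> b"
          by (rule filterlim_compose)
        then show "(\<lambda>n. ?q n x) \<longlonglongrightarrow> V x \<bullet> b" by simp
      qed
      show "AE x in lborel. norm (?q n x) \<le> indicator {x. infdist x K \<le> norm b + 1} x *\<^sub>R (L * norm b)" for n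
      proof (rule AE_I2)
        fix x
        let ?y = "x + (1 / Suc n) *\<^sub>R b"
        show "norm (?q n x) \<le> indicator {x. infdist x K \<le> norm b + 1} x *\<^sub>R (L * norm b)"
        proof (cases "infdist x K \<le> norm b + 1")
          case True
          have "norm (?q n x) = \<bar>f ?y - f x\<bar> * Suc n" by (simp add: abs_mult)
          also have "\<dots> \<le> (L * norm (?y - x)) * Suc n" by (intro mult_right_mono Lip) auto
          also have "\<dots> = L * norm b" by simp
          finally show ?thesis using True by simp
        next
          case False
          have "x \<notin> K" using False by (metis infdist_zero add_nonneg_nonneg norm_ge_zero zero_le_one)
          moreover have "?y \<notin> K"
          proof
            assume "?y \<in> K"
            then have "infdist x K \<le> dist x ?y" by (rule infdist_le)
            also have "\<dots> = norm b / Suc n" by (simp add: dist_norm)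
            also have "\<dots> \<le> norm b / 1" by (intro divide_left_mono) auto
            finally show False using False by simp
          qed
          ultimately show ?thesis using K(2) False by simp
        qed
      qed
    qed
    moreover have "(LINT x|lborel. ?q n x) = 0" for n
    proof -
      have f_meas: "f \<in> borel_measurable borel" using cont(1) by (rule borel_measurable_continuous_onI)
      have "integrable lborel (\<lambda>x. f (x + (1 / Suc n) *\<^sub>R b))"
      proof (rule continuous_compact_support_integrable)
        show "compact ((\<lambda>x. x - (1 / Suc n) *\<^sub>R b) ` K)"
          by (intro compact_continuous_image continuous_intros K(1))
        show "f (x + (1 / Suc n) *\<^sub>R b) = 0" if "x \<notin> (\<lambda>x. x - (1 / Suc n) *\<^sub>R b) ` K" for x
          using that K(2)[of "x + (1 / Suc n) *\<^sub>R b"] by (force simp: image_iff algebra_simps)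
      qed (intro continuous_on_compose2[OF cont(1)] continuous_intros; simp)
      then have "(LINT x|lborel. ?q n x)
          = ((LINT x|lborel. f (x + (1 / Suc n) *\<^sub>R b)) - (LINT x|lborel. f x)) * Suc n"
        using int(1) by (simp del: of_nat_Suc)
      also have "\<dots> = 0" using lborel_integral_translate[OF f_meas] by simp
      finally show ?thesis .
    qed
    ultimately show ?thesis using LIMSEQ_unique by (simp add: LIMSEQ_const_iff)
  qed
  have "(LINT x|lborel. V x) \<bullet> b = 0" for b
    using zero[of b] integral_inner_left[of b lborel V] int(2) by simp
  then show ?thesis by (metis inner_eq_zero_iff)
qed

lemma compact_support_uniformly_continuous:
  fixes V :: "'a::euclidean_space \<Rightarrow> 'b::euclidean_space"
  assumes "continuous_on UNIV V" "compact K" "\<And>x. x \<notin> K \<Longrightarrow> V x = 0" "0 < e"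
  obtains d where "0 < d" "\<And>x y. dist x y \<le> d \<Longrightarrow> norm (V y - V x) \<le> e"
proof -
  obtain c r where cr: "K \<subseteq> cball c r"
    using compact_imp_bounded[OF assms(2)] bounded_subset_cball by blast
  have "uniformly_continuous_on (cball c (r + 1)) V"
    using assms(1) by (intro compact_uniformly_continuous) (auto intro: continuous_on_subset)
  then obtain d where d: "0 < d"
    "\<And>x y. x \<in> cball c (r + 1) \<Longrightarrow> y \<in> cball c (r + 1) \<Longrightarrow> dist y x < d \<Longrightarrow> dist (V y) (V x) < e"
    using assms(4) unfolding uniformly_continuous_on_def by metis
  have "norm (V y - V x) \<le> e" if xy: "dist x y \<le> min (d / 2) 1" for x y
  proof (cases "x \<in> K \<or> y \<in> K")
    case True
    then have "x \<in> cball c (r + 1)" "y \<in> cball c (r + 1)"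
      using cr xy dist_triangle[of c x y] dist_triangle[of c y x] by (auto simp: dist_commute subset_iff)
    then show ?thesis using d(2)[of x y] d(1) xy by (simp add: dist_commute dist_norm norm_minus_commute)
  next
    case False
    then show ?thesis using assms(3,4) by simp
  qed
  then show ?thesis using that[of "min (d / 2) 1"] d(1) by auto
qed

text \<open>The derivative moves from the kernel to \<open>f\<close> because \<open>f y * \<rho> (x - y)\<close>, as a function of \<open>y\<close>, is \<open>C\<^sup>1\<close> with
compact support and so has a gradient of integral zero.\<close>

lemma mollify_gradient:
  fixes f :: "'a::euclidean_space \<Rightarrow> real"
  assumes f: "C1_on UNIV f V" and K: "compact K" "\<And>x. x \<notin> K \<Longrightarrow> f x = 0" and \<rho>: "smooth_on UNIV \<rho>"
  shows "frechet_derivative (mollify \<rho> f) (at x) b = mollify \<rho> (\<lambda>y. V y \<bullet> b) x"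
proof -
  have cont: "continuous_on UNIV f" "continuous_on UNIV V"
    using f C1_on_continuous C1_on_continuous_gradient by auto
  let ?r = "\<lambda>y. \<rho> (x - y)"
  let ?W = "\<lambda>y. gradient \<rho> (x - y)"
  have r: "GDERIV ?r y :> - ?W y" for y
  proof -
    have "((\<lambda>y. \<rho> (x - y)) has_derivative (\<lambda>h. (- h) \<bullet> ?W y)) (at y)"
      by (rule has_derivative_compose[of "\<lambda>y. x - y" "\<lambda>h. - h" y UNIV \<rho>])
         (use C1_on_GDERIV[OF smooth_on_C1_on[OF \<rho>, of UNIV], of "x - y"] in
           \<open>auto intro!: derivative_eq_intros simp: gderiv_def\<close>)
    then show ?thesis by (simp add: gderiv_def)
  qed
  have contr: "continuous_on UNIV ?r"
    by (intro continuous_on_compose2[OF smooth_on_continuous[OF \<rho>, of UNIV]] continuous_intros) auto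
  have contW: "continuous_on UNIV ?W"
    by (intro continuous_on_compose2[OF C1_on_continuous_gradient[OF smooth_on_C1_on[OF \<rho>, of UNIV]]]
          continuous_intros) auto
  have C1r: "C1_on UNIV ?r (\<lambda>y. - ?W y)"
    using r contW by (auto simp: C1_on_def intro!: continuous_intros)
  have V0: "V y = 0" if "y \<notin> K" for y using C1_on_compact_support_gradient[OF f K that] by simp
  have int1: "integrable lborel (\<lambda>y. f y *\<^sub>R (- ?W y))"
    by (rule continuous_compact_support_integrable[OF _ K(1)])
       (auto intro!: continuous_intros cont contW simp: K(2))
  have int2: "integrable lborel (\<lambda>y. ?r y *\<^sub>R V y)"
    by (rule continuous_compact_support_integrable[OF _ K(1)])
       (auto intro!: continuous_intros cont contr simp: V0)
  have "(LINT y|lborel. f y *\<^sub>R (- ?W y) + ?r y *\<^sub>R V y) = 0"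
    by (rule integral_gradient_eq_0[OF C1_on_mult[OF f C1r] K(1)]) (simp add: K(2))
  then have "(LINT y|lborel. ?r y *\<^sub>R V y) = - (LINT y|lborel. f y *\<^sub>R (- ?W y))"
    using int1 int2 by (simp add: Bochner_Integration.integral_add add_eq_0_iff)
  then have "(LINT y|lborel. ?r y *\<^sub>R V y) \<bullet> b = - ((LINT y|lborel. f y *\<^sub>R (- ?W y)) \<bullet> b)"
    by simp
  then have "(LINT y|lborel. (?r y *\<^sub>R V y) \<bullet> b) = - (LINT y|lborel. (f y *\<^sub>R (- ?W y)) \<bullet> b)"
    by (subst (1 2) integral_inner_left) (use int1 int2 in auto)
  then have *: "(LINT y|lborel. (V y \<bullet> b) * ?r y) = (LINT y|lborel. f y * (b \<bullet> ?W y))"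
    by (simp add: inner_commute mult.commute)
  have "frechet_derivative (mollify \<rho> f) (at x) b = mollify (\<lambda>z. frechet_derivative \<rho> (at z) b) f x"
    using frechet_derivative_at[OF mollify_has_derivative[OF cont(1) K \<rho>]] by metis
  also have "\<dots> = (LINT y|lborel. f y * (b \<bullet> ?W y))"
    using GDERIV_frechet(1)[OF C1_on_GDERIV[OF smooth_on_C1_on[OF \<rho>, of UNIV]]]
    by (simp add: mollify_def)
  finally show ?thesis using * by (simp add: mollify_def)
qed

text \<open>Mollification converges uniformly together with the gradient, and the support grows by at most
the radius of the kernel. Through this lemma compactly supported \<open>C\<^sup>1\<close> functions act as test functions.\<close>

lemma test_function_approximation:
  fixes f :: "'a::euclidean_space \<Rightarrow> real"
  assumes f: "C1_on UNIV f V" and K: "compact K" "K \<subseteq> \<Omega>" "\<And>x. x \<notin> K \<Longrightarrow> f x = 0"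
    and "open \<Omega>" "0 < e"
  obtains \<phi> where "test_function \<Omega> \<phi>" "\<And>x. \<bar>\<phi> x - f x\<bar> \<le> e" "\<And>x. norm (gradient \<phi> x - V x) \<le> e"
proof (cases "K = {}")
  case True
  then have "f = (\<lambda>x. 0)" "V = (\<lambda>x. 0)"
    using C1_on_compact_support_gradient[OF f K(1,3)] K(3) by auto
  moreover have "smooth_on UNIV (\<lambda>x::'a. 0)"
    by (rule bump_algebra_smooth[of _ 0]) (rule bump_algebra.const)
  then have "test_function \<Omega> (\<lambda>x. 0)"
    by (auto simp: test_function_def intro: exI[of _ "{}"])
  moreover have "gradient (\<lambda>x::'a. 0) x = 0" for x using GDERIV_frechet(2)[OF GDERIV_const] .
  ultimately show ?thesis using that[of "\<lambda>x. 0"] assms(6) by simp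
next
  case False
  have V0: "V x = 0" if "x \<notin> K" for x using C1_on_compact_support_gradient[OF f K(1,3) that] by simp
  have cont: "continuous_on UNIV f" "continuous_on UNIV V"
    using f C1_on_continuous C1_on_continuous_gradient by auto
  obtain r where r: "0 < r" "compact {x. infdist x K \<le> r}" "{x. infdist x K \<le> r} \<subseteq> \<Omega>"
    using compact_neighbourhood[OF K(1) False \<open>open \<Omega>\<close> K(2)] by blast
  obtain d1 where d1: "0 < d1" "\<And>x y. dist x y \<le> d1 \<Longrightarrow> norm (f y - f x) \<le> e"
    using compact_support_uniformly_continuous[OF cont(1) K(1,3) \<open>0 < e\<close>] by blast
  have "0 < e / DIM('a)" using \<open>0 < e\<close> by simp
  then obtain d2 where d2: "0 < d2" "\<And>x y. dist x y \<le> d2 \<Longrightarrow> norm (V y - V x) \<le> e / DIM('a)"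
    using compact_support_uniformly_continuous[OF cont(2) K(1) V0] by blast
  define \<sigma> where "\<sigma> = min r (min d1 d2)"
  have \<sigma>: "0 < \<sigma>" "\<sigma> \<le> r" "\<sigma> \<le> d1" "\<sigma> \<le> d2" using r d1 d2 by (auto simp: \<sigma>_def)
  let ?\<rho> = "mollifier \<sigma> :: 'a \<Rightarrow> real"
  define \<phi> where "\<phi> = mollify ?\<rho> f"
  have smooth: "smooth_on UNIV \<phi>"
    unfolding \<phi>_def using mollify_smooth[OF cont(1) K(1,3) mollifier_smooth[OF \<sigma>(1)]] .
  have supp: "\<phi> x = 0" if "x \<notin> {x. infdist x K \<le> r}" for x
  proof -
    have "\<bar>mollify ?\<rho> f x - 0\<bar> \<le> 0"
    proof (rule mollify_close[OF cont(1) \<sigma>(1)])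
      fix y assume "dist x y \<le> \<sigma>"
      then have "y \<notin> K" using that \<sigma>(2) infdist_le[of y K x] by auto
      then show "\<bar>f y - 0\<bar> \<le> 0" using K(3) by simp
    qed
    then show ?thesis by (simp add: \<phi>_def)
  qed
  have test: "test_function \<Omega> \<phi>" using smooth supp r by (auto simp: test_function_def)
  have close: "\<bar>\<phi> x - f x\<bar> \<le> e" for x
    unfolding \<phi>_def by (rule mollify_close[OF cont(1) \<sigma>(1)]) (use d1 \<sigma> in force)
  have "norm (gradient \<phi> x - V x) \<le> e" for x
  proof -
    have "\<bar>(gradient \<phi> x - V x) \<bullet> b\<bar> \<le> e / DIM('a)" if b: "b \<in> Basis" for b
    proof -
      have "gradient \<phi> x \<bullet> b = frechet_derivative \<phi> (at x) b"
        using GDERIV_frechet(1)[OF C1_on_GDERIV[OF smooth_on_C1_on[OF smooth, of UNIV]]]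
        by (simp add: inner_commute)
      also have "\<dots> = mollify ?\<rho> (\<lambda>y. V y \<bullet> b) x"
        unfolding \<phi>_def by (rule mollify_gradient[OF f K(1,3) mollifier_smooth[OF \<sigma>(1)]])
      finally have "\<bar>(gradient \<phi> x - V x) \<bullet> b\<bar> = \<bar>mollify ?\<rho> (\<lambda>y. V y \<bullet> b) x - V x \<bullet> b\<bar>"
        by (simp add: inner_diff_left)
      also have "\<dots> \<le> e / DIM('a)"
      proof (rule mollify_close[OF _ \<sigma>(1)])
        show "continuous_on UNIV (\<lambda>y. V y \<bullet> b)" by (intro continuous_intros cont)
        fix y assume "dist x y \<le> \<sigma>"
        then have "norm (V y - V x) \<le> e / DIM('a)" using d2(2) \<sigma>(4) by fastforce
        then show "\<bar>V y \<bullet> b - V x \<bullet> b\<bar> \<le> e / DIM('a)"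
          using Basis_le_norm[OF b, of "V y - V x"] by (simp add: inner_diff_left)
      qed
      finally show ?thesis .
    qed
    then have "(\<Sum>b\<in>Basis. \<bar>(gradient \<phi> x - V x) \<bullet> b\<bar>) \<le> (\<Sum>b\<in>(Basis :: 'a set). e / DIM('a))"
      by (rule sum_mono)
    also have "\<dots> = e" by simp
    finally show ?thesis using norm_le_l1[of "gradient \<phi> x - V x"] by linarith
  qed
  then show ?thesis using that test close by blast
qed

text \<open>Mollify a piecewise linear function of the distance to \<open>C\<close> that has plateaus of width \<open>r / 3\<close> at both
values; the kernel of radius \<open>r / 3\<close> respects the plateaus.\<close>

lemma smooth_urysohn:
  fixes C :: "'a::euclidean_space set"
  assumes "compact C" "open U" "C \<subseteq> U"
  obtains \<phi> where "test_function U \<phi>" "\<And>x. 0 \<le> \<phi> x \<and> \<phi> x \<le> 1" "\<And>x. x \<in> C \<Longrightarrow> \<phi> x = 1"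
proof (cases "C = {}")
  case True
  have "smooth_on UNIV (\<lambda>x::'a. 0)"
    by (rule bump_algebra_smooth[of _ 0]) (rule bump_algebra.const)
  then have "test_function U (\<lambda>x. 0)"
    by (auto simp: test_function_def intro: exI[of _ "{}"])
  then show ?thesis using that[of "\<lambda>x. 0"] True by simp
next
  case False
  obtain r where r: "0 < r" "compact {x. infdist x C \<le> r}" "{x. infdist x C \<le> r} \<subseteq> U"
    using compact_neighbourhood[OF assms(1) False assms(2,3)] by blast
  define f where "f y = max 0 (min 1 (2 - (3 / r) * infdist y C))" for y
  define \<sigma> where "\<sigma> = r / 3"
  have \<sigma>: "0 < \<sigma>" using r(1) by (simp add: \<sigma>_def)
  let ?\<rho> = "mollifier \<sigma> :: 'a \<Rightarrow> real"
  have cont: "continuous_on UNIV f" unfolding f_def by (intro continuous_intros)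
  have f0: "f y = 0" if "y \<notin> {x. infdist x C \<le> r}" for y
    using that r(1) by (auto simp: f_def field_simps)
  define \<phi> where "\<phi> = mollify ?\<rho> f"
  have tri: "infdist x C \<le> infdist y C + dist x y" for x y
    using infdist_triangle[of x C y] by simp
  have smooth: "smooth_on UNIV \<phi>"
    unfolding \<phi>_def using mollify_smooth[OF cont r(2) f0 mollifier_smooth[OF \<sigma>]] by simp
  have supp: "\<phi> x = 0" if "x \<notin> {x. infdist x C \<le> r}" for x
  proof -
    have "\<bar>mollify ?\<rho> f x - 0\<bar> \<le> 0"
    proof (rule mollify_close[OF cont \<sigma>])
      fix y assume "dist x y \<le> \<sigma>"
      then have "2 * r \<le> 3 * infdist y C" using that tri[of x y] by (simp add: \<sigma>_def)
      then show "\<bar>f y - 0\<bar> \<le> 0" using r(1) by (auto simp: f_def field_simps)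
    qed
    then show ?thesis by (simp add: \<phi>_def)
  qed
  have one: "\<phi> x = 1" if "x \<in> C" for x
  proof -
    have "\<bar>mollify ?\<rho> f x - 1\<bar> \<le> 0"
    proof (rule mollify_close[OF cont \<sigma>])
      fix y assume "dist x y \<le> \<sigma>"
      then have "infdist y C \<le> r / 3" using infdist_le[OF that, of y] by (simp add: \<sigma>_def dist_commute)
      then show "\<bar>f y - 1\<bar> \<le> 0" using r(1) by (auto simp: f_def field_simps)
    qed
    then show ?thesis by (simp add: \<phi>_def)
  qed
  have "\<bar>\<phi> x - 1 / 2\<bar> \<le> 1 / 2" for x
    unfolding \<phi>_def by (rule mollify_close[OF cont \<sigma>]) (auto simp: f_def abs_if)
  then have range: "0 \<le> \<phi> x \<and> \<phi> x \<le> 1" for x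
    by (simp add: abs_le_iff) (smt (verit) field_sum_of_halves)
  show ?thesis
    by (rule that[OF _ range one]) (use smooth supp r in \<open>auto simp: test_function_def\<close>)
qed


lemma test_function_C1_on: "test_function \<Omega> \<phi> \<Longrightarrow> C1_on S \<phi> (gradient \<phi>)"
  by (simp add: test_function_def smooth_on_C1_on)

lemma test_function_continuous:
  assumes "test_function \<Omega> \<phi>"
  shows "continuous_on S \<phi>" "continuous_on S (gradient \<phi>)"
  using C1_on_continuous C1_on_continuous_gradient test_function_C1_on[OF assms] by blast+

lemma test_function_support:
  assumes "test_function \<Omega> \<phi>"
  shows "\<exists>K. compact K \<and> K \<subseteq> \<Omega> \<and> (\<forall>x. x \<notin> K \<longrightarrow> \<phi> x = 0 \<and> gradient \<phi> x = 0)"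
proof -
  obtain K where K: "compact K" "K \<subseteq> \<Omega>" "\<And>x. x \<notin> K \<Longrightarrow> \<phi> x = 0"
    using assms by (auto simp: test_function_def)
  have "gradient \<phi> x = 0" if "x \<notin> K" for x
    using C1_on_compact_support_gradient[OF test_function_C1_on[OF assms] K(1,3) that] .
  then show ?thesis using K by blast
qed

lemma integrable_dominated:
  fixes h :: "'a \<Rightarrow> 'b::euclidean_space"
  assumes "integrable M f" "h \<in> borel_measurable M" "\<And>x. x \<in> space M \<Longrightarrow> norm (h x) \<le> (f x :: real)"
  shows "integrable M h"
proof (rule Bochner_Integration.integrable_bound[OF assms(1,2)])
  have "norm (h x) \<le> norm (f x)" if "x \<in> space M" for x using assms(3)[OF that] by simp
  then show "AE x in M. norm (h x) \<le> norm (f x)" by (rule AE_I2)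
qed

lemma set_integrable_continuous_compact:
  fixes f :: "'a::euclidean_space \<Rightarrow> 'b::euclidean_space"
  assumes "compact K" "continuous_on K f"
  shows "set_integrable lebesgue K f"
  using borel_integrable_compact[OF assms]
  by (simp add: set_integrable_def integrable_completion borel_measurable_integrable)

lemma continuous_imp_measurable_lebesgue:
  fixes f :: "'a::euclidean_space \<Rightarrow> 'b::euclidean_space"
  assumes "continuous_on UNIV f"
  shows "f \<in> borel_measurable lebesgue"
  using borel_measurable_continuous_onI[OF assms] by (auto intro: measurable_completion)

lemma set_integrable_compact_support_scaleR:
  fixes \<phi> :: "'a::euclidean_space \<Rightarrow> real" and V :: "'a \<Rightarrow> 'b::euclidean_space"
  assumes "continuous_on UNIV \<phi>" "compact K" "K \<subseteq> \<Omega>" "\<And>x. x \<notin> K \<Longrightarrow> \<phi> x = 0" "set_integrable lebesgue K V"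
  shows "set_integrable lebesgue \<Omega> (\<lambda>x. \<phi> x *\<^sub>R V x)"
proof -
  obtain B where B: "0 \<le> B" "\<And>x. norm (\<phi> x) \<le> B"
    using compact_support_bounded[OF assms(1,2,4)] by blast
  have \<phi>: "\<phi> \<in> borel_measurable lebesgue"
    using assms(1) by (rule continuous_imp_measurable_lebesgue)
  have eq: "(\<lambda>x. indicator \<Omega> x *\<^sub>R (\<phi> x *\<^sub>R V x)) = (\<lambda>x. \<phi> x *\<^sub>R (indicator K x *\<^sub>R V x))"
    using assms(3,4) by (force simp: indicator_def fun_eq_iff)
  have V: "integrable lebesgue (\<lambda>x. indicator K x *\<^sub>R V x)"
    using assms(5) by (simp add: set_integrable_def)
  have "integrable lebesgue (\<lambda>x. \<phi> x *\<^sub>R (indicator K x *\<^sub>R V x))"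
  proof (rule integrable_dominated[where f = "\<lambda>x. B * norm (indicator K x *\<^sub>R V x)"])
    show "integrable lebesgue (\<lambda>x. B * norm (indicator K x *\<^sub>R V x))"
      by (intro integrable_mult_right integrable_norm V)
    show "(\<lambda>x. \<phi> x *\<^sub>R (indicator K x *\<^sub>R V x)) \<in> borel_measurable lebesgue"
      by (rule borel_measurable_scaleR[OF \<phi> borel_measurable_integrable[OF V]])
    show "norm (\<phi> x *\<^sub>R (indicator K x *\<^sub>R V x)) \<le> B * norm (indicator K x *\<^sub>R V x)" for x
      unfolding norm_scaleR[of "\<phi> x"] using B(2)[of x] by (intro mult_right_mono) auto
  qed
  then show ?thesis by (simp only: set_integrable_def eq)
qed

lemma set_integrable_compact_support_scaleR':
  fixes u :: "'a::euclidean_space \<Rightarrow> real" and V :: "'a \<Rightarrow> 'b::euclidean_space"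
  assumes "continuous_on UNIV V" "compact K" "K \<subseteq> \<Omega>" "\<And>x. x \<notin> K \<Longrightarrow> V x = 0" "set_integrable lebesgue K u"
  shows "set_integrable lebesgue \<Omega> (\<lambda>x. u x *\<^sub>R V x)"
proof -
  obtain B where B: "0 \<le> B" "\<And>x. norm (V x) \<le> B"
    using compact_support_bounded[OF assms(1,2,4)] by blast
  have \<phi>: "V \<in> borel_measurable lebesgue"
    using assms(1) by (rule continuous_imp_measurable_lebesgue)
  have eq: "(\<lambda>x. indicator \<Omega> x *\<^sub>R (u x *\<^sub>R V x)) = (\<lambda>x. (indicator K x *\<^sub>R u x) *\<^sub>R V x)"
    using assms(3,4) by (force simp: indicator_def fun_eq_iff)
  have V: "integrable lebesgue (\<lambda>x. indicator K x *\<^sub>R u x)"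
    using assms(5) by (simp add: set_integrable_def)
  have "integrable lebesgue (\<lambda>x. (indicator K x *\<^sub>R u x) *\<^sub>R V x)"
  proof (rule integrable_dominated[where f = "\<lambda>x. norm (indicator K x *\<^sub>R u x) * B"])
    show "integrable lebesgue (\<lambda>x. norm (indicator K x *\<^sub>R u x) * B)"
      by (intro integrable_mult_left integrable_norm V)
    show "(\<lambda>x. (indicator K x *\<^sub>R u x) *\<^sub>R V x) \<in> borel_measurable lebesgue"
      by (rule borel_measurable_scaleR[OF borel_measurable_integrable[OF V] \<phi>])
    show "norm ((indicator K x *\<^sub>R u x) *\<^sub>R V x) \<le> norm (indicator K x *\<^sub>R u x) * B" for x
      unfolding norm_scaleR[of "indicator K x *\<^sub>R u x"] real_norm_def
      using B(2)[of x] by (intro mult_left_mono) auto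
  qed
  then show ?thesis by (simp only: set_integrable_def eq)
qed

lemma has_weak_gradient_C1_on:
  assumes f: "C1_on \<Omega> f V" and "open \<Omega>"
  shows "has_weak_gradient \<Omega> f V"
  unfolding has_weak_gradient_def
proof (intro conjI allI impI)
  fix K assume K: "compact K \<and> K \<subseteq> \<Omega>"
  show "set_integrable lebesgue K f"
    using K C1_on_continuous[OF f]
    by (intro set_integrable_continuous_compact) (auto intro: continuous_on_subset)
  show "set_integrable lebesgue K V"
    using K C1_on_continuous_gradient[OF f]
    by (intro set_integrable_continuous_compact) (auto intro: continuous_on_subset)
next
  fix \<phi> assume test: "test_function \<Omega> \<phi>"
  obtain K where K: "compact K" "K \<subseteq> \<Omega>" "\<And>x. x \<notin> K \<Longrightarrow> \<phi> x = 0" "\<And>x. x \<notin> K \<Longrightarrow> gradient \<phi> x = 0"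
    using test_function_support[OF test] by metis
  note cont = test_function_continuous[OF test, of UNIV]
  have \<phi>': "C1_on \<Omega> \<phi> (gradient \<phi>)" by (rule test_function_C1_on[OF test])
  let ?W = "\<lambda>x. f x *\<^sub>R gradient \<phi> x + \<phi> x *\<^sub>R V x"
  have W: "C1_on UNIV (\<lambda>x. indicator \<Omega> x *\<^sub>R (f x * \<phi> x)) (\<lambda>x. indicator \<Omega> x *\<^sub>R ?W x)"
    by (rule C1_on_zero_extension(1)[OF C1_on_mult[OF f \<phi>'] assms(2) K(1,2)]) (simp add: K(3))
  have "(LINT x|lborel. indicator \<Omega> x *\<^sub>R ?W x) = 0"
    by (rule integral_gradient_eq_0[OF W K(1)]) (simp add: K(3))
  moreover have "(\<lambda>x. indicator \<Omega> x *\<^sub>R ?W x) \<in> borel_measurable lborel"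
    using borel_measurable_continuous_onI[OF C1_on_continuous_gradient[OF W]] by simp
  ultimately have "(LINT x:\<Omega>|lebesgue. ?W x) = 0"
    by (simp only: set_lebesgue_integral_def integral_completion)
  moreover have "set_integrable lebesgue \<Omega> (\<lambda>x. f x *\<^sub>R gradient \<phi> x)"
    by (rule set_integrable_compact_support_scaleR'[OF cont(2) K(1,2,4)
          set_integrable_continuous_compact[OF K(1) continuous_on_subset[OF C1_on_continuous[OF f] K(2)]]])
  moreover have "set_integrable lebesgue \<Omega> (\<lambda>x. \<phi> x *\<^sub>R V x)"
    by (rule set_integrable_compact_support_scaleR[OF cont(1) K(1,2,3)
          set_integrable_continuous_compact[OF K(1) continuous_on_subset[OF C1_on_continuous_gradient[OF f] K(2)]]])
  ultimately have "(LINT x:\<Omega>|lebesgue. f x *\<^sub>R gradient \<phi> x) + (LINT x:\<Omega>|lebesgue. \<phi> x *\<^sub>R V x) = 0"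
    by (simp only: set_integral_add(2))
  then show "(LINT x:\<Omega>|lebesgue. f x *\<^sub>R gradient \<phi> x) = - (LINT x:\<Omega>|lebesgue. \<phi> x *\<^sub>R V x)"
    by (simp only: eq_neg_iff_add_eq_0)
qed

text \<open>The indicator of \<open>C\<close> is a bounded limit of test functions supported in one fixed compact neighbourhood
of \<open>C\<close>, where \<open>V\<close> is integrable.\<close>

lemma integral_compact_eq_0:
  fixes V :: "'a::euclidean_space \<Rightarrow> 'b::euclidean_space"
  assumes "open \<Omega>" and V: "\<And>K. compact K \<Longrightarrow> K \<subseteq> \<Omega> \<Longrightarrow> set_integrable lebesgue K V"
    and zero: "\<And>\<phi>. test_function \<Omega> \<phi> \<Longrightarrow> (LINT x:\<Omega>|lebesgue. \<phi> x *\<^sub>R V x) = 0"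
    and C: "compact C" "C \<subseteq> \<Omega>"
  shows "(LINT x:C|lebesgue. V x) = 0"
proof (cases "C = {}")
  case True
  then show ?thesis by (simp add: set_lebesgue_integral_def)
next
  case False
  obtain r where r: "0 < r" "compact {x. infdist x C \<le> r}" "{x. infdist x C \<le> r} \<subseteq> \<Omega>"
    using compact_neighbourhood[OF C(1) False assms(1) C(2)] by blast
  let ?K = "{x. infdist x C \<le> r}"
  let ?U = "\<lambda>n::nat. {x. infdist x C < r / Suc n}"
  have "\<exists>\<phi>. test_function (?U n) \<phi> \<and> (\<forall>x. 0 \<le> \<phi> x \<and> \<phi> x \<le> 1) \<and> (\<forall>x\<in>C. \<phi> x = 1)" for n
  proof -
    have "open (?U n)" by (intro open_Collect_less continuous_intros)
    moreover have "C \<subseteq> ?U n" using r(1) by auto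
    ultimately show ?thesis using smooth_urysohn[OF C(1)] by metis
  qed
  then obtain \<phi> where \<phi>: "\<And>n. test_function (?U n) (\<phi> n)" "\<And>n x. 0 \<le> \<phi> n x \<and> \<phi> n x \<le> 1"
    "\<And>n x. x \<in> C \<Longrightarrow> \<phi> n x = 1" by metis
  have out: "\<phi> n x = 0" if "\<not> infdist x C < r / Suc n" for n x
    using \<phi>(1)[of n] that by (auto simp: test_function_def)
  have le: "r / Suc n \<le> r" for n
  proof -
    have "r / Suc n \<le> r / 1" using r(1) by (intro divide_left_mono) auto
    then show ?thesis by simp
  qed
  have test: "test_function \<Omega> (\<phi> n)" for n
  proof -
    have "?U n \<subseteq> \<Omega>" using r(3) le[of n] by force
    then show ?thesis using \<phi>(1)[of n] unfolding test_function_def by (meson order_trans)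
  qed
  have meas: "\<phi> n \<in> borel_measurable lebesgue" for n
    using test[of n] by (intro continuous_imp_measurable_lebesgue test_function_continuous)
  have VK: "integrable lebesgue (\<lambda>x. indicator ?K x *\<^sub>R V x)"
    using V[OF r(2,3)] by (simp add: set_integrable_def)
  have eq: "indicator \<Omega> x *\<^sub>R (\<phi> n x *\<^sub>R V x) = \<phi> n x *\<^sub>R (indicator ?K x *\<^sub>R V x)" for n x
  proof (cases "x \<in> ?K")
    case True then show ?thesis using r(3) by (auto simp: indicator_def)
  next
    case False
    then have "\<not> infdist x C < r / Suc n" using le[of n] by auto
    then show ?thesis using out by simp
  qed
  have eqC: "indicator C x *\<^sub>R V x = indicator C x *\<^sub>R (indicator ?K x *\<^sub>R V x)" for x
    using r(1) by (auto simp: indicator_def)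
  have "(\<lambda>n. LINT x|lebesgue. \<phi> n x *\<^sub>R (indicator ?K x *\<^sub>R V x))
      \<longlonglongrightarrow> (LINT x|lebesgue. indicator C x *\<^sub>R (indicator ?K x *\<^sub>R V x))"
  proof (rule integral_dominated_convergence[where w = "\<lambda>x. norm (indicator ?K x *\<^sub>R V x)"])
    show "(\<lambda>x. indicator C x *\<^sub>R (indicator ?K x *\<^sub>R V x)) \<in> borel_measurable lebesgue"
      by (rule borel_measurable_scaleR[OF borel_measurable_indicator borel_measurable_integrable[OF VK]])
         (simp add: fmeasurableD lmeasurable_compact C(1))
    show "(\<lambda>x. \<phi> n x *\<^sub>R (indicator ?K x *\<^sub>R V x)) \<in> borel_measurable lebesgue" for n
      by (rule borel_measurable_scaleR[OF meas borel_measurable_integrable[OF VK]])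
    show "integrable lebesgue (\<lambda>x. norm (indicator ?K x *\<^sub>R V x))" using VK by (rule integrable_norm)
    show "AE x in lebesgue. norm (\<phi> n x *\<^sub>R (indicator ?K x *\<^sub>R V x)) \<le> norm (indicator ?K x *\<^sub>R V x)" for n
      using \<phi>(2)[of n] by (intro AE_I2) (simp only: norm_scaleR, simp add: mult_left_le_one_le)
    show "AE x in lebesgue. (\<lambda>n. \<phi> n x *\<^sub>R (indicator ?K x *\<^sub>R V x)) \<longlonglongrightarrow> indicator C x *\<^sub>R (indicator ?K x *\<^sub>R V x)"
    proof (rule AE_I2)
      fix x
      have "(\<lambda>n. \<phi> n x) \<longlonglongrightarrow> indicator C x"
      proof (cases "x \<in> C")
        case True then show ?thesis using \<phi>(3) by simp
      next
        case nC: False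
        then have "0 < infdist x C" using infdist_pos_not_in_closed C(1) False compact_imp_closed by blast
        moreover have "(\<lambda>n. r / Suc n) \<longlonglongrightarrow> 0"
          by (rule LIMSEQ_Suc) (rule lim_const_over_n)
        ultimately have "\<forall>\<^sub>F n in sequentially. r / Suc n < infdist x C"
          by (intro order_tendstoD)
        then have "\<forall>\<^sub>F n in sequentially. \<phi> n x = indicator C x"
          by eventually_elim (use nC out in auto)
        then show ?thesis by (rule tendsto_eventually)
      qed
      then show "(\<lambda>n. \<phi> n x *\<^sub>R (indicator ?K x *\<^sub>R V x)) \<longlonglongrightarrow> indicator C x *\<^sub>R (indicator ?K x *\<^sub>R V x)"
        by (intro tendsto_intros)
    qed
  qed
  moreover have "(LINT x|lebesgue. \<phi> n x *\<^sub>R (indicator ?K x *\<^sub>R V x)) = 0" for n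
    using zero[OF test[of n]] by (simp only: set_lebesgue_integral_def eq)
  ultimately have "(LINT x|lebesgue. indicator C x *\<^sub>R (indicator ?K x *\<^sub>R V x)) = 0"
    using LIMSEQ_unique by (simp add: LIMSEQ_const_iff)
  then show ?thesis by (simp only: set_lebesgue_integral_def eqC[symmetric])
qed

text \<open>If a component of \<open>V\<close> were positive on a set of positive measure, inner regularity would give a compact
set of positive measure inside, and the integral over that set could not vanish.\<close>

lemma fundamental_lemma:
  fixes V :: "'a::euclidean_space \<Rightarrow> 'b::euclidean_space"
  assumes "open \<Omega>" and V: "\<And>K. compact K \<Longrightarrow> K \<subseteq> \<Omega> \<Longrightarrow> set_integrable lebesgue K V"
    and zero: "\<And>\<phi>. test_function \<Omega> \<phi> \<Longrightarrow> (LINT x:\<Omega>|lebesgue. \<phi> x *\<^sub>R V x) = 0"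
  shows "AE x in lebesgue_on \<Omega>. V x = 0"
proof -
  have half: "AE x in lebesgue. x \<in> K \<longrightarrow> V x \<bullet> c \<le> 0" if K: "compact K" "K \<subseteq> \<Omega>" for K c
  proof -
    define A where "A = {x. indicator K x *\<^sub>R V x \<bullet> c > 0}"
    have int: "integrable lebesgue (\<lambda>x. indicator K x *\<^sub>R V x)"
      using V[OF K] by (simp add: set_integrable_def)
    then have "(\<lambda>x. indicator K x *\<^sub>R V x \<bullet> c) \<in> borel_measurable lebesgue"
      by (intro borel_measurable_inner) auto
    then have A: "A \<in> sets lebesgue"
      unfolding A_def using borel_measurable_less[of "\<lambda>x. 0" lebesgue] by simp
    have Apos: "x \<in> K \<and> 0 < V x \<bullet> c" if "x \<in> A" for x
      using that by (cases "x \<in> K") (auto simp: A_def)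
    then have AK: "A \<subseteq> K" by blast
    have small: "emeasure lebesgue A \<le> ennreal e" if "0 < e" for e
    proof -
      obtain T where T: "closed T" "T \<subseteq> A" "A - T \<in> lmeasurable" "emeasure lebesgue (A - T) < ennreal e"
        using sets_lebesgue_inner_closed[OF A \<open>0 < e\<close>] by blast
      have "T = K \<inter> T" using T(2) AK by blast
      then have "compact T" using compact_Int_closed[OF K(1) T(1)] by simp
      moreover have "T \<subseteq> \<Omega>" using T(2) AK K(2) by blast
      ultimately have V0: "(LINT x:T|lebesgue. V x) = 0" and Vi: "set_integrable lebesgue T V"
        using integral_compact_eq_0[OF assms(1) V zero] V by blast+
      have Tm: "T \<in> sets lebesgue" using \<open>compact T\<close> by (auto intro: lmeasurable_compact fmeasurableD)
      have "(LINT x|lebesgue. (indicator T x *\<^sub>R V x) \<bullet> c) = 0"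
        using V0 Vi by (subst integral_inner_left) (auto simp: set_lebesgue_integral_def set_integrable_def)
      moreover have nn: "0 \<le> (indicator T x *\<^sub>R V x) \<bullet> c" for x
        using T(2) Apos[of x] by (cases "x \<in> T") (auto simp: less_imp_le)
      moreover have "integrable lebesgue (\<lambda>x. (indicator T x *\<^sub>R V x) \<bullet> c)"
        using Vi by (intro integrable_inner_left) (auto simp: set_integrable_def)
      ultimately have "AE x in lebesgue. (indicator T x *\<^sub>R V x) \<bullet> c = 0"
        by (subst (asm) integral_nonneg_eq_0_iff_AE) auto
      then have "AE x in lebesgue. x \<notin> T"
        by eventually_elim (use T(2) Apos in fastforce)
      then have "emeasure lebesgue T = 0"
        using Tm by (subst (asm) AE_iff_measurable[where N = T]) auto
      moreover have "emeasure lebesgue A \<le> emeasure lebesgue T + emeasure lebesgue (A - T)"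
        using emeasure_subadditive[of T lebesgue "A - T"] Tm T(2,3)
        by (simp add: Un_absorb1 fmeasurableD)
      ultimately show ?thesis using T(4) by simp
    qed
    have "emeasure lebesgue A \<le> 0"
      by (rule ennreal_le_epsilon) (use small in auto)
    then have "emeasure lebesgue A = 0" by simp
    then have "A \<in> null_sets lebesgue" using A by (simp add: null_setsI)
    then have "AE x in lebesgue. x \<notin> A" by (rule AE_not_in)
    then show ?thesis by eventually_elim (auto simp: A_def indicator_def)
  qed
  have K0: "AE x in lebesgue. x \<in> K \<longrightarrow> V x = 0" if K: "compact K" "K \<subseteq> \<Omega>" for K
  proof -
    have "AE x in lebesgue. \<forall>b\<in>Basis. x \<in> K \<longrightarrow> V x \<bullet> b \<le> 0 \<and> V x \<bullet> (- b) \<le> 0"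
    proof (rule AE_finite_allI)
      fix b :: 'b
      show "AE x in lebesgue. x \<in> K \<longrightarrow> V x \<bullet> b \<le> 0 \<and> V x \<bullet> (- b) \<le> 0"
        using half[OF K, of b] half[OF K, of "- b"] by eventually_elim blast
    qed simp
    then show ?thesis
    proof eventually_elim
      case (elim x)
      show ?case
      proof
        assume "x \<in> K"
        then have "V x \<bullet> b = 0" if "b \<in> Basis" for b using elim that by force
        then show "V x = 0" by (auto simp: euclidean_eq_iff[where 'a = 'b])
      qed
    qed
  qed
  obtain D where D: "countable D" "D \<subseteq> Pow \<Omega>" "\<And>X. X \<in> D \<Longrightarrow> \<exists>a b. X = cbox a b" "\<Union>D = \<Omega>"
    using open_countable_Union_open_cbox[OF assms(1)] by metis
  have "AE x in lebesgue. \<forall>X\<in>D. x \<in> X \<longrightarrow> V x = 0"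
  proof (subst AE_ball_countable[OF D(1)], rule ballI)
    fix X assume X: "X \<in> D"
    then obtain a b where "X = cbox a b" using D(3) by blast
    then show "AE x in lebesgue. x \<in> X \<longrightarrow> V x = 0"
      using K0[of X] X D(2) by auto
  qed
  then have "AE x in lebesgue. x \<in> \<Omega> \<longrightarrow> V x = 0"
    by eventually_elim (use D(4) in blast)
  then show ?thesis using assms(1) by (subst AE_restrict_space_iff) auto
qed

lemma has_weak_gradient_integrable:
  assumes "has_weak_gradient \<Omega> u V" "test_function \<Omega> \<phi>"
  shows "set_integrable lebesgue \<Omega> (\<lambda>x. u x *\<^sub>R gradient \<phi> x)"
    and "set_integrable lebesgue \<Omega> (\<lambda>x. \<phi> x *\<^sub>R V x)"
proof -
  obtain K where K: "compact K" "K \<subseteq> \<Omega>" "\<And>x. x \<notin> K \<Longrightarrow> \<phi> x = 0" "\<And>x. x \<notin> K \<Longrightarrow> gradient \<phi> x = 0"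
    using test_function_support[OF assms(2)] by metis
  note cont = test_function_continuous[OF assms(2), of UNIV]
  show "set_integrable lebesgue \<Omega> (\<lambda>x. u x *\<^sub>R gradient \<phi> x)"
    using assms(1) K by (intro set_integrable_compact_support_scaleR'[OF cont(2)])
      (auto simp: has_weak_gradient_def)
  show "set_integrable lebesgue \<Omega> (\<lambda>x. \<phi> x *\<^sub>R V x)"
    using assms(1) K by (intro set_integrable_compact_support_scaleR[OF cont(1)])
      (auto simp: has_weak_gradient_def)
qed

lemma has_weak_gradient_diff:
  assumes "has_weak_gradient \<Omega> u V" "has_weak_gradient \<Omega> v W"
  shows "has_weak_gradient \<Omega> (\<lambda>x. u x - v x) (\<lambda>x. V x - W x)"
  unfolding has_weak_gradient_def
proof (intro conjI allI impI)
  fix \<phi> assume "test_function \<Omega> \<phi>"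
  note * = has_weak_gradient_integrable[OF assms(1) this] has_weak_gradient_integrable[OF assms(2) this]
  show "(LINT x:\<Omega>|lebesgue. (u x - v x) *\<^sub>R gradient \<phi> x) = - (LINT x:\<Omega>|lebesgue. \<phi> x *\<^sub>R (V x - W x))"
    using assms \<open>test_function \<Omega> \<phi>\<close> *
    by (simp add: has_weak_gradient_def scaleR_diff_left scaleR_diff_right set_integral_diff(2))
qed (use assms in \<open>auto simp: has_weak_gradient_def intro: set_integral_diff(1)\<close>)

lemma has_weak_gradient_unique:
  assumes "open \<Omega>" "has_weak_gradient \<Omega> u V" "has_weak_gradient \<Omega> u W"
  shows "AE x in lebesgue_on \<Omega>. V x = W x"
proof -
  have "AE x in lebesgue_on \<Omega>. V x - W x = 0"
  proof (rule fundamental_lemma[OF assms(1)])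
    show "set_integrable lebesgue K (\<lambda>x. V x - W x)" if "compact K" "K \<subseteq> \<Omega>" for K
      using that assms by (auto simp: has_weak_gradient_def intro: set_integral_diff(1))
    show "(LINT x:\<Omega>|lebesgue. \<phi> x *\<^sub>R (V x - W x)) = 0" if t: "test_function \<Omega> \<phi>" for \<phi>
      using t assms(2,3) has_weak_gradient_integrable[OF assms(2) t] has_weak_gradient_integrable[OF assms(3) t]
      by (simp add: scaleR_diff_right set_integral_diff(2)) (simp add: has_weak_gradient_def)
  qed
  then show ?thesis by simp
qed

text \<open>By uniqueness the gradient picked by the choice operator agrees almost everywhere with any gradient
that is found by other means.\<close>

lemma weak_gradient_AE:
  assumes "open \<Omega>" "has_weak_gradient \<Omega> u V"
  shows "has_weak_gradient \<Omega> u (weak_gradient \<Omega> u)"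
    and "AE x in lebesgue_on \<Omega>. weak_gradient \<Omega> u x = V x"
proof -
  show "has_weak_gradient \<Omega> u (weak_gradient \<Omega> u)"
    unfolding weak_gradient_def by (rule someI[where P = "has_weak_gradient \<Omega> u", OF assms(2)])
  from has_weak_gradient_unique[OF assms(1) this assms(2)]
  show "AE x in lebesgue_on \<Omega>. weak_gradient \<Omega> u x = V x" .
qed


section \<open>N-functions with Lieberman's conditions\<close>

locale lieberman_function =
  fixes G g :: "real \<Rightarrow> real" and \<delta>0 g0 :: real
  assumes N: "N_function G" and lieb: "lieberman \<delta>0 g0 G g" and pos: "0 < \<delta>0" "\<delta>0 \<le> g0"
begin

lemma G_nonneg: "0 \<le> t \<Longrightarrow> 0 \<le> G t"
  and G_pos: "0 < t \<Longrightarrow> 0 < G t"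
  and G_convex: "convex_on {0..} G"
  and G_sublinear: "((\<lambda>t. G t / t) \<longlongrightarrow> 0) (at_right 0)"
  using N by (auto simp: N_function_def)

lemma G_deriv: "0 \<le> t \<Longrightarrow> (G has_real_derivative g t) (at t within {0..})"
  and g_cont: "continuous_on {0..} g"
  and elliptic: "0 < t \<Longrightarrow> \<delta>0 \<le> t * deriv g t / g t \<and> t * deriv g t / g t \<le> g0"
  using lieb by (auto simp: lieberman_def)

lemma G_cont: "continuous_on {0..} G"
  using G_deriv by (auto simp: continuous_on_eq_continuous_within intro: DERIV_continuous)

lemma G_deriv_at: "0 < t \<Longrightarrow> (G has_real_derivative g t) (at t)"
  using G_deriv[of t] at_within_interior[of t "{0..}"] by (simp add: interior_real_atLeast)

lemma g_deriv: "0 < t \<Longrightarrow> (g has_real_derivative deriv g t) (at t)"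
proof -
  assume t: "0 < t"
  obtain D where "(g has_vector_derivative D t) (at t)"
    using lieb t by (auto simp: lieberman_def C1_differentiable_on_def)
  then have "(g has_real_derivative D t) (at t)"
    by (simp add: has_real_derivative_iff_has_vector_derivative)
  then show ?thesis using DERIV_imp_deriv by metis
qed

lemma G_0: "G 0 = 0"
proof -
  have "((\<lambda>t. G t / t * t) \<longlongrightarrow> 0 * 0) (at_right 0)"
    by (intro tendsto_mult G_sublinear tendsto_ident_at)
  moreover have "\<forall>\<^sub>F t in at_right 0. G t / t * t = G t" by (simp add: eventually_at_filter)
  ultimately have "(G \<longlongrightarrow> 0 * 0) (at_right 0)" by (rule Lim_transform_eventually)
  then have "(G \<longlongrightarrow> 0) (at_right 0)" by simp
  moreover have "(G \<longlongrightarrow> G 0) (at_right 0)"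
    using G_cont at_within_Ici_at_right[of "0::real"] unfolding continuous_on_def
    by (metis atLeast_iff order_refl)
  ultimately show ?thesis using tendsto_unique trivial_limit_at_right_real by blast
qed

text \<open>The tangent to \<open>G\<close> at \<open>t\<close>, evaluated at \<open>0\<close>, lies below \<open>G 0 = 0\<close>.\<close>

lemma G_le_tg: "0 \<le> t \<Longrightarrow> G t \<le> t * g t"
proof (cases "t = 0")
  case False
  assume "0 \<le> t"
  with False have "0 < t" by simp
  then have "G 0 - G t \<ge> g t * (0 - t)"
    by (intro convex_on_imp_above_tangent[OF G_convex _ _ _ G_deriv]) (auto simp: interior_real_atLeast)
  then show ?thesis by (simp add: G_0 mult.commute)
qed (simp add: G_0)

lemma g_pos: "0 < t \<Longrightarrow> 0 < g t"
  using G_le_tg[of t] G_pos[of t] by (smt (verit) zero_less_mult_pos)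

lemma g_0: "g 0 = 0"
proof -
  have "((\<lambda>t. (G t - G 0) / (t - 0)) \<longlongrightarrow> g 0) (at 0 within {0..})"
    using G_deriv[of 0] by (simp add: has_field_derivative_iff)
  then have "((\<lambda>t. G t / t) \<longlongrightarrow> g 0) (at_right 0)"
    by (simp add: G_0 at_within_Ici_at_right)
  then show ?thesis using G_sublinear tendsto_unique trivial_limit_at_right_real by blast
qed

lemma g_nonneg: "0 \<le> t \<Longrightarrow> 0 \<le> g t"
  using g_pos[of t] g_0 by (cases "t = 0") (auto simp: less_imp_le)

lemma g_mono:
  assumes s: "0 \<le> s" "s \<le> t"
  shows "g s \<le> g t"
proof (rule DERIV_nonneg_imp_increasing_open[of s t g, OF s(2)])
  show "continuous_on {s..t} g" using g_cont s by (auto intro: continuous_on_subset)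
  fix x assume "s < x" "x < t"
  then have x: "0 < x" using s by simp
  have "0 < x * deriv g x / g x" using elliptic[OF x] pos(1) by linarith
  then have "0 \<le> deriv g x" using x g_pos[OF x] by (simp add: zero_less_divide_iff zero_less_mult_iff)
  then show "\<exists>y. (g has_real_derivative y) (at x) \<and> 0 \<le> y" using g_deriv[OF x] by blast
qed

text \<open>The upper Lieberman bound says that the derivative \<open>g + t g'\<close> of the left side is at most \<open>(1 + g0) g\<close>,
the derivative of the right side.\<close>

lemma tg_le: "0 \<le> t \<Longrightarrow> t * g t \<le> (1 + g0) * G t"
proof -
  assume t: "0 \<le> t"
  have "t * g t - (1 + g0) * G t \<le> 0 * g 0 - (1 + g0) * G 0"
  proof (rule DERIV_nonpos_imp_decreasing_open[of 0 t "\<lambda>t. t * g t - (1 + g0) * G t", OF t])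
    show "continuous_on {0..t} (\<lambda>t. t * g t - (1 + g0) * G t)"
      by (intro continuous_intros continuous_on_subset[OF g_cont] continuous_on_subset[OF G_cont]) auto
    fix x :: real assume x: "0 < x" "x < t"
    have "((\<lambda>t. t * g t - (1 + g0) * G t) has_real_derivative (g x + x * deriv g x - (1 + g0) * g x)) (at x)"
      using g_deriv[OF x(1)] G_deriv_at[OF x(1)] by (auto intro!: derivative_eq_intros)
    moreover have "x * deriv g x \<le> g0 * g x"
      using elliptic[OF x(1)] g_pos[OF x(1)] by (simp add: field_simps)
    then have "g x + x * deriv g x - (1 + g0) * g x \<le> 0" by (simp add: algebra_simps)
    ultimately show "\<exists>y. ((\<lambda>t. t * g t - (1 + g0) * G t) has_real_derivative y) (at x) \<and> y \<le> 0"
      by blast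
  qed
  then show ?thesis by (simp add: G_0)
qed

lemma G_mono:
  assumes s: "0 \<le> s" "s \<le> t"
  shows "G s \<le> G t"
proof (rule DERIV_nonneg_imp_increasing_open[of s t G, OF s(2)])
  show "continuous_on {s..t} G" using G_cont s by (auto intro: continuous_on_subset)
  fix x assume "s < x" "x < t"
  then have x: "0 < x" using s by simp
  then show "\<exists>y. (G has_real_derivative y) (at x) \<and> 0 \<le> y" using G_deriv_at[OF x] g_pos[OF x] by force
qed

text \<open>Doubling: in logarithmic coordinates the slope of \<open>G\<close> is \<open>t g / G\<close>, which is at most \<open>1 + g0\<close>.\<close>

lemma G_dilate: "1 \<le> l \<Longrightarrow> 0 \<le> t \<Longrightarrow> G (l * t) \<le> l powr (1 + g0) * G t"
proof (cases "t = 0")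
  case False
  assume l: "1 \<le> l" and "0 \<le> t"
  with False have t: "0 < t" by simp
  let ?h = "\<lambda>s. ln (G s) - (1 + g0) * ln s"
  have "?h (l * t) \<le> ?h t"
  proof (rule DERIV_nonpos_imp_nonincreasing[of t "l * t" ?h])
    fix x assume "t \<le> x" "x \<le> l * t"
    then have x: "0 < x" using t by simp
    have "(?h has_real_derivative (g x / G x - (1 + g0) * (1 / x))) (at x)"
      using G_deriv_at[OF x] G_pos[OF x] x by (auto intro!: derivative_eq_intros)
    moreover have "g x / G x - (1 + g0) * (1 / x) \<le> 0"
      using tg_le[of x] G_pos[OF x] x by (simp add: field_simps)
    ultimately show "\<exists>y. (?h has_real_derivative y) (at x) \<and> y \<le> 0" by blast
  qed (use l t in simp)
  then have "ln (G (l * t)) \<le> (1 + g0) * ln l + ln (G t)"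
    using l t by (simp add: ln_mult algebra_simps)
  then have "exp (ln (G (l * t))) \<le> exp ((1 + g0) * ln l + ln (G t))" by simp
  then show ?thesis
    using l t G_pos[of t] G_pos[of "l * t"] by (simp add: exp_add powr_def)
qed (simp add: G_0)

lemma G_le_linear: "0 \<le> t \<Longrightarrow> t \<le> 1 \<Longrightarrow> G t \<le> t * G 1"
  using convex_onD[OF G_convex, of t 0 1] by (simp add: G_0)

lemma G_ge_linear: "1 \<le> t \<Longrightarrow> t * G 1 \<le> G t"
  using convex_onD[OF G_convex, of "1 / t" 0 t] by (simp add: G_0 field_simps)

lemma le_1_plus_G:
  assumes "0 \<le> t"
  shows "t \<le> 1 + G t / G 1"
proof (cases "t \<le> 1")
  case True
  then show ?thesis using G_nonneg[OF assms] G_pos[of 1] by (smt (verit) divide_nonneg_pos)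
next
  case False
  then have "t \<le> G t / G 1" using G_ge_linear[of t] G_pos[of 1] by (simp add: field_simps)
  then show ?thesis by simp
qed

lemma G_add_le:
  assumes "0 \<le> s" "0 \<le> t"
  shows "G (s + t) \<le> 2 powr (1 + g0) * (G s + G t)"
proof -
  have "G (s + t) \<le> G (2 * max s t)" using assms by (intro G_mono) auto
  also have "\<dots> \<le> 2 powr (1 + g0) * G (max s t)" using assms by (intro G_dilate) auto
  also have "\<dots> \<le> 2 powr (1 + g0) * (G s + G t)"
    using assms G_nonneg by (intro mult_left_mono) (auto simp: max_def)
  finally show ?thesis .
qed

text \<open>A replacement for Young's inequality with the complementary function. The parameter \<open>l\<close> is the scale
of the Luxemburg norm: when that norm of the second factor tends to \<open>0\<close>, so does the pairing.\<close>

lemma g_mult_le: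
  assumes "0 \<le> s" "0 \<le> t" "0 < l"
  shows "g s * t \<le> l * (1 + g0) * (G s + G (t / l))"
proof -
  have "g s * (t / l) \<le> g (max s (t / l)) * max s (t / l)"
    using assms by (intro mult_mono g_mono g_nonneg) auto
  also have "\<dots> = max s (t / l) * g (max s (t / l))" by (rule mult.commute)
  also have "\<dots> \<le> (1 + g0) * G (max s (t / l))" using assms by (intro tg_le) auto
  also have "\<dots> \<le> (1 + g0) * (G s + G (t / l))"
    using assms pos G_nonneg by (intro mult_left_mono) (auto simp: max_def)
  finally show ?thesis using assms(3) by (simp add: field_simps)
qed

lemma g_le_1_plus_G: "0 \<le> s \<Longrightarrow> g s \<le> (1 + g0) * (G s + G 1)"
  using g_mult_le[of s 1 1] by simp

lemma measurable_G:
  assumes "u \<in> borel_measurable M" "\<And>x. 0 \<le> u x"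
  shows "(\<lambda>x. G (u x)) \<in> borel_measurable M"
proof -
  have "continuous_on UNIV (\<lambda>t. G (max 0 t))"
    by (rule continuous_on_compose2[OF G_cont]) (auto intro!: continuous_intros)
  then have "(\<lambda>x. G (max 0 (u x))) \<in> borel_measurable M"
    by (rule borel_measurable_continuous_on[OF _ assms(1)])
  then show ?thesis using assms(2) by (simp add: max_absorb2)
qed

lemma measurable_g:
  assumes "u \<in> borel_measurable M" "\<And>x. 0 \<le> u x"
  shows "(\<lambda>x. g (u x)) \<in> borel_measurable M"
proof -
  have "continuous_on UNIV (\<lambda>t. g (max 0 t))"
    by (rule continuous_on_compose2[OF g_cont]) (auto intro!: continuous_intros)
  then have "(\<lambda>x. g (max 0 (u x))) \<in> borel_measurable M"
    by (rule borel_measurable_continuous_on[OF _ assms(1)])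
  then show ?thesis using assms(2) by (simp add: max_absorb2)
qed

end

section \<open>Luxemburg norms on sets of finite measure\<close>

lemma AE_lebesgue_measurable:
  fixes f h :: "'a::euclidean_space \<Rightarrow> 'b::euclidean_space"
  assumes f: "f \<in> borel_measurable lebesgue" and ae: "AE x in lebesgue. f x = h x"
  shows "h \<in> borel_measurable lebesgue"
proof (rule measurableI)
  fix A :: "'b set" assume A: "A \<in> sets borel"
  show "h -` A \<inter> space lebesgue \<in> sets lebesgue"
  proof (rule completion.in_sets_AE)
    show "AE x in lebesgue. (x \<in> f -` A \<inter> space lebesgue) = (x \<in> h -` A \<inter> space lebesgue)"
      using ae by eventually_elim auto
    show "f -` A \<inter> space lebesgue \<in> sets lebesgue" using f A by (rule measurable_sets)
  qed auto
qed auto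

lemma AE_lebesgue_on_measurable:
  fixes f h :: "'a::euclidean_space \<Rightarrow> 'b::euclidean_space"
  assumes "\<Omega> \<in> sets lebesgue" "f \<in> borel_measurable (lebesgue_on \<Omega>)" "AE x in lebesgue_on \<Omega>. h x = f x"
  shows "h \<in> borel_measurable (lebesgue_on \<Omega>)"
proof -
  have F: "(\<lambda>x. indicator \<Omega> x *\<^sub>R f x) \<in> borel_measurable lebesgue"
    using assms(1,2) by (subst (asm) borel_measurable_restrict_space_iff) auto
  have "AE x in lebesgue. x \<in> \<Omega> \<longrightarrow> h x = f x"
    using assms(1,3) by (subst (asm) AE_restrict_space_iff) auto
  then have "AE x in lebesgue. indicator \<Omega> x *\<^sub>R f x = indicator \<Omega> x *\<^sub>R h x" by eventually_elim auto
  from AE_lebesgue_measurable[OF F this] show ?thesis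
    using assms(1) by (subst borel_measurable_restrict_space_iff) auto
qed

lemma nn_set_integral_lebesgue_on:
  "\<Omega> \<in> sets lebesgue \<Longrightarrow> (\<integral>\<^sup>+x\<in>\<Omega>. f x \<partial>lebesgue) = (\<integral>\<^sup>+x. f x \<partial>lebesgue_on \<Omega>)"
  by (subst nn_integral_restrict_space) auto

lemma set_integral_lebesgue_on:
  fixes f :: "'a::euclidean_space \<Rightarrow> 'b::euclidean_space"
  shows "\<Omega> \<in> sets lebesgue \<Longrightarrow> (LINT x:\<Omega>|lebesgue. f x) = (LINT x|lebesgue_on \<Omega>. f x)"
  by (subst integral_restrict_space) (auto simp: set_lebesgue_integral_def)

text \<open>The norm sees a function only up to null sets, so in it a representative chosen as a weak gradient
can be replaced by a classical one.\<close>

lemma luxemburg_norm_cong_AE: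
  assumes "\<Omega> \<in> sets lebesgue" "AE x in lebesgue_on \<Omega>. u x = v x"
  shows "luxemburg_norm G \<Omega> u = luxemburg_norm G \<Omega> v"
proof -
  have "(\<integral>\<^sup>+x. ennreal (G (norm (u x) / l)) \<partial>lebesgue_on \<Omega>) = (\<integral>\<^sup>+x. ennreal (G (norm (v x) / l)) \<partial>lebesgue_on \<Omega>)" for l
    by (rule nn_integral_cong_AE) (use assms(2) in \<open>eventually_elim, simp\<close>)
  then show ?thesis by (simp add: luxemburg_norm_def nn_set_integral_lebesgue_on assms(1))
qed

lemma luxemburg_norm_le:
  assumes "\<Omega> \<in> sets lebesgue" "0 < l" "(\<integral>\<^sup>+x. ennreal (G (norm (u x) / l)) \<partial>lebesgue_on \<Omega>) \<le> 1"
  shows "luxemburg_norm G \<Omega> u \<le> ennreal l"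
  unfolding luxemburg_norm_def
  by (rule Inf_lower) (use assms in \<open>auto simp: nn_set_integral_lebesgue_on\<close>)

lemma tendsto_0_ennrealI:
  fixes f :: "nat \<Rightarrow> ennreal"
  assumes "\<And>e. 0 < e \<Longrightarrow> \<forall>\<^sub>F n in sequentially. f n \<le> ennreal e"
  shows "f \<longlonglongrightarrow> 0"
proof (rule order_tendstoI)
  fix a :: ennreal assume "0 < a"
  then obtain b where b: "0 < b" "b < a" using dense by blast
  then obtain e where e: "b = ennreal e" "0 < e"
    by (cases b) (auto simp: ennreal_zero_less_top)
  show "\<forall>\<^sub>F n in sequentially. f n < a"
    using assms[OF e(2)] by eventually_elim (use b e in auto)
qed simp

locale orlicz_setting = lieberman_function +
  fixes \<Omega> :: "'a::euclidean_space set"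
  assumes open_\<Omega>: "open \<Omega>" and bounded_\<Omega>: "bounded \<Omega>"
begin

abbreviation "M \<equiv> lebesgue_on \<Omega>"

lemma \<Omega>: "\<Omega> \<in> lmeasurable"
  using open_\<Omega> bounded_\<Omega> by (rule lmeasurable_open[rotated])

lemma sets_\<Omega>: "\<Omega> \<in> sets lebesgue" using \<Omega> by (rule fmeasurableD)

sublocale finite_measure M
  using \<Omega> by (intro finite_measure_lebesgue_on)

lemma luxemburg_norm_less_modular:
  assumes u: "luxemburg_norm G \<Omega> u < ennreal l"
  shows "(\<integral>\<^sup>+x. ennreal (G (norm (u x) / l)) \<partial>M) \<le> 1"
proof -
  obtain k where k: "0 < k" "ennreal k < ennreal l" "(\<integral>\<^sup>+x. ennreal (G (norm (u x) / k)) \<partial>M) \<le> 1"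
    using u unfolding luxemburg_norm_def by (auto simp: Inf_less_iff nn_set_integral_lebesgue_on sets_\<Omega>)
  have kl: "k < l" using k(1,2) by (simp add: ennreal_less_iff)
  have "(\<integral>\<^sup>+x. ennreal (G (norm (u x) / l)) \<partial>M) \<le> (\<integral>\<^sup>+x. ennreal (G (norm (u x) / k)) \<partial>M)"
    using k(1) kl by (intro nn_integral_mono ennreal_leI G_mono divide_left_mono) auto
  with k(3) show ?thesis by simp
qed

text \<open>Linear growth of \<open>G\<close> at infinity and finite measure embed the Orlicz space into \<open>L\<^sup>1\<close>.\<close>

lemma luxemburg_norm_less_L1:
  fixes u :: "'a \<Rightarrow> 'b::euclidean_space"
  assumes u: "luxemburg_norm G \<Omega> u < ennreal l" and l: "0 < l" and meas: "u \<in> borel_measurable M"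
  shows "integrable M u" "(LINT x|M. norm (u x)) \<le> l * (measure M (space M) + 1 / G 1)"
proof -
  let ?C = "measure M (space M) + 1 / G 1"
  have "ennreal (norm (u x)) \<le> ennreal l * (1 + ennreal (1 / G 1) * ennreal (G (norm (u x) / l)))" for x
  proof -
    have "norm (u x) \<le> l * (1 + G (norm (u x) / l) / G 1)"
      using le_1_plus_G[of "norm (u x) / l"] l by (simp add: field_simps)
    then have "ennreal (norm (u x)) \<le> ennreal (l * (1 + (1 / G 1) * G (norm (u x) / l)))"
      by (intro ennreal_leI) simp
    also have "\<dots> = ennreal l * (1 + ennreal (1 / G 1) * ennreal (G (norm (u x) / l)))"
    proof -
      have "ennreal (l * (1 + c * a)) = ennreal l * (1 + ennreal c * ennreal a)" if "0 \<le> c" "0 \<le> a" for c a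
        using that l by (simp add: ennreal_mult ennreal_plus)
      from this[of "1 / G 1" "G (norm (u x) / l)"] show ?thesis
        using l G_nonneg[of "norm (u x) / l"] G_pos[of 1] by (simp only: zero_le_divide_1_iff) simp
    qed
    finally show ?thesis .
  qed
  then have "(\<integral>\<^sup>+x. ennreal (norm (u x)) \<partial>M)
      \<le> (\<integral>\<^sup>+x. ennreal l * (1 + ennreal (1 / G 1) * ennreal (G (norm (u x) / l))) \<partial>M)"
    by (rule nn_integral_mono)
  also have "\<dots> = ennreal l * (emeasure M (space M) + ennreal (1 / G 1) * (\<integral>\<^sup>+x. ennreal (G (norm (u x) / l)) \<partial>M))"
  proof -
    have m: "(\<lambda>x. G (norm (u x) / l)) \<in> borel_measurable M"
      using meas l by (intro measurable_G) auto
    then show ?thesis by (simp add: nn_integral_cmult nn_integral_add)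
  qed
  also have "\<dots> \<le> ennreal l * (emeasure M (space M) + ennreal (1 / G 1) * 1)"
    by (intro mult_left_mono add_left_mono luxemburg_norm_less_modular[OF u]) auto
  also have "\<dots> = ennreal (l * ?C)"
    using l G_pos[of 1] by (simp add: emeasure_eq_measure ennreal_mult ennreal_plus)
  finally have le: "(\<integral>\<^sup>+x. ennreal (norm (u x)) \<partial>M) \<le> ennreal (l * ?C)" .
  then show int: "integrable M u"
    using meas by (intro integrableI_bounded) (auto intro: le_less_trans)
  have "ennreal (LINT x|M. norm (u x)) = (\<integral>\<^sup>+x. ennreal (norm (u x)) \<partial>M)"
    using int by (intro nn_integral_eq_integral[symmetric]) auto
  then show "(LINT x|M. norm (u x)) \<le> l * ?C"
  proof -
    have "0 \<le> l * ?C" using l G_pos[of 1] by (intro mult_nonneg_nonneg) auto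
    moreover have "ennreal (LINT x|M. norm (u x)) \<le> ennreal (l * ?C)"
      using le \<open>ennreal _ = _\<close> by (simp only:)
    ultimately show ?thesis using ennreal_le_iff by blast
  qed
qed

lemma luxemburg_tendsto_0_L1:
  fixes u :: "nat \<Rightarrow> 'a \<Rightarrow> 'b::euclidean_space"
  assumes "(\<lambda>k. luxemburg_norm G \<Omega> (u k)) \<longlonglongrightarrow> 0" "\<And>k. u k \<in> borel_measurable M"
  shows "(\<lambda>k. LINT x|M. norm (u k x)) \<longlonglongrightarrow> 0"
proof (rule tendstoI)
  fix e :: real assume "0 < e"
  let ?C = "measure M (space M) + 1 / G 1"
  have C: "0 < ?C" using G_pos[of 1] by (simp add: add_nonneg_pos)
  have "\<forall>\<^sub>F k in sequentially. luxemburg_norm G \<Omega> (u k) < ennreal (e / (2 * ?C))"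
    using assms(1) \<open>0 < e\<close> C by (intro order_tendstoD) auto
  then show "\<forall>\<^sub>F k in sequentially. dist (LINT x|M. norm (u k x)) 0 < e"
  proof eventually_elim
    case (elim k)
    have "(LINT x|M. norm (u k x)) \<le> e / (2 * ?C) * ?C"
      using luxemburg_norm_less_L1(2)[OF elim _ assms(2)] \<open>0 < e\<close> C by simp
    also have "\<dots> = e / 2"
    proof -
      have "e / (2 * c) * c = e / 2" if "0 < c" for c using that by simp
      from this[OF C] show ?thesis .
    qed
    also have "\<dots> < e" using \<open>0 < e\<close> by simp
    finally show ?case by simp
  qed
qed

text \<open>A finite norm only bounds the modular of a multiple of \<open>u\<close>; doubling removes the factor.\<close>

lemma orlicz_space_integrable:
  fixes u :: "'a \<Rightarrow> 'b::euclidean_space"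
  assumes "u \<in> orlicz_space G \<Omega>"
  shows "integrable M u" "integrable M (\<lambda>x. G (norm (u x)))"
proof -
  have meas: "u \<in> borel_measurable M" and fin: "luxemburg_norm G \<Omega> u < \<infinity>"
    using assms by (auto simp: orlicz_space_def)
  obtain r where r: "luxemburg_norm G \<Omega> u = ennreal r" "0 \<le> r"
    using fin by (cases "luxemburg_norm G \<Omega> u") auto
  let ?l = "r + 1"
  have l: "luxemburg_norm G \<Omega> u < ennreal ?l" using r by (simp add: ennreal_less_iff)
  show "integrable M u" using luxemburg_norm_less_L1(1)[OF l _ meas] r by simp
  have Gm: "(\<lambda>x. G (norm (u x))) \<in> borel_measurable M" using meas by (intro measurable_G) auto
  show "integrable M (\<lambda>x. G (norm (u x)))"
  proof (rule integrableI_bounded[OF Gm])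
    have "(\<integral>\<^sup>+x. ennreal (norm (G (norm (u x)))) \<partial>M)
        \<le> (\<integral>\<^sup>+x. ennreal (?l powr (1 + g0)) * ennreal (G (norm (u x) / ?l)) \<partial>M)"
    proof (rule nn_integral_mono)
      fix x
      have "G (?l * (norm (u x) / ?l)) \<le> ?l powr (1 + g0) * G (norm (u x) / ?l)"
        using r by (intro G_dilate) auto
      then show "ennreal (norm (G (norm (u x)))) \<le> ennreal (?l powr (1 + g0)) * ennreal (G (norm (u x) / ?l))"
        using r G_nonneg by (simp add: ennreal_mult[symmetric] ennreal_leI)
    qed
    also have "\<dots> = ennreal (?l powr (1 + g0)) * (\<integral>\<^sup>+x. ennreal (G (norm (u x) / ?l)) \<partial>M)"
      using measurable_G[of "\<lambda>x. norm (u x) / ?l" M] meas r by (intro nn_integral_cmult) auto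
    also have "\<dots> \<le> ennreal (?l powr (1 + g0)) * 1"
      by (intro mult_left_mono luxemburg_norm_less_modular[OF l]) auto
    also have "\<dots> < \<infinity>" by simp
    finally show "(\<integral>\<^sup>+x. ennreal (norm (G (norm (u x)))) \<partial>M) < \<infinity>" .
  qed
qed

text \<open>At every scale \<open>l\<close> the modular tends to \<open>0\<close> by dominated convergence, so the norm is eventually at
most \<open>l\<close>.\<close>

lemma luxemburg_tendsto_0_bounded:
  fixes u :: "nat \<Rightarrow> 'a \<Rightarrow> 'b::euclidean_space"
  assumes meas: "\<And>k. u k \<in> borel_measurable M" and bd: "\<And>k x. x \<in> \<Omega> \<Longrightarrow> norm (u k x) \<le> B"
    and ae: "AE x in M. (\<lambda>k. u k x) \<longlonglongrightarrow> 0"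
  shows "(\<lambda>k. luxemburg_norm G \<Omega> (u k)) \<longlonglongrightarrow> 0"
proof (rule tendsto_0_ennrealI)
  fix l :: real assume l: "0 < l"
  have Gcont: "continuous_on UNIV (\<lambda>t. G (max 0 t))"
    by (rule continuous_on_compose2[OF G_cont]) (auto intro!: continuous_intros)
  have m: "(\<lambda>x. G (norm (u k x) / l)) \<in> borel_measurable M" for k
    using meas l by (intro measurable_G) auto
  have B: "norm (G (norm (u k x) / l)) \<le> G (\<bar>B\<bar> / l)" if "x \<in> \<Omega>" for k x
  proof -
    have "norm (u k x) / l \<le> \<bar>B\<bar> / l" using bd[OF that, of k] l by (intro divide_right_mono) auto
    moreover have "0 \<le> norm (u k x) / l" using l by simp
    ultimately show ?thesis using G_mono[of "norm (u k x) / l" "\<bar>B\<bar> / l"] G_nonneg by simp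
  qed
  have "(\<lambda>k. LINT x|M. G (norm (u k x) / l)) \<longlonglongrightarrow> (LINT x|M. 0)"
  proof (rule integral_dominated_convergence[where w = "\<lambda>x. G (\<bar>B\<bar> / l)"])
    show "AE x in M. (\<lambda>k. G (norm (u k x) / l)) \<longlonglongrightarrow> 0"
      using ae
    proof eventually_elim
      case (elim x)
      have "(\<lambda>k. norm (u k x) / l) \<longlonglongrightarrow> 0 / l"
        using l by (intro tendsto_divide tendsto_norm_zero elim tendsto_const) auto
      then have "(\<lambda>k. G (max 0 (norm (u k x) / l))) \<longlonglongrightarrow> G (max 0 0)"
        using continuous_on_tendsto_compose[OF Gcont, of "\<lambda>k. norm (u k x) / l" 0 sequentially] by simp
      then show ?case using l by (simp add: max_absorb2 G_0)
    qed
    show "AE x in M. norm (G (norm (u k x) / l)) \<le> G (\<bar>B\<bar> / l)" for k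
      using B by (intro AE_I2) auto
  qed (use m in auto)
  then have "\<forall>\<^sub>F k in sequentially. (LINT x|M. G (norm (u k x) / l)) < 1"
    by (intro order_tendstoD) auto
  then show "\<forall>\<^sub>F k in sequentially. luxemburg_norm G \<Omega> (u k) \<le> ennreal l"
  proof eventually_elim
    case (elim k)
    have "integrable M (\<lambda>x. G (norm (u k x) / l))"
      using B by (intro integrable_const_bound[where B = "G (\<bar>B\<bar> / l)"] m AE_I2) auto
    then have "(\<integral>\<^sup>+x. ennreal (G (norm (u k x) / l)) \<partial>M) = ennreal (LINT x|M. G (norm (u k x) / l))"
      using G_nonneg l by (intro nn_integral_eq_integral) auto
    also have "\<dots> \<le> 1" using elim by simp
    finally show ?case by (rule luxemburg_norm_le[OF sets_\<Omega> l])
  qed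
qed

lemma bounded_orlicz_space:
  fixes u :: "'a \<Rightarrow> 'b::euclidean_space"
  assumes "u \<in> borel_measurable M" "\<And>x. x \<in> \<Omega> \<Longrightarrow> norm (u x) \<le> B"
  shows "u \<in> orlicz_space G \<Omega>"
proof -
  let ?m = "measure M (space M)"
  define l where "l = (\<bar>B\<bar> + 1) * (1 + G 1 * ?m)"
  have G1: "0 < G 1" using G_pos[of 1] by simp
  have c: "1 \<le> 1 + G 1 * ?m" using G1 by simp
  have l: "0 < l" unfolding l_def using c by (intro mult_pos_pos) auto
  have "(\<integral>\<^sup>+x. ennreal (G (norm (u x) / l)) \<partial>M) \<le> (\<integral>\<^sup>+x. ennreal (G 1 / (1 + G 1 * ?m)) \<partial>M)"
  proof (rule nn_integral_mono)
    fix x assume "x \<in> space M"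
    then have "norm (u x) \<le> \<bar>B\<bar> + 1" using assms(2)[of x] by (simp add: space_restrict_space)
    then have "norm (u x) / l \<le> (\<bar>B\<bar> + 1) / l" using l by (intro divide_right_mono) auto
    also have "\<dots> = 1 / (1 + G 1 * ?m)" unfolding l_def by (simp add: add_eq_0_iff abs_if)
    finally have "G (norm (u x) / l) \<le> G (1 / (1 + G 1 * ?m))" using l by (intro G_mono) auto
    also have "\<dots> \<le> 1 / (1 + G 1 * ?m) * G 1" using c by (intro G_le_linear) auto
    finally show "ennreal (G (norm (u x) / l)) \<le> ennreal (G 1 / (1 + G 1 * ?m))"
      by (intro ennreal_leI) simp
  qed
  also have "\<dots> = ennreal (G 1 / (1 + G 1 * ?m) * ?m)"
    using G1 c by (simp add: emeasure_eq_measure ennreal_mult[symmetric])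
  also have "\<dots> \<le> 1" using c by (simp add: field_simps)
  finally have "luxemburg_norm G \<Omega> u \<le> ennreal l" by (rule luxemburg_norm_le[OF sets_\<Omega> l])
  then show ?thesis using assms(1) by (auto simp: orlicz_space_def intro: le_less_trans)
qed

end


section \<open>Continuously differentiable truncations\<close>

text \<open>A \<open>C\<^sup>1\<close> version of the positive part with error at most \<open>\<tau>\<close>; its derivative is positive exactly where
the positive part is, which the comparison argument needs.\<close>

definition ramp :: "real \<Rightarrow> real \<Rightarrow> real" where
  "ramp \<tau> s = (if 0 < s then s\<^sup>2 / (s + \<tau>) else 0)"

definition ramp' :: "real \<Rightarrow> real \<Rightarrow> real" where
  "ramp' \<tau> s = (if 0 < s then 1 - (\<tau> / (s + \<tau>))\<^sup>2 else 0)"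

lemma ramp_bounds:
  assumes "0 < \<tau>"
  shows "0 \<le> ramp \<tau> s" "0 < s \<Longrightarrow> 0 < ramp \<tau> s" "0 < s \<Longrightarrow> ramp \<tau> s \<le> s" "s - \<tau> \<le> ramp \<tau> s"
proof -
  show "0 \<le> ramp \<tau> s" "0 < s \<Longrightarrow> 0 < ramp \<tau> s" using assms by (auto simp: ramp_def)
  show "0 < s \<Longrightarrow> ramp \<tau> s \<le> s" using assms by (auto simp: ramp_def field_simps power2_eq_square)
  show "s - \<tau> \<le> ramp \<tau> s"
  proof (cases "0 < s")
    case True
    have "(s - \<tau>) * (s + \<tau>) \<le> s\<^sup>2" by (simp add: algebra_simps power2_eq_square)
    then show ?thesis using True assms by (simp add: ramp_def pos_le_divide_eq)
  qed (use assms in \<open>simp add: ramp_def\<close>)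
qed

lemma ramp'_bounds:
  assumes "0 < \<tau>"
  shows "0 \<le> ramp' \<tau> s" "ramp' \<tau> s \<le> 1" "0 < s \<Longrightarrow> 0 < ramp' \<tau> s"
proof -
  have *: "(\<tau> / (s + \<tau>))\<^sup>2 < 1" if "0 < s"
    using assms that power_strict_mono[of "\<tau> / (s + \<tau>)" 1 2] by simp
  show "0 \<le> ramp' \<tau> s" "0 < s \<Longrightarrow> 0 < ramp' \<tau> s" "ramp' \<tau> s \<le> 1"
    using * by (auto simp: ramp'_def)
qed

lemma ramp_deriv:
  assumes "0 < \<tau>"
  shows "(ramp \<tau> has_real_derivative ramp' \<tau> s) (at s)"
proof (cases s "0::real" rule: linorder_cases)
  case less
  then show ?thesis
    by (subst DERIV_cong_ev[where g = "\<lambda>s. 0" and y = s and v = 0])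
       (auto simp: ramp_def ramp'_def intro!: eventually_mono[OF eventually_nhds_in_open[of "{..<0}"]])
next
  case equal
  have "((\<lambda>h. ramp \<tau> h / h) \<longlongrightarrow> 0) (at 0)"
  proof (rule tendsto_sandwich[of "\<lambda>h. 0"])
    show "\<forall>\<^sub>F h in at 0. ramp \<tau> h / h \<le> \<bar>h\<bar> / \<tau>"
    proof (intro always_eventually allI)
      fix h
      show "ramp \<tau> h / h \<le> \<bar>h\<bar> / \<tau>"
      proof (cases "0 < h")
        case True
        then have "h / (h + \<tau>) \<le> h / \<tau>" using assms by (intro divide_left_mono) auto
        then show ?thesis using True by (simp add: ramp_def power2_eq_square)
      next
        case False
        have "0 \<le> \<bar>h\<bar> / \<tau>" using assms by (intro divide_nonneg_pos) auto
        moreover have "ramp \<tau> h / h = 0" using False by (simp add: ramp_def)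
        ultimately show ?thesis by linarith
      qed
    qed
    show "\<forall>\<^sub>F h in at 0. 0 \<le> ramp \<tau> h / h"
      using assms by (intro always_eventually) (auto simp: ramp_def)
    show "((\<lambda>h. \<bar>h\<bar> / \<tau>) \<longlongrightarrow> 0) (at 0)"
      using assms by (auto intro!: tendsto_eq_intros)
  qed simp
  then show ?thesis using equal by (simp add: DERIV_def ramp_def[of _ 0] ramp'_def)
next
  case greater
  have ev: "\<forall>\<^sub>F x in nhds s. ramp \<tau> x = x\<^sup>2 / (x + \<tau>)"
    using greater by (auto simp: ramp_def intro!: eventually_mono[OF eventually_nhds_in_open[of "{0<..}"]])
  have "((\<lambda>x. x\<^sup>2 / (x + \<tau>)) has_real_derivative (2 * s * (s + \<tau>) - s\<^sup>2) / ((s + \<tau>) * (s + \<tau>))) (at s)"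
    using greater assms by (auto intro!: derivative_eq_intros)
  moreover have "(2 * s * (s + \<tau>) - s\<^sup>2) / ((s + \<tau>) * (s + \<tau>)) = ramp' \<tau> s"
  proof -
    have "2 * s * (s + \<tau>) - s\<^sup>2 = (s + \<tau>)\<^sup>2 - \<tau>\<^sup>2" by (simp add: power2_eq_square algebra_simps)
    then show ?thesis
      using greater assms by (simp add: ramp'_def power_divide diff_divide_distrib flip: power2_eq_square)
  qed
  ultimately show ?thesis by (subst DERIV_cong_ev[OF refl ev refl]) simp
qed

lemma ramp'_continuous:
  assumes "0 < \<tau>"
  shows "continuous_on UNIV (ramp' \<tau>)"
proof -
  have "ramp' \<tau> s = 1 - (\<tau> / (max 0 s + \<tau>))\<^sup>2" for s
    using assms by (auto simp: ramp'_def max_def)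
  then have "ramp' \<tau> = (\<lambda>s. 1 - (\<tau> / (max 0 s + \<tau>))\<^sup>2)" by auto
  moreover have "continuous_on UNIV (\<lambda>s. 1 - (\<tau> / (max 0 s + \<tau>))\<^sup>2)"
    using assms by (intro continuous_intros) (smt (verit) max.cobounded1)
  ultimately show ?thesis by simp
qed

text \<open>A \<open>C\<^sup>1\<close> version of truncation to \<open>[a, b]\<close>: the identity there, with values in \<open>[a - \<tau>, b + \<tau>]\<close> and
derivative between \<open>0\<close> and \<open>1\<close>.\<close>

definition trunc :: "real \<Rightarrow> real \<Rightarrow> real \<Rightarrow> real \<Rightarrow> real" where
  "trunc a b \<tau> s = s - ramp \<tau> (s - b) + ramp \<tau> (a - s)"

definition trunc' :: "real \<Rightarrow> real \<Rightarrow> real \<Rightarrow> real \<Rightarrow> real" where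
  "trunc' a b \<tau> s = 1 - ramp' \<tau> (s - b) - ramp' \<tau> (a - s)"

lemma trunc_deriv:
  assumes "0 < \<tau>"
  shows "(trunc a b \<tau> has_real_derivative trunc' a b \<tau> s) (at s)"
proof -
  have 1: "((\<lambda>s. ramp \<tau> (s - b)) has_real_derivative ramp' \<tau> (s - b) * 1) (at s)"
    by (rule DERIV_chain2[OF ramp_deriv[OF assms]]) (auto intro!: derivative_eq_intros)
  have 2: "((\<lambda>s. ramp \<tau> (a - s)) has_real_derivative ramp' \<tau> (a - s) * (- 1)) (at s)"
    by (rule DERIV_chain2[OF ramp_deriv[OF assms]]) (auto intro!: derivative_eq_intros)
  show ?thesis
    unfolding trunc_def[abs_def] trunc'_def using 1 2 by (auto intro!: derivative_eq_intros)
qed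

lemma trunc'_continuous:
  assumes "0 < \<tau>"
  shows "continuous_on UNIV (trunc' a b \<tau>)"
  unfolding trunc'_def[abs_def]
  by (intro continuous_intros continuous_on_compose2[OF ramp'_continuous[OF assms]]) auto

lemma trunc_bounds:
  assumes "0 < \<tau>" "a \<le> b"
  shows "a - \<tau> \<le> trunc a b \<tau> s" "trunc a b \<tau> s \<le> b + \<tau>"
    and "a \<le> s \<Longrightarrow> s \<le> b \<Longrightarrow> trunc a b \<tau> s = s"
    and "0 \<le> trunc' a b \<tau> s" "trunc' a b \<tau> s \<le> 1"
    and "a \<le> 0 \<Longrightarrow> 0 \<le> b \<Longrightarrow> \<bar>trunc a b \<tau> s\<bar> \<le> \<bar>s\<bar>"
proof -
  have r0: "ramp \<tau> r = 0" "ramp' \<tau> r = 0" if "r \<le> 0" for r using that by (auto simp: ramp_def ramp'_def)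
  note rb = ramp_bounds[OF assms(1)] ramp'_bounds[OF assms(1)]
  consider "s < a" | "a \<le> s" "s \<le> b" | "b < s" by linarith
  then have "a - \<tau> \<le> trunc a b \<tau> s \<and> trunc a b \<tau> s \<le> b + \<tau> \<and> (a \<le> s \<longrightarrow> s \<le> b \<longrightarrow> trunc a b \<tau> s = s)
    \<and> 0 \<le> trunc' a b \<tau> s \<and> trunc' a b \<tau> s \<le> 1 \<and> (a \<le> 0 \<longrightarrow> 0 \<le> b \<longrightarrow> \<bar>trunc a b \<tau> s\<bar> \<le> \<bar>s\<bar>)"
  proof cases
    case 1
    then show ?thesis using r0[of "s - b"] rb(3,4,5,6)[of "a - s"] rb(1)[of "a - s"] assms
      by (auto simp: trunc_def trunc'_def)
  next
    case 2
    then show ?thesis using r0[of "s - b"] r0[of "a - s"] assms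
      by (auto simp: trunc_def trunc'_def)
  next
    case 3
    then show ?thesis using r0[of "a - s"] rb(3,4,5,6)[of "s - b"] rb(1)[of "s - b"] assms
      by (auto simp: trunc_def trunc'_def)
  qed
  then show "a - \<tau> \<le> trunc a b \<tau> s" "trunc a b \<tau> s \<le> b + \<tau>"
    "a \<le> s \<Longrightarrow> s \<le> b \<Longrightarrow> trunc a b \<tau> s = s"
    "0 \<le> trunc' a b \<tau> s" "trunc' a b \<tau> s \<le> 1"
    "a \<le> 0 \<Longrightarrow> 0 \<le> b \<Longrightarrow> \<bar>trunc a b \<tau> s\<bar> \<le> \<bar>s\<bar>" by auto
qed

lemma C1_on_trunc:
  assumes "C1_on S f V" "0 < \<tau>"
  shows "C1_on S (\<lambda>x. trunc a b \<tau> (f x)) (\<lambda>x. trunc' a b \<tau> (f x) *\<^sub>R V x)"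
  by (rule C1_on_compose[OF assms(1) trunc_deriv[OF assms(2)] trunc'_continuous[OF assms(2)]])

text \<open>Truncations with range shrinking to \<open>0\<close>; their derivatives converge to the indicator of \<open>{0}\<close>.\<close>

abbreviation clip :: "nat \<Rightarrow> real \<Rightarrow> real" where
  "clip n \<equiv> trunc (- (1 / Suc n)) (1 / Suc n) (1 / Suc n)"

abbreviation clip' :: "nat \<Rightarrow> real \<Rightarrow> real" where
  "clip' n \<equiv> trunc' (- (1 / Suc n)) (1 / Suc n) (1 / Suc n)"

lemma clip_tendsto_0: "(\<lambda>n. clip n s) \<longlonglongrightarrow> 0"
proof (rule tendsto_sandwich[of "\<lambda>n. - (2 * inverse (real (Suc n)))" _ _ "\<lambda>n. 2 * inverse (real (Suc n))"])
  have "- (1 / real (Suc n)) - 1 / Suc n \<le> clip n s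
      \<and> clip n s \<le> 1 / Suc n + 1 / Suc n" for n
    using trunc_bounds(1,2)[of "1 / Suc n" "- (1 / Suc n)" "1 / Suc n" s] by simp
  then show "\<forall>\<^sub>F n in sequentially. - (2 * inverse (real (Suc n))) \<le> clip n s"
    "\<forall>\<^sub>F n in sequentially. clip n s \<le> 2 * inverse (real (Suc n))"
    by (auto intro!: always_eventually simp: inverse_eq_divide)
  have "(\<lambda>n. 2 * inverse (real (Suc n))) \<longlonglongrightarrow> 2 * 0"
    by (intro tendsto_mult tendsto_const LIMSEQ_inverse_real_of_nat)
  then show "(\<lambda>n. 2 * inverse (real (Suc n))) \<longlonglongrightarrow> 0" by simp
  then show "(\<lambda>n. - (2 * inverse (real (Suc n)))) \<longlonglongrightarrow> 0"
    using tendsto_minus by fastforce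
qed

lemma clip'_tendsto:
  "(\<lambda>n. clip' n s) \<longlonglongrightarrow> (if s = 0 then 1 else 0)"
proof (cases "s = 0")
  case True
  then show ?thesis by (simp add: trunc'_def ramp'_def)
next
  case False
  have lim: "(\<lambda>n. inverse (real (Suc n))) \<longlonglongrightarrow> 0" by (rule LIMSEQ_inverse_real_of_nat)
  then have "\<forall>\<^sub>F n in sequentially. inverse (real (Suc n)) < \<bar>s\<bar>"
    using False by (intro order_tendstoD(2)) auto
  then have "\<forall>\<^sub>F n in sequentially. (inverse (real (Suc n)) / \<bar>s\<bar>)\<^sup>2 = clip' n s"
  proof eventually_elim
    case (elim n)
    have eq: "(e / \<bar>s\<bar>)\<^sup>2 = trunc' (- e) e e s" if "0 < e" "e < \<bar>s\<bar>" for e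
      using that by (cases "0 < s") (auto simp: trunc'_def ramp'_def)
    have "0 < 1 / real (Suc n)" by simp
    from eq[OF this] elim show ?case unfolding inverse_eq_divide by blast
  qed
  moreover have "(\<lambda>n. (inverse (real (Suc n)) / \<bar>s\<bar>)\<^sup>2) \<longlonglongrightarrow> (0 / \<bar>s\<bar>)\<^sup>2"
    using False by (intro tendsto_intros lim) auto
  ultimately have "(\<lambda>n. clip' n s) \<longlonglongrightarrow> (0 / \<bar>s\<bar>)\<^sup>2"
    by (rule Lim_transform_eventually[rotated])
  then show ?thesis using False by simp
qed

text \<open>Let \<open>clip n \<circ> w\<close> shrink to \<open>0\<close>. Integration by parts against a test function gives \<open>0\<close> in the limit, while the
gradients \<open>clip' n w *\<^sub>R V\<close> converge to \<open>V\<close> on the zero set of \<open>w\<close> and to \<open>0\<close> elsewhere; the fundamental lemma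
applies to this limit.\<close>

lemma gradient_zero_on_level_set:
  fixes w :: "'a::euclidean_space \<Rightarrow> real"
  assumes "open \<Omega>" and w: "C1_on \<Omega> w V"
  shows "AE x in lebesgue_on \<Omega>. w x = 0 \<longrightarrow> V x = 0"
proof -
  let ?Z = "\<lambda>x. (if w x = 0 then 1 else 0) *\<^sub>R V x"
  have Z: "set_integrable lebesgue K ?Z" if K: "compact K" "K \<subseteq> \<Omega>" for K
  proof -
    have cw: "continuous_on K w" "continuous_on K V"
      using C1_on_continuous[OF w] C1_on_continuous_gradient[OF w] K by (auto intro: continuous_on_subset)
    have "closed (K \<inter> w -` {0})"
      using cw(1) compact_imp_closed[OF K(1)] by (rule continuous_closed_preimage) simp
    then have "compact (K \<inter> (K \<inter> w -` {0}))" using K(1) by (rule compact_Int_closed[rotated])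
    then have "compact (K \<inter> w -` {0})" by (simp add: Int_absorb1)
    then have "set_integrable lebesgue (K \<inter> w -` {0}) V"
      using cw(2) by (intro set_integrable_continuous_compact) (auto intro: continuous_on_subset)
    moreover have "indicator (K \<inter> w -` {0}) x *\<^sub>R V x = indicator K x *\<^sub>R ?Z x" for x
      by (auto simp: indicator_def)
    ultimately show ?thesis by (simp only: set_integrable_def)
  qed
  have "AE x in lebesgue_on \<Omega>. ?Z x = 0"
  proof (rule fundamental_lemma[OF assms(1) Z])
    fix \<phi> assume test: "test_function \<Omega> \<phi>"
    have weak: "has_weak_gradient \<Omega> w V" by (rule has_weak_gradient_C1_on[OF w assms(1)])
    have weakn: "has_weak_gradient \<Omega> (\<lambda>x. clip n (w x)) (\<lambda>x. clip' n (w x) *\<^sub>R V x)" for n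
      by (intro has_weak_gradient_C1_on[OF _ assms(1)] C1_on_trunc w) simp
    note int = has_weak_gradient_integrable[OF weak test, unfolded set_integrable_def]
    note intn = has_weak_gradient_integrable[OF weakn test, unfolded set_integrable_def]
    have intZ: "set_integrable lebesgue \<Omega> (\<lambda>x. \<phi> x *\<^sub>R ?Z x)"
    proof -
      obtain K where K: "compact K" "K \<subseteq> \<Omega>" "\<And>x. x \<notin> K \<Longrightarrow> \<phi> x = 0"
        using test_function_support[OF test] by metis
      show ?thesis
        by (rule set_integrable_compact_support_scaleR[OF test_function_continuous(1)[OF test] K Z[OF K(1,2)]])
    qed
    have "(\<lambda>n. LINT x|lebesgue. indicator \<Omega> x *\<^sub>R (clip n (w x) *\<^sub>R gradient \<phi> x)) \<longlonglongrightarrow> (LINT x|(lebesgue::'a measure). 0::'a)"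
    proof (rule integral_dominated_convergence[where w = "\<lambda>x. norm (indicator \<Omega> x *\<^sub>R (w x *\<^sub>R gradient \<phi> x))"])
      show "AE x in lebesgue. (\<lambda>n. indicator \<Omega> x *\<^sub>R (clip n (w x) *\<^sub>R gradient \<phi> x)) \<longlonglongrightarrow> 0"
      proof (rule AE_I2)
        fix x
        have "(\<lambda>n. indicator \<Omega> x *\<^sub>R (clip n (w x) *\<^sub>R gradient \<phi> x)) \<longlonglongrightarrow> indicator \<Omega> x *\<^sub>R (0 *\<^sub>R gradient \<phi> x)"
          by (intro tendsto_scaleR tendsto_const clip_tendsto_0)
        then show "(\<lambda>n. indicator \<Omega> x *\<^sub>R (clip n (w x) *\<^sub>R gradient \<phi> x)) \<longlonglongrightarrow> 0" by simp
      qed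
      show "AE x in lebesgue. norm (indicator \<Omega> x *\<^sub>R (clip n (w x) *\<^sub>R gradient \<phi> x))
          \<le> norm (indicator \<Omega> x *\<^sub>R (w x *\<^sub>R gradient \<phi> x))" for n
      proof (rule AE_I2)
        fix x
        have "\<bar>clip n (w x)\<bar> \<le> \<bar>w x\<bar>" by (rule trunc_bounds(6)) auto
        then show "norm (indicator \<Omega> x *\<^sub>R (clip n (w x) *\<^sub>R gradient \<phi> x))
          \<le> norm (indicator \<Omega> x *\<^sub>R (w x *\<^sub>R gradient \<phi> x))"
          unfolding norm_scaleR by (intro mult_left_mono mult_right_mono) auto
      qed
    qed (rule borel_measurable_const, rule borel_measurable_integrable[OF intn(1)], rule integrable_norm[OF int(1)])
    moreover have "(\<lambda>n. LINT x|lebesgue. indicator \<Omega> x *\<^sub>R (\<phi> x *\<^sub>R (clip' n (w x) *\<^sub>R V x)))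
        \<longlonglongrightarrow> (LINT x|lebesgue. indicator \<Omega> x *\<^sub>R (\<phi> x *\<^sub>R ?Z x))"
    proof (rule integral_dominated_convergence[where w = "\<lambda>x. norm (indicator \<Omega> x *\<^sub>R (\<phi> x *\<^sub>R V x))"])
      show "AE x in lebesgue. (\<lambda>n. indicator \<Omega> x *\<^sub>R (\<phi> x *\<^sub>R (clip' n (w x) *\<^sub>R V x)))
        \<longlonglongrightarrow> indicator \<Omega> x *\<^sub>R (\<phi> x *\<^sub>R ?Z x)"
        by (intro AE_I2 tendsto_scaleR tendsto_const clip'_tendsto)
      show "AE x in lebesgue. norm (indicator \<Omega> x *\<^sub>R (\<phi> x *\<^sub>R (clip' n (w x) *\<^sub>R V x)))
          \<le> norm (indicator \<Omega> x *\<^sub>R (\<phi> x *\<^sub>R V x))" for n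
      proof (rule AE_I2)
        fix x
        have "0 \<le> clip' n (w x) \<and> clip' n (w x) \<le> 1" by (intro conjI trunc_bounds(4,5)) auto
        then have "\<bar>clip' n (w x)\<bar> * norm (V x) \<le> 1 * norm (V x)" by (intro mult_right_mono) auto
        then have "\<bar>indicator \<Omega> x\<bar> * (\<bar>\<phi> x\<bar> * (\<bar>clip' n (w x)\<bar> * norm (V x))) \<le> \<bar>indicator \<Omega> x\<bar> * (\<bar>\<phi> x\<bar> * norm (V x))"
          by (intro mult_left_mono) auto
        then show "norm (indicator \<Omega> x *\<^sub>R (\<phi> x *\<^sub>R (clip' n (w x) *\<^sub>R V x)))
          \<le> norm (indicator \<Omega> x *\<^sub>R (\<phi> x *\<^sub>R V x))" by (simp only: norm_scaleR)
      qed
    qed (rule borel_measurable_integrable[OF intZ[unfolded set_integrable_def]],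
         rule borel_measurable_integrable[OF intn(2)], rule integrable_norm[OF int(2)])
    moreover have "(LINT x|lebesgue. indicator \<Omega> x *\<^sub>R (\<phi> x *\<^sub>R (clip' n (w x) *\<^sub>R V x)))
      = - (LINT x|lebesgue. indicator \<Omega> x *\<^sub>R (clip n (w x) *\<^sub>R gradient \<phi> x))" for n
      using weakn[of n] test by (simp add: has_weak_gradient_def set_lebesgue_integral_def)
    ultimately have "(\<lambda>n. - (LINT x|lebesgue. indicator \<Omega> x *\<^sub>R (clip n (w x) *\<^sub>R gradient \<phi> x)))
      \<longlonglongrightarrow> (LINT x|lebesgue. indicator \<Omega> x *\<^sub>R (\<phi> x *\<^sub>R ?Z x))"
      and "(\<lambda>n. LINT x|lebesgue. indicator \<Omega> x *\<^sub>R (clip n (w x) *\<^sub>R gradient \<phi> x)) \<longlonglongrightarrow> 0"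
      by simp_all
    from this(1) tendsto_minus[OF this(2)] have "(LINT x|lebesgue. indicator \<Omega> x *\<^sub>R (\<phi> x *\<^sub>R ?Z x)) = - 0"
      by (rule LIMSEQ_unique)
    then show "(LINT x:\<Omega>|lebesgue. \<phi> x *\<^sub>R ?Z x) = 0" by (simp only: set_lebesgue_integral_def neg_equal_0_iff_equal minus_zero)
  qed
  then show ?thesis by eventually_elim auto
qed

section \<open>Zero boundary values\<close>

context orlicz_setting
begin

lemma continuous_measurable_M:
  fixes f :: "'a \<Rightarrow> 'b::euclidean_space"
  assumes "continuous_on \<Omega> f"
  shows "f \<in> borel_measurable M"
  using continuous_imp_measurable_on_sets_lebesgue[OF assms sets_\<Omega>] .

lemma C1_on_orlicz_sobolev:
  assumes f: "C1_on \<Omega> f V" and "\<And>x. x \<in> \<Omega> \<Longrightarrow> \<bar>f x\<bar> \<le> B" "\<And>x. x \<in> \<Omega> \<Longrightarrow> norm (V x) \<le> L"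
  shows "f \<in> orlicz_sobolev G \<Omega>"
proof -
  have "f \<in> orlicz_space G \<Omega>"
    by (rule bounded_orlicz_space[where B = B])
       (use assms(2) continuous_measurable_M[OF C1_on_continuous[OF f]] in auto)
  moreover have "V \<in> orlicz_space G \<Omega>"
    by (rule bounded_orlicz_space[where B = L, OF continuous_measurable_M[OF C1_on_continuous_gradient[OF f]]])
       (use assms(3) in auto)
  ultimately show ?thesis
    using has_weak_gradient_C1_on[OF f open_\<Omega>] by (auto simp: orlicz_sobolev_def)
qed

text \<open>The function \<open>w - clip n w\<close> vanishes where \<open>|w|\<close> is at most \<open>1 / Suc n\<close>, hence near the boundary, and so is
close in \<open>C\<^sup>1\<close> to a test function. The remainder \<open>clip n w\<close> is uniformly small; its gradient is bounded and
tends to \<open>0\<close> almost everywhere, since \<open>V\<close> vanishes almost everywhere on the zero set of \<open>w\<close>.\<close>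

lemma C1_on_orlicz_sobolev_0:
  assumes w: "C1_on \<Omega> w V" and L: "\<And>x. x \<in> \<Omega> \<Longrightarrow> norm (V x) \<le> L"
    and cont: "continuous_on (closure \<Omega>) w" and bdry: "\<And>x. x \<in> frontier \<Omega> \<Longrightarrow> w x = 0"
  shows "w \<in> orlicz_sobolev_0 G \<Omega>"
proof -
  have cl: "compact (closure \<Omega>)" using bounded_\<Omega> by simp
  have ex: "\<exists>\<phi>. test_function \<Omega> \<phi> \<and> (\<forall>x\<in>\<Omega>. \<bar>\<phi> x - (w x - clip n (w x))\<bar> \<le> 1 / Suc n)
      \<and> (\<forall>x\<in>\<Omega>. norm (gradient \<phi> x - (V x - clip' n (w x) *\<^sub>R V x)) \<le> 1 / Suc n)" for n
  proof -
    let ?s = "\<lambda>x. w x - clip n (w x)" and ?S = "\<lambda>x. V x - clip' n (w x) *\<^sub>R V x"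
    let ?e = "1 / real (Suc n)"
    define K where "K = closure \<Omega> \<inter> (\<lambda>x. \<bar>w x\<bar>) -` {?e..}"
    have "closed K"
      unfolding K_def by (rule continuous_closed_preimage) (auto intro!: continuous_intros cont)
    then have "compact (closure \<Omega> \<inter> K)" by (rule compact_Int_closed[OF cl])
    then have K: "compact K" by (simp add: K_def Int_absorb1)
    have "\<not> ?e \<le> 0" by simp
    then have "K \<inter> frontier \<Omega> = {}" using bdry by (auto simp: K_def)
    then have K\<Omega>: "K \<subseteq> \<Omega>"
      using open_\<Omega> by (auto simp: K_def frontier_def interior_open)
    have s: "C1_on \<Omega> ?s ?S" by (intro C1_on_diff w C1_on_trunc) simp
    have s0: "?s x = 0" if "x \<in> \<Omega> - K" for x
    proof -
      have "x \<in> closure \<Omega>" using that closure_subset by blast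
      then have "\<bar>w x\<bar> < ?e" using that by (auto simp: K_def)
      then have "clip n (w x) = w x" by (intro trunc_bounds(3)) auto
      then show ?thesis by simp
    qed
    have s': "C1_on UNIV (\<lambda>x. indicator \<Omega> x *\<^sub>R ?s x) (\<lambda>x. indicator \<Omega> x *\<^sub>R ?S x)"
      by (rule C1_on_zero_extension(1)[OF s open_\<Omega> K K\<Omega> s0])
    have s0': "indicator \<Omega> x *\<^sub>R ?s x = 0" if "x \<notin> K" for x
      using s0[of x] that by (cases "x \<in> \<Omega>") auto
    have e: "0 < ?e" by simp
    obtain \<phi> where "test_function \<Omega> \<phi>" "\<And>x. \<bar>\<phi> x - indicator \<Omega> x *\<^sub>R ?s x\<bar> \<le> ?e"
      "\<And>x. norm (gradient \<phi> x - indicator \<Omega> x *\<^sub>R ?S x) \<le> ?e"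
      using test_function_approximation[OF s' K K\<Omega> s0' open_\<Omega> e] by blast
    then show ?thesis by (intro exI[of _ \<phi>]) (auto, (metis indicator_simps(1) mult_1 scaleR_one)+)
  qed
  then obtain \<phi> where test: "\<And>n. test_function \<Omega> (\<phi> n)"
    and c0: "\<And>n x. x \<in> \<Omega> \<Longrightarrow> \<bar>\<phi> n x - (w x - clip n (w x))\<bar> \<le> 1 / Suc n"
    and c1: "\<And>n x. x \<in> \<Omega> \<Longrightarrow> norm (gradient (\<phi> n) x - (V x - clip' n (w x) *\<^sub>R V x)) \<le> 1 / Suc n"
    by metis
  have C1: "C1_on \<Omega> (\<lambda>x. w x - \<phi> n x) (\<lambda>x. V x - gradient (\<phi> n) x)" for n
    by (intro C1_on_diff w test_function_C1_on[OF test])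
  have le1: "1 / real (Suc n) \<le> 1" for n by simp
  have lim0: "(\<lambda>n. inverse (real (Suc n))) \<longlonglongrightarrow> 0" by (rule LIMSEQ_inverse_real_of_nat)
  have norm0: "(\<lambda>n. luxemburg_norm G \<Omega> (\<lambda>x. w x - \<phi> n x)) \<longlonglongrightarrow> 0"
  proof (rule luxemburg_tendsto_0_bounded[where B = 3])
    show "(\<lambda>x. w x - \<phi> n x) \<in> borel_measurable M" for n
      by (rule continuous_measurable_M[OF C1_on_continuous[OF C1]])
    have bd: "\<bar>w x - \<phi> n x\<bar> \<le> \<bar>clip n (w x)\<bar> + inverse (real (Suc n))" if "x \<in> \<Omega>" for n x
      using c0[OF that, of n] unfolding inverse_eq_divide by linarith
    show "norm (w x - \<phi> n x) \<le> 3" if "x \<in> \<Omega>" for n x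
    proof -
      have "\<bar>clip n (w x)\<bar> \<le> 1 / Suc n + 1 / Suc n"
        using trunc_bounds(1,2)[of "1 / Suc n" "- (1 / Suc n)" "1 / Suc n" "w x"] by simp
      then show ?thesis using bd[OF that, of n] le1[of n] unfolding inverse_eq_divide real_norm_def by linarith
    qed
    show "AE x in M. (\<lambda>n. w x - \<phi> n x) \<longlonglongrightarrow> 0"
    proof (rule AE_I2)
      fix x assume "x \<in> space M"
      then have x: "x \<in> \<Omega>" by (simp add: space_restrict_space)
      have "(\<lambda>n. \<bar>clip n (w x)\<bar> + inverse (real (Suc n))) \<longlonglongrightarrow> \<bar>0\<bar> + 0"
        by (intro tendsto_add tendsto_rabs clip_tendsto_0 lim0)
      then have "(\<lambda>n. \<bar>clip n (w x)\<bar> + inverse (real (Suc n))) \<longlonglongrightarrow> 0" by (simp only: abs_zero add_0)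
      moreover have "\<forall>\<^sub>F n in sequentially. norm (w x - \<phi> n x) \<le> \<bar>clip n (w x)\<bar> + inverse (real (Suc n))"
        unfolding real_norm_def by (intro always_eventually allI bd[OF x])
      ultimately show "(\<lambda>n. w x - \<phi> n x) \<longlonglongrightarrow> 0" by (rule Lim_null_comparison[rotated])
    qed
  qed
  have norm1: "(\<lambda>n. luxemburg_norm G \<Omega> (\<lambda>x. V x - gradient (\<phi> n) x)) \<longlonglongrightarrow> 0"
  proof (rule luxemburg_tendsto_0_bounded[where B = "L + 1"])
    show "(\<lambda>x. V x - gradient (\<phi> n) x) \<in> borel_measurable M" for n
      by (rule continuous_measurable_M[OF C1_on_continuous_gradient[OF C1]])
    have bd: "norm (V x - gradient (\<phi> n) x) \<le> norm (clip' n (w x) *\<^sub>R V x) + inverse (real (Suc n))" if "x \<in> \<Omega>" for n x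
    proof -
      have "norm (V x - gradient (\<phi> n) x)
          = norm (clip' n (w x) *\<^sub>R V x - (gradient (\<phi> n) x - (V x - clip' n (w x) *\<^sub>R V x)))" by simp
      also have "\<dots> \<le> norm (clip' n (w x) *\<^sub>R V x) + norm (gradient (\<phi> n) x - (V x - clip' n (w x) *\<^sub>R V x))"
        by (rule norm_triangle_ineq4)
      finally show ?thesis using c1[OF that, of n] unfolding inverse_eq_divide by linarith
    qed
    show "norm (V x - gradient (\<phi> n) x) \<le> L + 1" if "x \<in> \<Omega>" for n x
    proof -
      have "0 \<le> clip' n (w x) \<and> clip' n (w x) \<le> 1" by (intro conjI trunc_bounds(4,5)) auto
      then have "\<bar>clip' n (w x)\<bar> * norm (V x) \<le> 1 * norm (V x)" by (intro mult_right_mono) auto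
      then show ?thesis
        using bd[OF that, of n] le1[of n] L[OF that] unfolding inverse_eq_divide norm_scaleR by linarith
    qed
    show "AE x in M. (\<lambda>n. V x - gradient (\<phi> n) x) \<longlonglongrightarrow> 0"
      using gradient_zero_on_level_set[OF open_\<Omega> w] AE_space
    proof eventually_elim
      case (elim x)
      then have x: "x \<in> \<Omega>" by (simp add: space_restrict_space)
      have "(\<lambda>n. norm (clip' n (w x) *\<^sub>R V x) + inverse (real (Suc n))) \<longlonglongrightarrow> norm ((if w x = 0 then 1 else 0) *\<^sub>R V x) + 0"
        by (intro tendsto_add tendsto_norm tendsto_scaleR tendsto_const clip'_tendsto lim0)
      moreover have "norm ((if w x = 0 then 1 else 0) *\<^sub>R V x) + 0 = 0" using elim(1) by simp
      ultimately have "(\<lambda>n. norm (clip' n (w x) *\<^sub>R V x) + inverse (real (Suc n))) \<longlonglongrightarrow> 0" by (simp only:)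
      moreover have "\<forall>\<^sub>F n in sequentially. norm (V x - gradient (\<phi> n) x)
          \<le> norm (clip' n (w x) *\<^sub>R V x) + inverse (real (Suc n))"
        by (intro always_eventually allI bd[OF x])
      ultimately show ?case by (rule Lim_null_comparison[rotated])
    qed
  qed
  have "luxemburg_norm G \<Omega> (weak_gradient \<Omega> (\<lambda>x. w x - \<phi> n x)) = luxemburg_norm G \<Omega> (\<lambda>x. V x - gradient (\<phi> n) x)" for n
    by (rule luxemburg_norm_cong_AE[OF sets_\<Omega> weak_gradient_AE(2)[OF open_\<Omega> has_weak_gradient_C1_on[OF C1 open_\<Omega>]]])
  then have "(\<lambda>n. orlicz_sobolev_norm G \<Omega> (\<lambda>x. w x - \<phi> n x)) \<longlonglongrightarrow> 0"
    using tendsto_add[OF norm0 norm1] by (simp add: orlicz_sobolev_norm_def)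
  moreover have "w \<in> orlicz_sobolev G \<Omega>"
  proof -
    have "bounded (w ` closure \<Omega>)" by (intro compact_imp_bounded compact_continuous_image cont cl)
    then obtain B where "\<And>x. x \<in> closure \<Omega> \<Longrightarrow> \<bar>w x\<bar> \<le> B" by (auto simp: bounded_iff)
    then show ?thesis using C1_on_orlicz_sobolev[OF w _ L, of B] closure_subset by blast
  qed
  ultimately show ?thesis using test by (auto simp: orlicz_sobolev_0_def)
qed

end


section \<open>The lower bound for the \<open>g\<close>-harmonic solution\<close>

context orlicz_setting
begin

lemma space_M: "x \<in> space M \<longleftrightarrow> x \<in> \<Omega>"
  by (simp add: space_restrict_space)

lemma lborel_integral_zero_extension:
  fixes V :: "'a \<Rightarrow> 'b::euclidean_space"
  assumes "continuous_on UNIV (\<lambda>x. indicator \<Omega> x *\<^sub>R V x)"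
  shows "(LINT x|lborel. indicator \<Omega> x *\<^sub>R V x) = (LINT x|M. V x)"
proof -
  have "(\<lambda>x. indicator \<Omega> x *\<^sub>R V x) \<in> borel_measurable lborel"
    using borel_measurable_continuous_onI[OF assms] by simp
  then have "(LINT x|lborel. indicator \<Omega> x *\<^sub>R V x) = (LINT x|lebesgue. indicator \<Omega> x *\<^sub>R V x)"
    by (rule integral_completion[symmetric])
  also have "\<dots> = (LINT x|M. V x)" using sets_\<Omega> by (subst integral_restrict_space) auto
  finally show ?thesis .
qed

lemma bounded_continuous_integrable:
  fixes f :: "'a \<Rightarrow> 'b::euclidean_space"
  assumes "continuous_on \<Omega> f" "\<And>x. x \<in> \<Omega> \<Longrightarrow> norm (f x) \<le> B"
  shows "integrable M f"
  by (rule integrable_const_bound[where B = B])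
     (use assms(2) continuous_measurable_M[OF assms(1)] in \<open>auto intro!: AE_I2 simp: space_M\<close>)

lemma compact_support_bounded_on:
  fixes f :: "'a \<Rightarrow> 'b::euclidean_space"
  assumes "continuous_on \<Omega> f" "compact K" "K \<subseteq> \<Omega>" "\<And>x. x \<in> \<Omega> - K \<Longrightarrow> f x = 0"
  obtains B where "0 \<le> B" "\<And>x. x \<in> \<Omega> \<Longrightarrow> norm (f x) \<le> B"
proof -
  have "bounded (f ` K)"
    using assms by (intro compact_imp_bounded compact_continuous_image) (auto intro: continuous_on_subset)
  then obtain B where B: "\<And>x. x \<in> K \<Longrightarrow> norm (f x) \<le> B" by (auto simp: bounded_iff)
  have "norm (f x) \<le> \<bar>B\<bar>" if "x \<in> \<Omega>" for x
    using B[of x] assms(4)[of x] that by (cases "x \<in> K") auto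
  then show ?thesis using that[of "\<bar>B\<bar>"] by auto
qed

text \<open>Integrate the derivative of \<open>(x \<bullet> b) \<zeta>\<close> in a coordinate direction \<open>b\<close>. For nonnegative \<open>\<zeta>\<close> this is a Poincare
inequality in \<open>L\<^sup>1\<close>, obtained without taking an absolute value and leaving the class \<open>C\<^sup>1\<close>.\<close>

lemma integral_le_integral_gradient:
  assumes \<zeta>: "C1_on \<Omega> \<zeta> Z" and K: "compact K" "K \<subseteq> \<Omega>" "\<And>x. x \<in> \<Omega> - K \<Longrightarrow> \<zeta> x = 0"
    and R: "\<And>x. x \<in> \<Omega> \<Longrightarrow> norm x \<le> R"
  shows "(LINT x|M. \<zeta> x) \<le> R * (LINT x|M. norm (Z x))"
proof -
  obtain b :: 'a where b: "b \<in> Basis" using nonempty_Basis by blast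
  let ?F = "\<lambda>x. (x \<bullet> b) *\<^sub>R Z x + \<zeta> x *\<^sub>R b"
  have lin: "C1_on \<Omega> (\<lambda>x. x \<bullet> b) (\<lambda>x. b)"
    by (auto simp: C1_on_def gderiv_def intro!: derivative_eq_intros)
  have prod: "C1_on \<Omega> (\<lambda>x. (x \<bullet> b) * \<zeta> x) ?F" by (rule C1_on_mult[OF lin \<zeta>])
  have Z0: "Z x = 0" if "x \<in> \<Omega> - K" for x
    using C1_on_zero_extension(2)[OF \<zeta> open_\<Omega> K(1,2) K(3) that] .
  have ext: "C1_on UNIV (\<lambda>x. indicator \<Omega> x *\<^sub>R ((x \<bullet> b) * \<zeta> x)) (\<lambda>x. indicator \<Omega> x *\<^sub>R ?F x)"
    by (rule C1_on_zero_extension(1)[OF prod open_\<Omega> K(1,2)]) (simp add: K(3))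
  have "(LINT x|lborel. indicator \<Omega> x *\<^sub>R ?F x) = 0"
    by (rule integral_gradient_eq_0[OF ext K(1)]) (use K(2,3) in \<open>auto simp: indicator_def\<close>)
  then have zero: "(LINT x|M. ?F x) = 0"
    using lborel_integral_zero_extension[OF C1_on_continuous_gradient[OF ext]] by simp
  obtain B1 where B1: "\<And>x. x \<in> \<Omega> \<Longrightarrow> norm (\<zeta> x) \<le> B1"
    using compact_support_bounded_on[OF C1_on_continuous[OF \<zeta>] K] by blast
  obtain B2 where B2: "\<And>x. x \<in> \<Omega> \<Longrightarrow> norm (Z x) \<le> B2"
    using compact_support_bounded_on[OF C1_on_continuous_gradient[OF \<zeta>] K(1,2) Z0] by blast
  have int\<zeta>: "integrable M \<zeta>" by (rule bounded_continuous_integrable[OF C1_on_continuous[OF \<zeta>] B1])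
  have intZ: "integrable M Z"
    by (rule bounded_continuous_integrable[OF C1_on_continuous_gradient[OF \<zeta>] B2])
  have bound: "\<bar>(x \<bullet> b) * (Z x \<bullet> b)\<bar> \<le> R * norm (Z x)" if "x \<in> \<Omega>" for x
    unfolding abs_mult using R[OF that] Basis_le_norm[OF b, of x] Basis_le_norm[OF b, of "Z x"]
    by (intro mult_mono) auto
  have intP: "integrable M (\<lambda>x. (x \<bullet> b) * (Z x \<bullet> b))"
  proof (rule integrable_dominated[where f = "\<lambda>x. R * norm (Z x)"])
    show "integrable M (\<lambda>x. R * norm (Z x))" using intZ by simp
    show "(\<lambda>x. (x \<bullet> b) * (Z x \<bullet> b)) \<in> borel_measurable M"
      by (intro continuous_measurable_M continuous_intros C1_on_continuous_gradient[OF \<zeta>])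
    show "norm ((x \<bullet> b) * (Z x \<bullet> b)) \<le> R * norm (Z x)" if "x \<in> space M" for x
      unfolding real_norm_def using that by (intro bound) (simp only: space_M)
  qed
  have "integrable M ?F"
  proof (rule bounded_continuous_integrable[where B = "R * B2 + B1"])
    show "continuous_on \<Omega> ?F" by (rule C1_on_continuous_gradient[OF prod])
    fix x assume x: "x \<in> \<Omega>"
    have "norm (?F x) \<le> norm ((x \<bullet> b) *\<^sub>R Z x) + norm (\<zeta> x *\<^sub>R b)" by (rule norm_triangle_ineq)
    also have "\<dots> = \<bar>x \<bullet> b\<bar> * norm (Z x) + norm (\<zeta> x)" using b by simp
    also have "\<dots> \<le> R * B2 + B1"
      using R[OF x] B1[OF x] B2[OF x] Basis_le_norm[OF b, of x] by (intro add_mono mult_mono) (auto intro: order_trans)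
    finally show "norm (?F x) \<le> R * B2 + B1" .
  qed
  then have "(LINT x|M. ?F x \<bullet> b) = 0"
    using zero by (subst integral_inner_left) auto
  moreover have "?F x \<bullet> b = (x \<bullet> b) * (Z x \<bullet> b) + \<zeta> x" for x
    using b by (simp add: inner_add_left)
  ultimately have "(LINT x|M. (x \<bullet> b) * (Z x \<bullet> b)) + (LINT x|M. \<zeta> x) = 0"
    using intP int\<zeta> by (simp add: Bochner_Integration.integral_add)
  moreover have "- (LINT x|M. (x \<bullet> b) * (Z x \<bullet> b)) \<le> R * (LINT x|M. norm (Z x))"
  proof -
    have "- (LINT x|M. (x \<bullet> b) * (Z x \<bullet> b)) = (LINT x|M. - ((x \<bullet> b) * (Z x \<bullet> b)))" by simp
    also have "\<dots> \<le> (LINT x|M. R * norm (Z x))"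
    proof (rule integral_mono)
      show "- ((x \<bullet> b) * (Z x \<bullet> b)) \<le> R * norm (Z x)" if "x \<in> space M" for x
      proof -
        have "x \<in> \<Omega>" using that by (simp add: space_M)
        from bound[OF this] show ?thesis by linarith
      qed
    qed (rule Bochner_Integration.integrable_minus[OF intP], rule integrable_mult_right[OF integrable_norm[OF intZ]])
    finally show ?thesis by simp
  qed
  ultimately show ?thesis by linarith
qed

lemma weak_equation_C1:
  assumes A: "integrable M A" and eq: "\<And>\<phi>. test_function \<Omega> \<phi> \<Longrightarrow> (LINT x|M. A x \<bullet> gradient \<phi> x) = 0"
    and \<zeta>: "C1_on \<Omega> \<zeta> Z" and K: "compact K" "K \<subseteq> \<Omega>" "\<And>x. x \<in> \<Omega> - K \<Longrightarrow> \<zeta> x = 0"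
  shows "(LINT x|M. A x \<bullet> Z x) = 0"
proof -
  have ext: "C1_on UNIV (\<lambda>x. indicator \<Omega> x *\<^sub>R \<zeta> x) (\<lambda>x. indicator \<Omega> x *\<^sub>R Z x)"
    by (rule C1_on_zero_extension(1)[OF \<zeta> open_\<Omega> K])
  have Z0: "Z x = 0" if "x \<in> \<Omega> - K" for x
    using C1_on_zero_extension(2)[OF \<zeta> open_\<Omega> K that] .
  have ext0: "indicator \<Omega> x *\<^sub>R \<zeta> x = 0" if "x \<notin> K" for x
    using K(3)[of x] that by (cases "x \<in> \<Omega>") auto
  have pair: "integrable M (\<lambda>x. A x \<bullet> Y x)"
    if Y: "continuous_on \<Omega> Y" "\<And>x. x \<in> \<Omega> \<Longrightarrow> norm (Y x) \<le> B" for Y B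
  proof (rule integrable_dominated[where f = "\<lambda>x. norm (A x) * B"])
    show "integrable M (\<lambda>x. norm (A x) * B)" using A by simp
    show "(\<lambda>x. A x \<bullet> Y x) \<in> borel_measurable M"
      using A continuous_measurable_M[OF Y(1)] by (intro borel_measurable_inner) auto
    fix x assume "x \<in> space M"
    have "\<bar>A x \<bullet> Y x\<bar> \<le> norm (A x) * norm (Y x)" by (rule Cauchy_Schwarz_ineq2)
    also have "\<dots> \<le> norm (A x) * B"
      using Y(2) \<open>x \<in> space M\<close> by (intro mult_left_mono) (auto simp: space_M)
    finally show "norm (A x \<bullet> Y x) \<le> norm (A x) * B" by (simp only: real_norm_def)
  qed
  obtain B where B: "\<And>x. x \<in> \<Omega> \<Longrightarrow> norm (Z x) \<le> B"
    using compact_support_bounded_on[OF C1_on_continuous_gradient[OF \<zeta>] K(1,2) Z0] by blast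
  have small: "\<bar>LINT x|M. A x \<bullet> Z x\<bar> \<le> e * (LINT x|M. norm (A x))" if "0 < e" for e
  proof -
    obtain \<phi> where test: "test_function \<Omega> \<phi>" and "\<And>x. \<bar>\<phi> x - indicator \<Omega> x *\<^sub>R \<zeta> x\<bar> \<le> e"
      and close: "\<And>x. norm (gradient \<phi> x - indicator \<Omega> x *\<^sub>R Z x) \<le> e"
      by (rule test_function_approximation[OF ext K(1,2) ext0 open_\<Omega> \<open>0 < e\<close>]) (assumption, rule that)
    have close\<Omega>: "norm (Z x - gradient \<phi> x) \<le> e" if "x \<in> \<Omega>" for x
      using close[of x] that by (simp add: norm_minus_commute)
    have cont: "continuous_on \<Omega> (\<lambda>x. Z x - gradient \<phi> x)"
      by (intro continuous_intros C1_on_continuous_gradient[OF \<zeta>] test_function_continuous(2)[OF test])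
    have i1: "integrable M (\<lambda>x. A x \<bullet> Z x)"
      by (rule pair[OF C1_on_continuous_gradient[OF \<zeta>] B])
    have i2: "integrable M (\<lambda>x. A x \<bullet> (Z x - gradient \<phi> x))" by (rule pair[OF cont close\<Omega>])
    have "(LINT x|M. A x \<bullet> Z x) - (LINT x|M. A x \<bullet> (Z x - gradient \<phi> x)) = (LINT x|M. A x \<bullet> gradient \<phi> x)"
      by (subst Bochner_Integration.integral_diff[OF i1 i2, symmetric]) (simp add: inner_diff_right)
    also have "\<dots> = 0" by (rule eq[OF test])
    finally have "\<bar>LINT x|M. A x \<bullet> Z x\<bar> = \<bar>LINT x|M. A x \<bullet> (Z x - gradient \<phi> x)\<bar>" by simp
    also have "\<dots> \<le> (LINT x|M. \<bar>A x \<bullet> (Z x - gradient \<phi> x)\<bar>)" by (rule integral_abs_bound)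
    also have "\<dots> \<le> (LINT x|M. e * norm (A x))"
    proof (rule integral_mono)
      fix x assume "x \<in> space M"
      have "\<bar>A x \<bullet> (Z x - gradient \<phi> x)\<bar> \<le> norm (A x) * norm (Z x - gradient \<phi> x)" by (rule Cauchy_Schwarz_ineq2)
      also have "\<dots> \<le> norm (A x) * e"
        using close\<Omega> \<open>x \<in> space M\<close> by (intro mult_left_mono) (auto simp: space_M)
      finally show "\<bar>A x \<bullet> (Z x - gradient \<phi> x)\<bar> \<le> e * norm (A x)" by (simp add: mult.commute)
    qed (use i2 A in auto)
    finally show ?thesis by simp
  qed
  show ?thesis
  proof (rule ccontr)
    assume "(LINT x|M. A x \<bullet> Z x) \<noteq> 0"
    then have p: "0 < \<bar>LINT x|M. A x \<bullet> Z x\<bar>" by simp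
    let ?I = "LINT x|M. norm (A x)"
    have I: "0 \<le> ?I" by (rule Bochner_Integration.integral_nonneg) simp
    define J where "J = ?I + 1"
    have J: "0 < J" "?I \<le> J" unfolding J_def using I by linarith+
    define e where "e = \<bar>LINT x|M. A x \<bullet> Z x\<bar> / (2 * J)"
    have "0 < e" unfolding e_def using p J(1) by (intro divide_pos_pos) auto
    have "e * ?I \<le> e * J" using \<open>0 < e\<close> J(2) by (intro mult_left_mono) auto
    also have "\<dots> = \<bar>LINT x|M. A x \<bullet> Z x\<bar> / 2"
      unfolding e_def using J(1) by simp
    finally show False using small[OF \<open>0 < e\<close>] p by linarith
  qed
qed

text \<open>The flux of \<open>V\<close> has size \<open>g |V|\<close>; paired with a field of Luxemburg norm below \<open>l\<close> it contributes \<open>O(l)\<close>.\<close>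

lemma pairing_small:
  assumes V: "V \<in> borel_measurable M" "integrable M (\<lambda>x. G (norm (V x)))"
    and D: "D \<in> borel_measurable M" "luxemburg_norm G \<Omega> D < ennreal l" and l: "0 < l"
  shows "integrable M (\<lambda>x. g (norm (V x)) * norm (D x))"
    and "(LINT x|M. g (norm (V x)) * norm (D x)) \<le> l * ((1 + g0) * ((LINT x|M. G (norm (V x))) + 1))"
proof -
  have mod: "(\<integral>\<^sup>+x. ennreal (G (norm (D x) / l)) \<partial>M) \<le> 1" by (rule luxemburg_norm_less_modular[OF D(2)])
  have mD: "(\<lambda>x. G (norm (D x) / l)) \<in> borel_measurable M"
    using D(1) l by (intro measurable_G) auto
  have nnD: "0 \<le> G (norm (D x) / l)" for x using l by (intro G_nonneg) auto
  have iD: "integrable M (\<lambda>x. G (norm (D x) / l))"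
    by (rule integrableI_bounded[OF mD]) (use mod nnD in \<open>auto intro: le_less_trans\<close>)
  have "ennreal (LINT x|M. G (norm (D x) / l)) = (\<integral>\<^sup>+x. ennreal (G (norm (D x) / l)) \<partial>M)"
    using iD nnD by (intro nn_integral_eq_integral[symmetric]) auto
  with mod have "ennreal (LINT x|M. G (norm (D x) / l)) \<le> 1" by (simp only:)
  then have D1: "(LINT x|M. G (norm (D x) / l)) \<le> 1" by (simp only: ennreal_le_1)
  let ?f = "\<lambda>x. l * (1 + g0) * (G (norm (V x)) + G (norm (D x) / l))"
  have le: "g (norm (V x)) * norm (D x) \<le> ?f x" for x using l by (intro g_mult_le) auto
  have nn: "0 \<le> g (norm (V x)) * norm (D x)" for x by (intro mult_nonneg_nonneg g_nonneg) auto
  have intf: "integrable M ?f" using V(2) iD by simp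
  have mg: "(\<lambda>x. g (norm (V x))) \<in> borel_measurable M" using V(1) by (intro measurable_g) auto
  show int: "integrable M (\<lambda>x. g (norm (V x)) * norm (D x))"
  proof (rule integrable_dominated[OF intf])
    show "(\<lambda>x. g (norm (V x)) * norm (D x)) \<in> borel_measurable M" using mg D(1) by simp
    show "norm (g (norm (V x)) * norm (D x)) \<le> ?f x" for x
      unfolding real_norm_def abs_of_nonneg[OF nn] by (rule le)
  qed
  have "(LINT x|M. g (norm (V x)) * norm (D x)) \<le> (LINT x|M. ?f x)"
    using int intf le by (intro integral_mono) auto
  also have "\<dots> = l * (1 + g0) * ((LINT x|M. G (norm (V x))) + (LINT x|M. G (norm (D x) / l)))"
    using V(2) iD by simp
  also have "\<dots> \<le> l * (1 + g0) * ((LINT x|M. G (norm (V x))) + 1)"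
    using D1 l pos by (intro mult_left_mono) auto
  finally show "(LINT x|M. g (norm (V x)) * norm (D x)) \<le> l * ((1 + g0) * ((LINT x|M. G (norm (V x))) + 1))"
    by (simp only: mult.assoc)
qed

text \<open>Comparison with the constant \<open>m\<close>. Formally one tests the equation with the positive part of \<open>m - u0\<close>.
Here \<open>u0\<close> is replaced by its approximations \<open>U k = \<psi> + \<phi> k\<close>, which are \<open>C\<^sup>1\<close> and exceed \<open>m\<close> near the
boundary, so that \<open>\<zeta> k = ramp 1 (m - U k)\<close> has compact support. In the limit the equation says that the
gradient \<open>V\<close> of \<open>u0\<close> vanishes almost everywhere where \<open>u0 < m\<close>, so the gradients of \<open>\<zeta> k\<close> tend to \<open>0\<close> in \<open>L\<^sup>1\<close>. By
the Poincare inequality \<open>\<zeta> k\<close> itself tends to \<open>0\<close>, while along a subsequence it converges almost everywhere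
to \<open>ramp 1 (m - u0)\<close>.\<close>

lemma g_harmonic_lower_bound:
  assumes sol: "g_harmonic_solution G g \<Omega> \<psi> u0"
    and \<psi>: "C1_on \<Omega> \<psi> W" "continuous_on (closure \<Omega>) \<psi>" and m: "\<And>x. x \<in> frontier \<Omega> \<Longrightarrow> m < \<psi> x"
  shows "AE x in M. m \<le> u0 x"
proof -
  define V where "V = weak_gradient \<Omega> u0"
  have u0: "u0 \<in> orlicz_space G \<Omega>" and diff0: "(\<lambda>x. u0 x - \<psi> x) \<in> orlicz_sobolev_0 G \<Omega>"
    using sol by (auto simp: g_harmonic_solution_def dirichlet_class_def orlicz_sobolev_def)
  obtain V' where V': "has_weak_gradient \<Omega> u0 V'" "V' \<in> orlicz_space G \<Omega>"
    using sol by (auto simp: g_harmonic_solution_def dirichlet_class_def orlicz_sobolev_def)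
  have hV: "has_weak_gradient \<Omega> u0 V" and VV': "AE x in M. V x = V' x"
    unfolding V_def using weak_gradient_AE[OF open_\<Omega> V'(1)] by auto
  have mV: "V \<in> borel_measurable M"
    using AE_lebesgue_on_measurable[OF sets_\<Omega> _ VV'] V'(2) by (simp add: orlicz_space_def)
  have VO: "V \<in> orlicz_space G \<Omega>"
    using V'(2) mV luxemburg_norm_cong_AE[OF sets_\<Omega> VV'] by (simp add: orlicz_space_def)
  note intV = orlicz_space_integrable[OF VO]
  have mu0: "u0 \<in> borel_measurable M" using u0 by (simp add: orlicz_space_def)
  obtain \<phi> where test: "\<And>k. test_function \<Omega> (\<phi> k)"
    and lim: "(\<lambda>k. orlicz_sobolev_norm G \<Omega> (\<lambda>x. u0 x - \<psi> x - \<phi> k x)) \<longlonglongrightarrow> 0"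
    using diff0 by (auto simp: orlicz_sobolev_0_def)
  define U where "U k x = \<psi> x + \<phi> k x" for k x
  define P where "P k x = W x + gradient (\<phi> k) x" for k x
  define E where "E k x = u0 x - U k x" for k x
  define D where "D k x = V x - P k x" for k x
  have U: "C1_on \<Omega> (U k) (P k)" for k
    unfolding U_def[abs_def] P_def[abs_def] by (intro C1_on_add \<psi>(1) test_function_C1_on[OF test])
  have E_eq: "(\<lambda>x. u0 x - \<psi> x - \<phi> k x) = E k" for k by (auto simp: E_def U_def)
  have hD: "has_weak_gradient \<Omega> (E k) (D k)" for k
    unfolding E_def[abs_def] D_def[abs_def]
    by (intro has_weak_gradient_diff hV has_weak_gradient_C1_on[OF U open_\<Omega>])
  have normD: "luxemburg_norm G \<Omega> (weak_gradient \<Omega> (E k)) = luxemburg_norm G \<Omega> (D k)" for k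
    by (rule luxemburg_norm_cong_AE[OF sets_\<Omega> weak_gradient_AE(2)[OF open_\<Omega> hD]])
  have lim': "(\<lambda>k. luxemburg_norm G \<Omega> (E k) + luxemburg_norm G \<Omega> (D k)) \<longlonglongrightarrow> 0"
    using lim by (simp add: E_eq orlicz_sobolev_norm_def normD)
  have limE: "(\<lambda>k. luxemburg_norm G \<Omega> (E k)) \<longlonglongrightarrow> 0"
    by (rule tendsto_sandwich[OF _ _ tendsto_const lim']) auto
  have limD: "(\<lambda>k. luxemburg_norm G \<Omega> (D k)) \<longlonglongrightarrow> 0"
    by (rule tendsto_sandwich[OF _ _ tendsto_const lim']) auto
  have mU: "U k \<in> borel_measurable M" for k
    by (rule continuous_measurable_M[OF C1_on_continuous[OF U]])
  have mP: "P k \<in> borel_measurable M" for k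
    by (rule continuous_measurable_M[OF C1_on_continuous_gradient[OF U]])
  have mE: "E k \<in> borel_measurable M" for k unfolding E_def[abs_def] using mu0 mU by simp
  have mD: "D k \<in> borel_measurable M" for k unfolding D_def[abs_def] using mV mP by simp
  obtain B\<psi> where B\<psi>: "\<And>x. x \<in> \<Omega> \<Longrightarrow> norm (\<psi> x) \<le> B\<psi>"
  proof -
    have "compact (closure \<Omega>)" using bounded_\<Omega> by simp
    then have "bounded (\<psi> ` closure \<Omega>)" by (intro compact_imp_bounded compact_continuous_image \<psi>(2))
    then show thesis using that closure_subset by (auto simp: bounded_iff)
  qed
  have intE: "integrable M (E k)" for k
  proof -
    obtain K where "compact K" "K \<subseteq> \<Omega>" "\<And>x. x \<notin> K \<Longrightarrow> \<phi> k x = 0"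
      using test_function_support[OF test[of k]] by metis
    then obtain B where B: "\<And>x. x \<in> \<Omega> \<Longrightarrow> norm (\<phi> k x) \<le> B"
      using compact_support_bounded_on[OF test_function_continuous(1)[OF test[of k]], of K] by blast
    have "norm (U k x) \<le> B\<psi> + B" if "x \<in> \<Omega>" for x
      unfolding U_def using B\<psi>[OF that] B[OF that] norm_triangle_ineq[of "\<psi> x" "\<phi> k x"] by linarith
    then have "integrable M (U k)" by (rule bounded_continuous_integrable[OF C1_on_continuous[OF U]])
    then show ?thesis
      unfolding E_def[abs_def] using orlicz_space_integrable(1)[OF u0] by (intro Bochner_Integration.integrable_diff)
  qed
  have L1E: "(\<lambda>k. LINT x|M. norm (E k x)) \<longlonglongrightarrow> 0" by (rule luxemburg_tendsto_0_L1[OF limE mE])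
  have L1D: "(\<lambda>k. LINT x|M. norm (D k x)) \<longlonglongrightarrow> 0" by (rule luxemburg_tendsto_0_L1[OF limD mD])
  obtain r :: "nat \<Rightarrow> nat" where r: "strict_mono r" and aeE: "AE x in M. (\<lambda>k. E (r k) x) \<longlonglongrightarrow> 0"
    using tendsto_L1_AE_subseq[OF intE L1E] by blast

  define c where "c k x = ramp' 1 (m - U k x)" for k x
  define c' where "c' x = ramp' 1 (m - u0 x)" for x
  define \<zeta> where "\<zeta> k x = ramp 1 (m - U k x)" for k x
  define A where "A x = (g (norm (V x)) / norm (V x)) *\<^sub>R V x" for x
  define h where "h x = g (norm (V x)) * norm (V x)" for x
  have c01: "0 \<le> c k x" "c k x \<le> 1" for k x using ramp'_bounds[of 1] by (auto simp: c_def)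
  have mc: "c k \<in> borel_measurable M" for k
    unfolding c_def[abs_def]
    by (rule borel_measurable_continuous_on[OF ramp'_continuous]) (use mU in auto)
  have mc': "c' \<in> borel_measurable M"
    unfolding c'_def[abs_def]
    by (rule borel_measurable_continuous_on[OF ramp'_continuous]) (use mu0 in auto)
  have aeU: "AE x in M. (\<lambda>k. U (r k) x) \<longlonglongrightarrow> u0 x"
    using aeE
  proof eventually_elim
    case (elim x)
    have "(\<lambda>k. u0 x - E (r k) x) \<longlonglongrightarrow> u0 x - 0" by (intro tendsto_diff tendsto_const elim)
    then show ?case by (simp add: E_def)
  qed
  have aec: "AE x in M. (\<lambda>k. c (r k) x) \<longlonglongrightarrow> c' x"
    using aeU
  proof eventually_elim
    case (elim x)
    have "(\<lambda>k. m - U (r k) x) \<longlonglongrightarrow> m - u0 x" by (intro tendsto_diff tendsto_const elim)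
    then show ?case
      unfolding c_def c'_def using continuous_on_tendsto_compose[OF ramp'_continuous[of 1]] by auto
  qed
  have ae\<zeta>: "AE x in M. (\<lambda>k. \<zeta> (r k) x) \<longlonglongrightarrow> ramp 1 (m - u0 x)"
    using aeU
  proof eventually_elim
    case (elim x)
    have "isCont (ramp 1) (m - u0 x)" using ramp_deriv[of 1] DERIV_isCont by auto
    moreover have "(\<lambda>k. m - U (r k) x) \<longlonglongrightarrow> m - u0 x" by (intro tendsto_diff tendsto_const elim)
    ultimately show ?case unfolding \<zeta>_def by (rule isCont_tendsto_compose)
  qed

  have h_nonneg: "0 \<le> h x" for x unfolding h_def by (intro mult_nonneg_nonneg g_nonneg) auto
  have mg: "(\<lambda>x. g (norm (V x))) \<in> borel_measurable M" using mV by (intro measurable_g) auto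
  have inth: "integrable M h"
  proof (rule integrable_dominated[where f = "\<lambda>x. (1 + g0) * G (norm (V x))"])
    show "integrable M (\<lambda>x. (1 + g0) * G (norm (V x)))" using intV(2) by simp
    show "h \<in> borel_measurable M" unfolding h_def[abs_def] using mg mV by simp
    fix x
    have "norm (h x) = norm (V x) * g (norm (V x))" using h_nonneg[of x] by (simp add: h_def mult.commute)
    also have "\<dots> \<le> (1 + g0) * G (norm (V x))" by (rule tg_le) simp
    finally show "norm (h x) \<le> (1 + g0) * G (norm (V x))" .
  qed
  have normA: "norm (A x) \<le> g (norm (V x))" for x
    unfolding A_def using g_nonneg[of "norm (V x)"] by (cases "V x = 0") auto
  have AV: "A x \<bullet> V x = h x" for x
    unfolding A_def h_def by (cases "V x = 0") (auto simp: dot_square_norm power2_eq_square)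
  have mA: "A \<in> borel_measurable M" unfolding A_def[abs_def] using mg mV by simp
  have intA: "integrable M A"
  proof (rule integrable_dominated[where f = "\<lambda>x. (1 + g0) * (G (norm (V x)) + G 1)"])
    show "integrable M (\<lambda>x. (1 + g0) * (G (norm (V x)) + G 1))" using intV(2) by simp
    show "norm (A x) \<le> (1 + g0) * (G (norm (V x)) + G 1)" for x
      by (rule order_trans[OF normA g_le_1_plus_G]) simp
  qed (rule mA)
  have eqA: "(LINT x|M. A x \<bullet> gradient \<phi> x) = 0" if "test_function \<Omega> \<phi>" for \<phi>
    using sol that set_integral_lebesgue_on[OF sets_\<Omega>, of "\<lambda>x. A x \<bullet> gradient \<phi> x"]
    by (simp add: g_harmonic_solution_def A_def V_def)

  have supp: "\<exists>K. compact K \<and> K \<subseteq> \<Omega> \<and> (\<forall>x\<in>\<Omega> - K. \<zeta> k x = 0)" for k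
  proof -
    obtain K where K: "compact K" "K \<subseteq> \<Omega>" "\<And>x. x \<notin> K \<Longrightarrow> \<phi> k x = 0"
      using test_function_support[OF test[of k]] by metis
    define L where "L = closure \<Omega> \<inter> \<psi> -` {..m}"
    have "closed L" unfolding L_def by (rule continuous_closed_preimage[OF \<psi>(2)]) auto
    moreover have "bounded L" unfolding L_def using bounded_\<Omega> bounded_closure bounded_Int by blast
    ultimately have L: "compact L" by (simp add: compact_eq_bounded_closed)
    have "L \<inter> frontier \<Omega> = {}" using m by (force simp: L_def)
    then have L\<Omega>: "L \<subseteq> \<Omega>" using open_\<Omega> by (auto simp: L_def frontier_def interior_open)
    have "\<zeta> k x = 0" if "x \<in> \<Omega> - (K \<union> L)" for x
      using that K(3)[of x] closure_subset[of \<Omega>] by (auto simp: L_def \<zeta>_def U_def ramp_def)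
    then show ?thesis using K L L\<Omega> by (intro exI[of _ "K \<union> L"]) auto
  qed
  have \<zeta>C1: "C1_on \<Omega> (\<zeta> k) (\<lambda>x. (- c k x) *\<^sub>R P k x)" for k
  proof -
    have d: "((\<lambda>s. ramp 1 (m - s)) has_real_derivative - ramp' 1 (m - s)) (at s)" for s
    proof -
      have "((\<lambda>s. ramp 1 (m - s)) has_real_derivative ramp' 1 (m - s) * (- 1)) (at s)"
        by (rule DERIV_chain2[where f = "ramp 1" and g = "\<lambda>s. m - s", OF ramp_deriv])
           (auto intro!: derivative_eq_intros)
      then show ?thesis by simp
    qed
    have "continuous_on UNIV (\<lambda>s. - ramp' 1 (m - s))"
      by (intro continuous_intros continuous_on_compose2[OF ramp'_continuous[of 1]]) auto
    from C1_on_compose[OF U d this] show ?thesis unfolding \<zeta>_def[abs_def] c_def by simp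
  qed
  \<comment> \<open>The equation tested with \<open>\<zeta> k\<close>; below, \<open>P k = V - D k\<close> splits it into an energy term and a small pairing.\<close>
  have weak0: "(LINT x|M. A x \<bullet> ((- c k x) *\<^sub>R P k x)) = 0" for k
  proof -
    obtain K where "compact K" "K \<subseteq> \<Omega>" "\<And>x. x \<in> \<Omega> - K \<Longrightarrow> \<zeta> k x = 0" using supp[of k] by blast
    from weak_equation_C1[OF intA eqA \<zeta>C1 this] show ?thesis .
  qed

  have mult01: "integrable M (\<lambda>x. e x * f x)"
    if "e \<in> borel_measurable M" "\<And>x. 0 \<le> e x \<and> e x \<le> 1" "integrable M f" "\<And>x. 0 \<le> f x"
    for e f :: "'a \<Rightarrow> real"
  proof (rule integrable_dominated[OF that(3)])
    show "(\<lambda>x. e x * f x) \<in> borel_measurable M" using that(1,3) by (intro borel_measurable_times) auto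
    show "norm (e x * f x) \<le> f x" for x
      using that(2)[of x] that(4)[of x] by (simp add: abs_mult mult_left_le_one_le)
  qed
  have intch: "integrable M (\<lambda>x. c k x * h x)" for k
    using c01 h_nonneg by (intro mult01 mc inth) auto
  let ?C = "(1 + g0) * ((LINT x|M. G (norm (V x))) + 1)"
  have energy_small: "(LINT x|M. c k x * h x) \<le> l * ?C"
    if l: "0 < l" "luxemburg_norm G \<Omega> (D k) < ennreal l" for k l
  proof -
    note pair = pairing_small[OF mV intV(2) mD l(2,1)]
    have bd: "\<bar>c k x * (A x \<bullet> D k x)\<bar> \<le> g (norm (V x)) * norm (D k x)" for x
    proof -
      have "\<bar>c k x * (A x \<bullet> D k x)\<bar> \<le> 1 * \<bar>A x \<bullet> D k x\<bar>"
        unfolding abs_mult using c01[of k x] by (intro mult_right_mono) auto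
      also have "\<dots> \<le> norm (A x) * norm (D k x)" using Cauchy_Schwarz_ineq2[of "A x" "D k x"] by simp
      also have "\<dots> \<le> g (norm (V x)) * norm (D k x)" by (intro mult_right_mono normA) simp
      finally show ?thesis .
    qed
    have intAD: "integrable M (\<lambda>x. c k x * (A x \<bullet> D k x))"
    proof (rule integrable_dominated[OF pair(1)])
      show "(\<lambda>x. c k x * (A x \<bullet> D k x)) \<in> borel_measurable M"
        using mc mA mD by (intro borel_measurable_times borel_measurable_inner) auto
    qed (simp only: real_norm_def bd)
    have "A x \<bullet> ((- c k x) *\<^sub>R P k x) = c k x * (A x \<bullet> D k x) - c k x * h x" for x
      unfolding AV[symmetric] D_def by (simp add: inner_diff_right algebra_simps)
    then have "(LINT x|M. c k x * h x) = (LINT x|M. c k x * (A x \<bullet> D k x))"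
      using weak0[of k] by (simp add: Bochner_Integration.integral_diff[OF intAD intch])
    also have "\<dots> \<le> (LINT x|M. g (norm (V x)) * norm (D k x))"
      using bd by (intro integral_mono intAD pair(1)) (smt (verit))
    also have "\<dots> \<le> l * ?C" by (rule pair(2))
    finally show ?thesis .
  qed
  have "(\<lambda>k. LINT x|M. c (r k) x * h x) \<longlonglongrightarrow> (LINT x|M. c' x * h x)"
  proof (rule integral_dominated_convergence[where w = h])
    show "AE x in M. (\<lambda>k. c (r k) x * h x) \<longlonglongrightarrow> c' x * h x"
      using aec by eventually_elim (intro tendsto_mult tendsto_const)
    show "AE x in M. norm (c (r k) x * h x) \<le> h x" for k
      using c01 h_nonneg by (intro AE_I2) (auto simp: abs_mult intro!: mult_left_le_one_le)
    show "(\<lambda>x. c' x * h x) \<in> borel_measurable M" using mc' inth by (intro borel_measurable_times) auto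
  qed (rule borel_measurable_integrable[OF intch], rule inth)
  moreover have "(\<lambda>k. LINT x|M. c (r k) x * h x) \<longlonglongrightarrow> 0"
  proof (rule tendstoI)
    fix e :: real assume "0 < e"
    have C: "0 < ?C"
      using pos G_nonneg by (intro mult_pos_pos add_nonneg_pos Bochner_Integration.integral_nonneg) auto
    define l where "l = e / (2 * ?C)"
    have "0 < e / (2 * c) \<and> e / (2 * c) * c < e" if "0 < c" for c using that \<open>0 < e\<close> by simp
    from this[OF C] have l: "0 < l" "l * ?C < e" unfolding l_def by blast+
    have "(\<lambda>k. luxemburg_norm G \<Omega> (D (r k))) \<longlonglongrightarrow> 0"
      using LIMSEQ_subseq_LIMSEQ[OF limD r] by (simp add: o_def)
    then have "\<forall>\<^sub>F k in sequentially. luxemburg_norm G \<Omega> (D (r k)) < ennreal l"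
      using l by (intro order_tendstoD) auto
    then show "\<forall>\<^sub>F k in sequentially. dist (LINT x|M. c (r k) x * h x) 0 < e"
    proof eventually_elim
      case (elim k)
      have "0 \<le> (LINT x|M. c (r k) x * h x)"
        using c01 h_nonneg by (intro Bochner_Integration.integral_nonneg) auto
      then show ?case using energy_small[OF l(1) elim] l(2) by simp
    qed
  qed
  ultimately have zero: "(LINT x|M. c' x * h x) = 0" by (rule LIMSEQ_unique)
  have c'01: "0 \<le> c' x" "c' x \<le> 1" for x using ramp'_bounds[of 1] by (auto simp: c'_def)
  have "integrable M (\<lambda>x. c' x * h x)"
    using c'01 h_nonneg by (intro mult01 mc' inth) auto
  then have "AE x in M. c' x * h x = 0"
    using zero c'01 h_nonneg by (subst (asm) integral_nonneg_eq_0_iff_AE) auto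
  \<comment> \<open>The energy density \<open>h\<close> is positive wherever \<open>V\<close> is not \<open>0\<close>.\<close>
  then have ae0: "AE x in M. c' x * norm (V x) = 0"
  proof eventually_elim
    case (elim x)
    show ?case
    proof (cases "V x = 0")
      case False
      then have "h x \<noteq> 0" unfolding h_def using g_pos[of "norm (V x)"] by simp
      then show ?thesis using elim by simp
    qed simp
  qed

  obtain R where R: "\<And>x. x \<in> \<Omega> \<Longrightarrow> norm x \<le> R" using bounded_\<Omega> by (auto simp: bounded_iff)
  have R0: "0 \<le> \<bar>R\<bar>" by simp
  have R': "norm x \<le> \<bar>R\<bar>" if "x \<in> \<Omega>" for x using R[OF that] by linarith
  have \<zeta>_nonneg: "0 \<le> \<zeta> k x" for k x unfolding \<zeta>_def by (rule ramp_bounds(1)) simp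
  have intcV: "integrable M (\<lambda>x. c k x * norm (V x))" for k
    using c01 by (intro mult01 mc integrable_norm[OF intV(1)]) auto
  have \<zeta>_small: "\<forall>\<^sub>F k in sequentially. (LINT x|M. \<zeta> k x) \<le> \<bar>R\<bar> * ((LINT x|M. c k x * norm (V x)) + (LINT x|M. norm (D k x)))"
  proof -
    have "\<forall>\<^sub>F k in sequentially. luxemburg_norm G \<Omega> (D k) < ennreal 1"
      using limD by (intro order_tendstoD) auto
    then show ?thesis
    proof eventually_elim
      case (elim k)
      have iD: "integrable M (D k)" by (rule luxemburg_norm_less_L1(1)[OF elim _ mD]) simp
      obtain K where K: "compact K" "K \<subseteq> \<Omega>" "\<And>x. x \<in> \<Omega> - K \<Longrightarrow> \<zeta> k x = 0" using supp[of k] by blast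
      have "(LINT x|M. \<zeta> k x) \<le> \<bar>R\<bar> * (LINT x|M. norm ((- c k x) *\<^sub>R P k x))"
        by (rule integral_le_integral_gradient[OF \<zeta>C1 K R'])
      also have "\<dots> \<le> \<bar>R\<bar> * (LINT x|M. c k x * norm (V x) + norm (D k x))"
      proof (rule mult_left_mono[OF integral_mono' R0])
        show "integrable M (\<lambda>x. c k x * norm (V x) + norm (D k x))" using intcV iD by simp
        fix x
        have "norm ((- c k x) *\<^sub>R P k x) = c k x * norm (V x - D k x)" using c01[of k x] by (simp add: D_def)
        also have "\<dots> \<le> c k x * (norm (V x) + norm (D k x))"
          using c01[of k x] by (intro mult_left_mono norm_triangle_ineq4) auto
        also have "\<dots> \<le> c k x * norm (V x) + norm (D k x)"
          using c01[of k x] by (simp add: distrib_left mult_left_le_one_le)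
        finally show "norm ((- c k x) *\<^sub>R P k x) \<le> c k x * norm (V x) + norm (D k x)" .
        show "0 \<le> c k x * norm (V x) + norm (D k x)" using c01[of k x] by simp
      qed
      also have "(LINT x|M. c k x * norm (V x) + norm (D k x)) = (LINT x|M. c k x * norm (V x)) + (LINT x|M. norm (D k x))"
        using intcV iD by (intro Bochner_Integration.integral_add) auto
      finally show ?case .
    qed
  qed
  have "(\<lambda>k. LINT x|M. c (r k) x * norm (V x)) \<longlonglongrightarrow> (LINT x|M. 0)"
  proof (rule integral_dominated_convergence[where w = "\<lambda>x. norm (V x)"])
    show "AE x in M. (\<lambda>k. c (r k) x * norm (V x)) \<longlonglongrightarrow> 0"
      using aec ae0
    proof eventually_elim
      case (elim x)
      have "(\<lambda>k. c (r k) x * norm (V x)) \<longlonglongrightarrow> c' x * norm (V x)" by (intro tendsto_mult tendsto_const elim)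
      then show ?case using elim(2) by simp
    qed
    show "AE x in M. norm (c (r k) x * norm (V x)) \<le> norm (V x)" for k
      using c01 by (intro AE_I2) (auto simp: abs_mult intro!: mult_left_le_one_le)
  qed (simp, rule borel_measurable_integrable[OF intcV], rule integrable_norm[OF intV(1)])
  then have "(\<lambda>k. \<bar>R\<bar> * ((LINT x|M. c (r k) x * norm (V x)) + (LINT x|M. norm (D (r k) x)))) \<longlonglongrightarrow> \<bar>R\<bar> * (0 + 0)"
    using LIMSEQ_subseq_LIMSEQ[OF L1D r] by (intro tendsto_mult tendsto_add tendsto_const) (auto simp: o_def)
  then have lim_up: "(\<lambda>k. \<bar>R\<bar> * ((LINT x|M. c (r k) x * norm (V x)) + (LINT x|M. norm (D (r k) x)))) \<longlonglongrightarrow> 0" by simp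
  have "(\<lambda>k. LINT x|M. norm (\<zeta> (r k) x)) \<longlonglongrightarrow> 0"
  proof (rule tendsto_sandwich[OF _ _ tendsto_const lim_up])
    show "\<forall>\<^sub>F k in sequentially. 0 \<le> (LINT x|M. norm (\<zeta> (r k) x))" by simp
    show "\<forall>\<^sub>F k in sequentially. (LINT x|M. norm (\<zeta> (r k) x))
        \<le> \<bar>R\<bar> * ((LINT x|M. c (r k) x * norm (V x)) + (LINT x|M. norm (D (r k) x)))"
      using eventually_subseq[OF r \<zeta>_small] \<zeta>_nonneg by simp
  qed
  moreover have int\<zeta>: "integrable M (\<zeta> k)" for k
  proof -
    obtain K where K: "compact K" "K \<subseteq> \<Omega>" "\<And>x. x \<in> \<Omega> - K \<Longrightarrow> \<zeta> k x = 0" using supp[of k] by blast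
    obtain B where "\<And>x. x \<in> \<Omega> \<Longrightarrow> norm (\<zeta> k x) \<le> B"
      using compact_support_bounded_on[OF C1_on_continuous[OF \<zeta>C1] K] by blast
    then show ?thesis by (rule bounded_continuous_integrable[OF C1_on_continuous[OF \<zeta>C1]])
  qed
  ultimately obtain s :: "nat \<Rightarrow> nat" where s: "strict_mono s" and aes: "AE x in M. (\<lambda>k. \<zeta> (r (s k)) x) \<longlonglongrightarrow> 0"
    using tendsto_L1_AE_subseq[of M "\<lambda>k. \<zeta> (r k)"] by blast
  show ?thesis
    using ae\<zeta> aes
  proof eventually_elim
    case (elim x)
    have "(\<lambda>k. \<zeta> (r (s k)) x) \<longlonglongrightarrow> ramp 1 (m - u0 x)"
      using LIMSEQ_subseq_LIMSEQ[OF elim(1) s] by (simp add: o_def)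
    then have "ramp 1 (m - u0 x) = 0" using elim(2) by (rule LIMSEQ_unique)
    then show ?case using ramp_bounds(2)[of 1 "m - u0 x"] by (cases "0 < m - u0 x") auto
  qed
qed

end


section \<open>The competitor\<close>

context orlicz_setting
begin

lemma nn_set_integral_M:
  assumes "S \<subseteq> \<Omega>"
  shows "(\<integral>\<^sup>+x\<in>S. f x \<partial>lebesgue) = (\<integral>\<^sup>+x. f x * indicator S x \<partial>M)"
proof -
  have "(\<integral>\<^sup>+x. f x * indicator S x \<partial>M) = (\<integral>\<^sup>+x. f x * indicator S x * indicator \<Omega> x \<partial>lebesgue)"
    using sets_\<Omega> by (intro nn_integral_restrict_space) simp
  also have "(\<lambda>x. f x * indicator S x * indicator \<Omega> x) = (\<lambda>x. f x * indicator S x)"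
    using assms by (auto simp: indicator_def fun_eq_iff)
  finally show ?thesis ..
qed

text \<open>The competitor is \<open>\<eta>\<close> times the truncation of \<open>\<psi>\<close> to \<open>[0, b]\<close>. On the boundary both operations act
trivially; inside, the truncation replaces the unknown size of \<open>\<psi>\<close> by \<open>2 b\<close> without increasing the gradient.\<close>

lemma competitor:
  assumes \<psi>: "C1_on \<Omega> \<psi> W" "continuous_on (closure \<Omega>) \<psi>" "\<And>x. x \<in> \<Omega> \<Longrightarrow> norm (W x) \<le> L"
    and bdry: "\<And>x. x \<in> frontier \<Omega> \<Longrightarrow> 0 \<le> \<psi> x \<and> \<psi> x \<le> b" and b: "0 < b"
    and \<eta>: "C1_on UNIV \<eta> Y" "\<And>x. 0 \<le> \<eta> x \<and> \<eta> x \<le> 1" "\<And>x. x \<in> frontier \<Omega> \<Longrightarrow> \<eta> x = 1"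
      "\<And>x. norm (Y x) \<le> C"
    and I: "open I" "I \<subseteq> \<Omega>" "\<And>x. x \<in> I \<Longrightarrow> \<eta> x = 0"
  obtains v V where "v \<in> dirichlet_class G \<Omega> \<psi>" "has_weak_gradient \<Omega> v V"
    "\<And>x. norm (V x) \<le> norm (W x) + 2 * b * C" "\<And>x. x \<in> I \<Longrightarrow> v x = 0 \<and> V x = 0"
proof -
  let ?T = "trunc 0 b b" and ?T' = "trunc' 0 b b"
  define v where "v x = \<eta> x * ?T (\<psi> x)" for x
  define V where "V x = \<eta> x *\<^sub>R (?T' (\<psi> x) *\<^sub>R W x) + ?T (\<psi> x) *\<^sub>R Y x" for x
  have \<eta>\<Omega>: "C1_on \<Omega> \<eta> Y" by (rule C1_on_subset[OF \<eta>(1)]) simp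
  have v: "C1_on \<Omega> v V"
    unfolding v_def[abs_def] V_def[abs_def] by (rule C1_on_mult[OF \<eta>\<Omega> C1_on_trunc[OF \<psi>(1) b]])
  have T: "\<bar>?T s\<bar> \<le> 2 * b" "0 \<le> ?T' s" "?T' s \<le> 1" for s
    using trunc_bounds(1,2,4,5)[of b 0 b s] b by auto
  have bV: "norm (V x) \<le> norm (W x) + 2 * b * C" for x
  proof -
    have "norm (V x) \<le> norm (\<eta> x *\<^sub>R (?T' (\<psi> x) *\<^sub>R W x)) + norm (?T (\<psi> x) *\<^sub>R Y x)"
      unfolding V_def by (rule norm_triangle_ineq)
    also have "\<dots> \<le> norm (W x) + 2 * b * C"
    proof (rule add_mono)
      have "\<bar>\<eta> x\<bar> * (\<bar>?T' (\<psi> x)\<bar> * norm (W x)) \<le> 1 * (1 * norm (W x))"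
        using \<eta>(2)[of x] T(2,3)[of "\<psi> x"] by (intro mult_mono) auto
      then show "norm (\<eta> x *\<^sub>R (?T' (\<psi> x) *\<^sub>R W x)) \<le> norm (W x)"
        by (simp only: norm_scaleR mult_1)
      show "norm (?T (\<psi> x) *\<^sub>R Y x) \<le> 2 * b * C"
        unfolding norm_scaleR using T(1) \<eta>(4) b by (intro mult_mono) auto
    qed
    finally show ?thesis .
  qed
  have bv: "\<bar>v x\<bar> \<le> 2 * b" for x
  proof -
    have "\<bar>\<eta> x\<bar> * \<bar>?T (\<psi> x)\<bar> \<le> 1 * (2 * b)" using \<eta>(2)[of x] T(1) by (intro mult_mono) auto
    then show ?thesis by (simp add: v_def abs_mult)
  qed
  have "v \<in> orlicz_sobolev G \<Omega>"
  proof (rule C1_on_orlicz_sobolev[OF v bv])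
    fix x assume "x \<in> \<Omega>"
    then show "norm (V x) \<le> L + 2 * b * C" using bV[of x] \<psi>(3)[of x] by linarith
  qed
  moreover have "(\<lambda>x. v x - \<psi> x) \<in> orlicz_sobolev_0 G \<Omega>"
  proof (rule C1_on_orlicz_sobolev_0[OF C1_on_diff[OF v \<psi>(1)]])
    fix x assume "x \<in> \<Omega>"
    then show "norm (V x - W x) \<le> (L + 2 * b * C) + L"
      using bV[of x] \<psi>(3)[of x] norm_triangle_ineq4[of "V x" "W x"] by linarith
  next
    have "continuous_on UNIV ?T"
      using DERIV_isCont[OF trunc_deriv[OF b]] by (intro continuous_at_imp_continuous_on ballI) blast
    then have "continuous_on (closure \<Omega>) (\<lambda>x. ?T (\<psi> x))"
      by (rule continuous_on_compose2[OF _ \<psi>(2)]) simp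
    then show "continuous_on (closure \<Omega>) (\<lambda>x. v x - \<psi> x)"
      unfolding v_def by (intro continuous_intros \<psi>(2) continuous_on_subset[OF C1_on_continuous[OF \<eta>(1)]]) auto
  next
    fix x assume x: "x \<in> frontier \<Omega>"
    then have "?T (\<psi> x) = \<psi> x" using bdry[OF x] b by (intro trunc_bounds(3)) auto
    then show "v x - \<psi> x = 0" using \<eta>(3)[OF x] by (simp add: v_def)
  qed
  ultimately have dir: "v \<in> dirichlet_class G \<Omega> \<psi>" by (simp add: dirichlet_class_def)
  have v0: "v x = 0" if "x \<in> I" for x using I(3)[OF that] by (simp add: v_def)
  have V0: "V x = 0" if "x \<in> I" for x
  proof -
    have "x \<in> \<Omega>" using that I(2) by blast
    from C1_on_gradient_zero[OF v I(1) that this v0] show ?thesis .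
  qed
  show ?thesis
    by (rule that[OF dir has_weak_gradient_C1_on[OF v open_\<Omega>] bV]) (simp add: v0 V0)
qed

lemma energy_competitor_le:
  fixes W :: "'a \<Rightarrow> 'a"
  assumes v: "has_weak_gradient \<Omega> v V" "\<And>x. norm (V x) \<le> norm (W x) + t"
    "\<And>x. x \<in> I \<Longrightarrow> v x = 0 \<and> V x = 0" and t: "0 \<le> t"
    and W: "continuous_on \<Omega> W" and I: "open I" "I \<subseteq> \<Omega>"
    and a: "continuous_on \<Omega> a" "\<And>x. x \<in> \<Omega> \<Longrightarrow> 0 \<le> a x"
    and \<Gamma>: "\<And>s. 0 \<le> \<Gamma> s \<and> \<Gamma> s \<le> 1" "\<Gamma> 0 = 0"
  shows "energy G \<Omega> a \<Gamma> v
     \<le> ennreal (2 powr (1 + g0)) * ((\<integral>\<^sup>+x\<in>\<Omega> - I. ennreal (G (norm (W x))) \<partial>lebesgue) + ennreal (G t * measure lebesgue \<Omega>))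
       + (\<integral>\<^sup>+x\<in>\<Omega> - I. ennreal (a x) \<partial>lebesgue)"
proof -
  let ?K = "2 powr (1 + g0)" and ?i = "indicator (\<Omega> - I) :: 'a \<Rightarrow> ennreal"
  have "\<Omega> - I \<in> sets lebesgue" using I open_\<Omega> by (intro sets.Diff) (auto intro: borel_open)
  then have setS: "\<Omega> - I \<in> sets M"
    using sets_\<Omega> by (auto simp: sets_restrict_space_iff)
  have mW: "(\<lambda>x. G (norm (W x))) \<in> borel_measurable M"
    using continuous_measurable_M[OF W] by (intro measurable_G) auto
  have ma: "a \<in> borel_measurable M" by (rule continuous_measurable_M[OF a(1)])
  have "energy G \<Omega> a \<Gamma> v = (\<integral>\<^sup>+x. ennreal (G (norm (weak_gradient \<Omega> v x)) + a x * \<Gamma> (v x)) \<partial>M)"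
    by (simp only: energy_def nn_set_integral_lebesgue_on sets_\<Omega>)
  also have "\<dots> = (\<integral>\<^sup>+x. ennreal (G (norm (V x)) + a x * \<Gamma> (v x)) \<partial>M)"
    by (rule nn_integral_cong_AE) (use weak_gradient_AE(2)[OF open_\<Omega> v(1)] in \<open>eventually_elim, simp\<close>)
  also have "\<dots> \<le> (\<integral>\<^sup>+x. ennreal ?K * (ennreal (G (norm (W x))) * ?i x + ennreal (G t)) + ennreal (a x) * ?i x \<partial>M)"
  proof (rule nn_integral_mono)
    fix x assume "x \<in> space M"
    then have x: "x \<in> \<Omega>" by (simp only: space_M)
    show "ennreal (G (norm (V x)) + a x * \<Gamma> (v x)) \<le> ennreal ?K * (ennreal (G (norm (W x))) * ?i x + ennreal (G t)) + ennreal (a x) * ?i x"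
    proof (cases "x \<in> I")
      case True
      then show ?thesis using v(3)[OF True] \<Gamma>(2) by (simp add: G_0)
    next
      case False
      have "G (norm (V x)) \<le> G (norm (W x) + t)" using v(2)[of x] by (intro G_mono) auto
      also have "\<dots> \<le> ?K * (G (norm (W x)) + G t)" using t by (intro G_add_le) auto
      finally have 1: "G (norm (V x)) \<le> ?K * (G (norm (W x)) + G t)" .
      have 2: "a x * \<Gamma> (v x) \<le> a x" using a(2)[OF x] \<Gamma>(1)[of "v x"] by (simp add: mult_left_le)
      have "ennreal (G (norm (V x)) + a x * \<Gamma> (v x)) \<le> ennreal (?K * (G (norm (W x)) + G t) + a x)"
        using 1 2 by (intro ennreal_leI) linarith
      also have "\<dots> = ennreal ?K * (ennreal (G (norm (W x))) + ennreal (G t)) + ennreal (a x)"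
        using G_nonneg[of "norm (W x)"] G_nonneg[OF t] a(2)[OF x] by (simp add: ennreal_plus ennreal_mult)
      finally show ?thesis using False x by simp
    qed
  qed
  also have "\<dots> = ennreal ?K * ((\<integral>\<^sup>+x. ennreal (G (norm (W x))) * ?i x \<partial>M) + ennreal (G t) * emeasure M (space M))
      + (\<integral>\<^sup>+x. ennreal (a x) * ?i x \<partial>M)"
    using mW ma setS by (simp add: nn_integral_add nn_integral_cmult)
  also have "ennreal (G t) * emeasure M (space M) = ennreal (G t * measure lebesgue \<Omega>)"
  proof -
    have "emeasure M (space M) = emeasure lebesgue \<Omega>"
      using sets_\<Omega> by (simp add: emeasure_restrict_space space_restrict_space)
    also have "\<dots> = ennreal (measure lebesgue \<Omega>)"
      using \<Omega> by (rule emeasure_eq_measure2)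
    finally show ?thesis using G_nonneg[OF t] by (simp add: ennreal_mult)
  qed
  finally show ?thesis
    by (simp only: nn_set_integral_M[OF Diff_subset])
qed

lemma energy_solution_ge:
  assumes u: "AE x in M. \<epsilon> \<le> u x" and \<Gamma>: "\<And>s. \<epsilon> \<le> s \<Longrightarrow> \<Gamma> s = 1"
  shows "(\<integral>\<^sup>+x\<in>\<Omega>. ennreal (a x) \<partial>lebesgue) \<le> energy G \<Omega> a \<Gamma> u"
proof -
  have "(\<integral>\<^sup>+x. ennreal (a x) \<partial>M) \<le> (\<integral>\<^sup>+x. ennreal (G (norm (weak_gradient \<Omega> u x)) + a x * \<Gamma> (u x)) \<partial>M)"
  proof (rule nn_integral_mono_AE)
    show "AE x in M. ennreal (a x) \<le> ennreal (G (norm (weak_gradient \<Omega> u x)) + a x * \<Gamma> (u x))"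
      using u by eventually_elim (simp add: \<Gamma> G_nonneg ennreal_leI)
  qed
  then show ?thesis by (simp only: energy_def nn_set_integral_lebesgue_on sets_\<Omega>)
qed

text \<open>Removing the weight from \<open>I\<close> saves at least \<open>i0\<close> times the measure of \<open>I\<close>. The bound \<open>B\<close> makes the integral over the
layer finite, so that the strict inequality survives the addition of this integral.\<close>

lemma integral_gap:
  assumes I: "open I" "I \<subseteq> \<Omega>" and a: "continuous_on \<Omega> a" "\<And>x. x \<in> \<Omega> \<Longrightarrow> i0 \<le> a x" "\<And>x. x \<in> \<Omega> \<Longrightarrow> a x \<le> B"
    and i0: "0 < i0" and q: "0 \<le> q" "q < i0 * measure lebesgue I"
  shows "ennreal q + (\<integral>\<^sup>+x\<in>\<Omega> - I. ennreal (a x) \<partial>lebesgue) < (\<integral>\<^sup>+x\<in>\<Omega>. ennreal (a x) \<partial>lebesgue)"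
proof -
  have Im: "I \<in> lmeasurable"
    using I(1) bounded_subset[OF bounded_\<Omega> I(2)] by (rule lmeasurable_open[rotated])
  have "\<Omega> - I \<in> sets lebesgue" using fmeasurableD[OF Im] sets_\<Omega> by (rule sets.Diff[rotated])
  then have setS: "\<Omega> - I \<in> sets M" and setI: "I \<in> sets M"
    using I(2) fmeasurableD[OF Im] sets_\<Omega> by (auto simp: sets_restrict_space_iff)
  have ma: "a \<in> borel_measurable M" by (rule continuous_measurable_M[OF a(1)])
  let ?A = "\<integral>\<^sup>+x. ennreal (a x) * indicator (\<Omega> - I) x \<partial>M"
  have "?A \<le> (\<integral>\<^sup>+x. ennreal B \<partial>M)"
    using a(3) by (intro nn_integral_mono) (auto simp: space_M indicator_def intro: ennreal_leI)
  also have "\<dots> < top" by (simp add: emeasure_eq_measure ennreal_mult_less_top)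
  finally have fin: "?A < top" .
  have "ennreal q < ennreal (i0 * measure lebesgue I)"
    using q by (simp add: ennreal_less_iff)
  then have "?A + ennreal q < ?A + ennreal (i0 * measure lebesgue I)"
    using fin by (simp add: ennreal_add_left_cancel_less less_top)
  also have "ennreal (i0 * measure lebesgue I) = (\<integral>\<^sup>+x. ennreal i0 * indicator I x \<partial>M)"
  proof -
    have "emeasure M I = emeasure lebesgue I"
      using I(2) sets_\<Omega> by (simp add: emeasure_restrict_space)
    also have "\<dots> = ennreal (measure lebesgue I)" using Im by (rule emeasure_eq_measure2)
    finally show ?thesis using setI i0 by (simp add: nn_integral_cmult_indicator ennreal_mult)
  qed
  also have "?A + (\<integral>\<^sup>+x. ennreal i0 * indicator I x \<partial>M) = (\<integral>\<^sup>+x. ennreal (a x) * indicator (\<Omega> - I) x + ennreal i0 * indicator I x \<partial>M)"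
    using ma setI setS by (intro nn_integral_add[symmetric]) auto
  also have "\<dots> \<le> (\<integral>\<^sup>+x. ennreal (a x) \<partial>M)"
    using a(2) by (intro nn_integral_mono) (auto simp: space_M indicator_def intro: ennreal_leI)
  finally show ?thesis
    by (simp only: nn_set_integral_M[OF Diff_subset] nn_set_integral_lebesgue_on sets_\<Omega> add.commute)
qed

end


section \<open>The boundary datum\<close>

lemma C1_holder_closure_imp:
  fixes \<Omega> :: "'a::euclidean_space set"
  assumes "C1_holder_closure \<alpha> \<Omega> \<psi>" "0 < \<alpha>" "bounded \<Omega>"
  shows "C1_on \<Omega> \<psi> (gradient \<psi>)" "\<exists>L. \<forall>x\<in>\<Omega>. norm (gradient \<psi> x) \<le> L"
proof -
  obtain C where C: "\<And>x y. x \<in> \<Omega> \<Longrightarrow> y \<in> \<Omega> \<Longrightarrow> norm (gradient \<psi> x - gradient \<psi> y) \<le> C * dist x y powr \<alpha>"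
    using assms(1) by (auto simp: C1_holder_closure_def)
  have "(gradient \<psi> \<longlongrightarrow> gradient \<psi> x) (at x within \<Omega>)" if x: "x \<in> \<Omega>" for x
  proof -
    have "((\<lambda>y. C * dist y x powr \<alpha>) \<longlongrightarrow> C * dist x x powr \<alpha>) (at x within \<Omega>)"
      using assms(2) by (intro tendsto_mult tendsto_const tendsto_powr' tendsto_dist tendsto_ident_at) auto
    then have lim: "((\<lambda>y. C * dist y x powr \<alpha>) \<longlongrightarrow> 0) (at x within \<Omega>)" by simp
    have "\<forall>\<^sub>F y in at x within \<Omega>. norm (gradient \<psi> y - gradient \<psi> x) \<le> C * dist y x powr \<alpha>"
      using C[OF _ x] by (auto simp: eventually_at_filter)
    then have "((\<lambda>y. gradient \<psi> y - gradient \<psi> x) \<longlongrightarrow> 0) (at x within \<Omega>)"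
      using lim by (rule Lim_null_comparison)
    then show ?thesis by (simp add: LIM_zero_iff)
  qed
  then have "continuous_on \<Omega> (gradient \<psi>)" by (simp add: continuous_on_def)
  then show "C1_on \<Omega> \<psi> (gradient \<psi>)"
    using assms(1) GDERIV_gradient by (auto simp: C1_on_def C1_holder_closure_def)
  show "\<exists>L. \<forall>x\<in>\<Omega>. norm (gradient \<psi> x) \<le> L"
  proof (cases "\<Omega> = {}")
    case False
    then obtain x0 where x0: "x0 \<in> \<Omega>" by blast
    have "norm (gradient \<psi> x) \<le> norm (gradient \<psi> x0) + \<bar>C\<bar> * diameter \<Omega> powr \<alpha>" if x: "x \<in> \<Omega>" for x
    proof -
      have "dist x x0 powr \<alpha> \<le> diameter \<Omega> powr \<alpha>"
        using diameter_bounded_bound[OF assms(3) x x0] assms(2) by (intro powr_mono2) auto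
      then have "\<bar>C\<bar> * dist x x0 powr \<alpha> \<le> \<bar>C\<bar> * diameter \<Omega> powr \<alpha>" by (intro mult_left_mono) auto
      moreover have "C * dist x x0 powr \<alpha> \<le> \<bar>C\<bar> * dist x x0 powr \<alpha>" by (intro mult_right_mono) auto
      moreover have "norm (gradient \<psi> x) \<le> norm (gradient \<psi> x0) + norm (gradient \<psi> x - gradient \<psi> x0)"
        using norm_triangle_sub by blast
      ultimately show ?thesis using C[OF x x0] by linarith
    qed
    then show ?thesis by blast
  qed simp
qed

text \<open>Differentiate in the direction of the gradient itself.\<close>

lemma gradient_le_Lipschitz:
  fixes \<Omega> :: "'a::euclidean_space set"
  assumes "open \<Omega>" "x \<in> \<Omega>" "GDERIV f x :> D" and Lip: "\<And>y. y \<in> \<Omega> \<Longrightarrow> \<bar>f y - f x\<bar> \<le> \<kappa> * dist y x"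
  shows "norm D \<le> \<kappa>"
proof (cases "D = 0")
  case True
  have "\<exists>e>0. ball x e \<subseteq> \<Omega>" using assms(1,2) open_contains_ball by blast
  then obtain e where e: "0 < e" "ball x e \<subseteq> \<Omega>" by blast
  obtain b :: 'a where b: "b \<in> Basis" using nonempty_Basis by blast
  let ?y = "x + (e / 2) *\<^sub>R b"
  have d: "dist ?y x = e / 2" using b e(1) by (simp add: dist_norm)
  then have "?y \<in> \<Omega>" using e by (auto simp: dist_commute)
  from Lip[OF this] have "0 \<le> \<kappa> * (e / 2)" unfolding d by linarith
  then show ?thesis using e(1) True by (simp add: zero_le_mult_iff)
next
  case False
  have "((\<lambda>t. f (x + t *\<^sub>R D)) has_derivative (\<lambda>t. (t *\<^sub>R D) \<bullet> D)) (at 0)"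
    by (rule has_derivative_compose[of "\<lambda>t. x + t *\<^sub>R D" "\<lambda>t. t *\<^sub>R D" 0 UNIV f])
       (use assms(3) in \<open>auto intro!: derivative_eq_intros simp: gderiv_def\<close>)
  then have "((\<lambda>t. f (x + t *\<^sub>R D)) has_real_derivative D \<bullet> D) (at 0)"
    by (simp add: has_field_derivative_def mult.commute[of _ "D \<bullet> D"])
  then have "((\<lambda>h. (f (x + h *\<^sub>R D) - f x) / h) \<longlongrightarrow> D \<bullet> D) (at 0)"
    by (simp add: DERIV_def)
  moreover have "\<forall>\<^sub>F h in at 0. (f (x + h *\<^sub>R D) - f x) / h \<le> \<kappa> * norm D"
  proof -
    have "((\<lambda>h. x + h *\<^sub>R D) \<longlongrightarrow> x + 0 *\<^sub>R D) (at 0)" by (intro tendsto_intros)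
    then have "\<forall>\<^sub>F h in at 0. x + h *\<^sub>R D \<in> \<Omega>"
      using topological_tendstoD[OF _ assms(1)] assms(2) by auto
    moreover have "\<forall>\<^sub>F h in at 0. h \<noteq> (0::real)" by (simp add: eventually_at_filter)
    ultimately show ?thesis
    proof eventually_elim
      case (elim h)
      have "(f (x + h *\<^sub>R D) - f x) / h \<le> \<bar>f (x + h *\<^sub>R D) - f x\<bar> / \<bar>h\<bar>"
        by (metis abs_divide abs_ge_self)
      also have "\<dots> \<le> (\<kappa> * (\<bar>h\<bar> * norm D)) / \<bar>h\<bar>"
        using Lip[OF elim(1)] by (intro divide_right_mono) (auto simp: dist_norm)
      also have "\<dots> = \<kappa> * norm D" using elim(2) by simp
      finally show ?case .
    qed
  qed
  ultimately have "D \<bullet> D \<le> \<kappa> * norm D" by (intro tendsto_upperbound) auto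
  then have "norm D * norm D \<le> \<kappa> * norm D" by (simp add: dot_square_norm power2_eq_square)
  then show ?thesis using False by simp
qed

lemma C01_norm_le:
  assumes "C01_norm \<Omega> \<psi> \<le> ennreal \<kappa>" "0 \<le> \<kappa>"
  shows "x \<in> \<Omega> \<Longrightarrow> \<bar>\<psi> x\<bar> \<le> \<kappa>" "x \<in> \<Omega> \<Longrightarrow> y \<in> \<Omega> \<Longrightarrow> \<bar>\<psi> x - \<psi> y\<bar> \<le> \<kappa> * dist x y"
proof -
  let ?A = "SUP x\<in>\<Omega>. ennreal \<bar>\<psi> x\<bar>"
  let ?S = "{(x, y). x \<in> \<Omega> \<and> y \<in> \<Omega> \<and> x \<noteq> y}"
  let ?B = "SUP (x, y)\<in>?S. ennreal (\<bar>\<psi> x - \<psi> y\<bar> / dist x y)"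
  have le: "?A + ?B \<le> ennreal \<kappa>" using assms(1) by (simp only: C01_norm_def)
  have A: "?A \<le> ennreal \<kappa>" by (rule order_trans[OF _ le]) simp
  have B: "?B \<le> ennreal \<kappa>" by (rule order_trans[OF _ le]) simp
  show "\<bar>\<psi> x\<bar> \<le> \<kappa>" if "x \<in> \<Omega>"
  proof -
    have "ennreal \<bar>\<psi> x\<bar> \<le> ?A" using that by (rule SUP_upper)
    then have "ennreal \<bar>\<psi> x\<bar> \<le> ennreal \<kappa>" using A by (rule order_trans)
    then show ?thesis using assms(2) by (simp add: ennreal_le_iff)
  qed
  show "\<bar>\<psi> x - \<psi> y\<bar> \<le> \<kappa> * dist x y" if "x \<in> \<Omega>" "y \<in> \<Omega>"
  proof (cases "x = y")
    case False
    then have "(x, y) \<in> ?S" using that by simp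
    then have "(case (x, y) of (x, y) \<Rightarrow> ennreal (\<bar>\<psi> x - \<psi> y\<bar> / dist x y)) \<le> ?B" by (rule SUP_upper)
    then have "ennreal (\<bar>\<psi> x - \<psi> y\<bar> / dist x y) \<le> ?B" by simp
    then have "ennreal (\<bar>\<psi> x - \<psi> y\<bar> / dist x y) \<le> ennreal \<kappa>" using B by (rule order_trans)
    then have "\<bar>\<psi> x - \<psi> y\<bar> / dist x y \<le> \<kappa>" using assms(2) by (simp add: ennreal_le_iff)
    then show ?thesis using False by (simp add: pos_divide_le_eq)
  qed simp
qed

lemma continuous_boundary_bounds:
  fixes \<Omega> :: "'a::euclidean_space set"
  assumes "continuous_on (closure \<Omega>) \<psi>" "bounded \<Omega>" "x \<in> frontier \<Omega>"
  shows "(INF x\<in>frontier \<Omega>. \<psi> x) \<le> \<psi> x" "\<psi> x \<le> (SUP x\<in>frontier \<Omega>. (\<psi> x :: real))"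
proof -
  have sub: "frontier \<Omega> \<subseteq> closure \<Omega>" by (auto simp: frontier_def)
  have "compact (frontier \<Omega>)" using assms(2) by (rule compact_frontier_bounded)
  then have bd: "bounded (\<psi> ` frontier \<Omega>)"
    by (intro compact_imp_bounded compact_continuous_image continuous_on_subset[OF assms(1) sub])
  from bounded_imp_bdd_below[OF bd] bounded_imp_bdd_above[OF bd] show "(INF x\<in>frontier \<Omega>. \<psi> x) \<le> \<psi> x" "\<psi> x \<le> (SUP x\<in>frontier \<Omega>. \<psi> x)"
    using assms(3) by (auto intro: cINF_lower cSUP_upper)
qed

context orlicz_setting
begin

lemma boundary_layer_size_le:
  assumes \<psi>: "C1_on \<Omega> \<psi> (gradient \<psi>)" "continuous_on (closure \<Omega>) \<psi>" and "frontier \<Omega> \<noteq> {}"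
    and \<kappa>: "C01_norm \<Omega> \<psi> \<le> ennreal \<kappa>" "0 \<le> \<kappa>" "\<kappa> \<le> 1"
  shows "boundary_layer_size G \<Omega> \<delta> \<psi> \<le> ennreal (\<kappa> * (1 + G 1 * measure lebesgue \<Omega>))"
proof -
  note bd = C01_norm_le[OF \<kappa>(1,2)]
  have "\<psi> x \<le> \<kappa>" if "x \<in> frontier \<Omega>" for x
  proof (rule continuous_le_on_closure[OF \<psi>(2)])
    show "x \<in> closure \<Omega>" using that by (simp add: frontier_def)
    show "\<psi> y \<le> \<kappa>" if "y \<in> \<Omega>" for y using bd(1)[OF that] by linarith
  qed
  then have "(SUP x\<in>frontier \<Omega>. \<psi> x) \<le> \<kappa>" using assms(3) by (intro cSUP_least) auto
  then have 1: "ennreal (SUP x\<in>frontier \<Omega>. \<psi> x) \<le> ennreal \<kappa>" by (rule ennreal_leI)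
  have grad: "norm (gradient \<psi> x) \<le> \<kappa>" if x: "x \<in> \<Omega>" for x
    by (rule gradient_le_Lipschitz[OF open_\<Omega> x C1_on_GDERIV[OF \<psi>(1) x]]) (rule bd(2)[OF _ x])
  have "(\<integral>\<^sup>+x\<in>\<Omega> - inner_domain \<Omega> \<delta>. ennreal (G (norm (gradient \<psi> x))) \<partial>lebesgue)
      \<le> (\<integral>\<^sup>+x. ennreal (\<kappa> * G 1) * indicator \<Omega> x \<partial>lebesgue)"
  proof (rule nn_integral_mono)
    fix x
    show "ennreal (G (norm (gradient \<psi> x))) * indicator (\<Omega> - inner_domain \<Omega> \<delta>) x \<le> ennreal (\<kappa> * G 1) * indicator \<Omega> x"
    proof (cases "x \<in> \<Omega>")
      case True
      have "G (norm (gradient \<psi> x)) \<le> G \<kappa>" using grad[OF True] by (intro G_mono) auto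
      also have "\<dots> \<le> \<kappa> * G 1" using \<kappa> by (intro G_le_linear) auto
      finally show ?thesis using True by (auto simp: indicator_def intro: ennreal_leI)
    qed (simp add: indicator_def)
  qed
  also have "\<dots> = ennreal (\<kappa> * G 1 * measure lebesgue \<Omega>)"
    using sets_\<Omega> \<kappa>(2) G_pos[of 1] emeasure_eq_measure2[OF \<Omega>]
    by (simp add: nn_integral_cmult_indicator ennreal_mult)
  finally have "boundary_layer_size G \<Omega> \<delta> \<psi> \<le> ennreal \<kappa> + ennreal (\<kappa> * G 1 * measure lebesgue \<Omega>)"
    unfolding boundary_layer_size_def using 1 by (rule add_mono[rotated])
  also have "\<dots> = ennreal (\<kappa> * (1 + G 1 * measure lebesgue \<Omega>))"
    using \<kappa>(2) G_pos[of 1] by (subst ennreal_plus[symmetric]) (auto simp: algebra_simps)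
  finally show ?thesis .
qed

end

section \<open>Comparison of the energies\<close>

text \<open>Functions that agree almost everywhere have the same weak gradients, so the choice operator picks
the same one for both. Hence different energies force different functions.\<close>

lemma energy_cong_AE:
  assumes "open \<Omega>" "AE x in lebesgue_on \<Omega>. u x = v x"
  shows "energy G \<Omega> a \<Gamma> u = energy G \<Omega> a \<Gamma> v"
proof -
  have sets: "\<Omega> \<in> sets lebesgue" using assms(1) by (auto intro: borel_open)
  have ae: "AE x in lebesgue. x \<in> \<Omega> \<longrightarrow> u x = v x"
    using assms(2) sets by (subst (asm) AE_restrict_space_iff) auto
  have half: "has_weak_gradient \<Omega> u' V \<Longrightarrow> has_weak_gradient \<Omega> v' V"
    if ae: "AE x in lebesgue. x \<in> \<Omega> \<longrightarrow> u' x = v' x" for u' v' :: "'a \<Rightarrow> real" and V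
  proof -
    assume hu: "has_weak_gradient \<Omega> u' V"
    have loc: "set_integrable lebesgue K v'" if K: "compact K" "K \<subseteq> \<Omega>" for K
    proof -
      have iu: "integrable lebesgue (\<lambda>x. indicator K x *\<^sub>R u' x)"
        using hu K by (auto simp: has_weak_gradient_def set_integrable_def)
      have ae': "AE x in lebesgue. indicator K x *\<^sub>R u' x = indicator K x *\<^sub>R v' x"
        using ae by eventually_elim (use K(2) in \<open>auto simp: indicator_def\<close>)
      have "(\<lambda>x. indicator K x *\<^sub>R v' x) \<in> borel_measurable lebesgue"
        by (rule AE_lebesgue_measurable[OF borel_measurable_integrable[OF iu] ae'])
      from integrable_cong_AE_imp[OF iu this ae'] show ?thesis unfolding set_integrable_def .
    qed
    have "(LINT x:\<Omega>|lebesgue. v' x *\<^sub>R gradient \<phi> x) = - (LINT x:\<Omega>|lebesgue. \<phi> x *\<^sub>R V x)"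
      if t: "test_function \<Omega> \<phi>" for \<phi>
    proof -
      obtain K where K: "compact K" "K \<subseteq> \<Omega>" "\<And>x. x \<notin> K \<Longrightarrow> gradient \<phi> x = 0"
        using test_function_support[OF t] by metis
      have iv: "set_integrable lebesgue \<Omega> (\<lambda>x. v' x *\<^sub>R gradient \<phi> x)"
        by (rule set_integrable_compact_support_scaleR'[OF test_function_continuous(2)[OF t] K loc[OF K(1,2)]])
      have "(LINT x:\<Omega>|lebesgue. v' x *\<^sub>R gradient \<phi> x) = (LINT x:\<Omega>|lebesgue. u' x *\<^sub>R gradient \<phi> x)"
        unfolding set_lebesgue_integral_def
      proof (rule integral_cong_AE)
        show "(\<lambda>x. indicator \<Omega> x *\<^sub>R v' x *\<^sub>R gradient \<phi> x) \<in> borel_measurable lebesgue"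
          using iv unfolding set_integrable_def by (rule borel_measurable_integrable)
        show "(\<lambda>x. indicator \<Omega> x *\<^sub>R u' x *\<^sub>R gradient \<phi> x) \<in> borel_measurable lebesgue"
          using has_weak_gradient_integrable(1)[OF hu t] unfolding set_integrable_def
          by (rule borel_measurable_integrable)
        show "AE x in lebesgue. indicator \<Omega> x *\<^sub>R v' x *\<^sub>R gradient \<phi> x = indicator \<Omega> x *\<^sub>R u' x *\<^sub>R gradient \<phi> x"
          using ae by eventually_elim (auto simp: indicator_def)
      qed
      then show ?thesis using hu t by (simp only: has_weak_gradient_def)
    qed
    then show "has_weak_gradient \<Omega> v' V"
      using hu loc by (simp add: has_weak_gradient_def)
  qed
  have ae': "AE x in lebesgue. x \<in> \<Omega> \<longrightarrow> v x = u x" using ae by eventually_elim auto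
  have "has_weak_gradient \<Omega> u = has_weak_gradient \<Omega> v"
    using half[OF ae] half[OF ae'] by blast
  then have wg: "weak_gradient \<Omega> u = weak_gradient \<Omega> v" by (simp only: weak_gradient_def)
  show ?thesis
    unfolding energy_def wg
    by (rule nn_integral_cong_AE) (use ae in \<open>eventually_elim, auto simp: indicator_def\<close>)
qed

theorem mainTheorem3:
  fixes \<Omega> :: "'a::euclidean_space set"
  assumes "smooth_bounded_domain \<Omega>"
  shows "\<exists>\<delta>'>0. \<forall>\<delta>. 0 < \<delta> \<and> \<delta> < \<delta>' \<longrightarrow>
    (\<forall>(a :: 'a \<Rightarrow> real) (\<delta>0 :: real) (g0 :: real) (G1 :: real).
       admissible_weight \<Omega> a \<and> 0 < \<delta>0 \<and> \<delta>0 \<le> g0 \<longrightarrow>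
       (\<exists>c0>0. \<exists>\<kappa>>0. \<forall>G g \<epsilon> \<Gamma> \<psi>.
          N_function G \<and> lieberman \<delta>0 g0 G g \<and> G 1 = G1 \<and>
          0 < \<epsilon> \<and> smooth_cutoff \<epsilon> \<Gamma> \<and> admissible_datum G \<Omega> \<epsilon> \<psi> \<longrightarrow>
          (C01_norm \<Omega> \<psi> \<le> ennreal \<kappa> \<longrightarrow> boundary_layer_size G \<Omega> \<delta> \<psi> \<le> ennreal c0) \<and>
          (boundary_layer_size G \<Omega> \<delta> \<psi> \<le> ennreal c0 \<longrightarrow>
             (\<forall>u0 u2. g_harmonic_solution G g \<Omega> \<psi> u0 \<and> energy_minimizer G \<Omega> a \<Gamma> \<psi> u2 \<longrightarrow>
                energy G \<Omega> a \<Gamma> u2 < energy G \<Omega> a \<Gamma> u0 \<and>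
                \<not> (AE x in lebesgue_on \<Omega>. u2 x = u0 x)))))"
proof -
  let ?F = "frontier \<Omega>"
  have op: "open \<Omega>" and bd: "bounded \<Omega>" and ne: "\<Omega> \<noteq> {}"
    using assms by (auto simp: smooth_bounded_domain_def)
  have "\<Omega> \<noteq> UNIV" using bd not_bounded_UNIV by blast
  then have F: "?F \<noteq> {}" using frontier_not_empty ne by blast
  have Fc: "compact ?F" using bd by (rule compact_frontier_bounded)
  obtain x0 where x0: "x0 \<in> \<Omega>" using ne by blast
  have "x0 \<notin> ?F" using x0 op by (simp add: frontier_def interior_open)
  then have \<delta>': "0 < infdist x0 ?F"
    by (intro infdist_pos_not_in_closed compact_imp_closed Fc F)
  show ?thesis
  proof (rule exI[of _ "infdist x0 ?F"], rule conjI[OF \<delta>'], intro allI impI)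
    fix \<delta> :: real and a :: "'a \<Rightarrow> real" and \<delta>0 g0 G1 :: real
    assume \<delta>: "0 < \<delta> \<and> \<delta> < infdist x0 ?F"
      and data: "admissible_weight \<Omega> a \<and> 0 < \<delta>0 \<and> \<delta>0 \<le> g0"
    define I where "I = inner_domain \<Omega> \<delta>"
    have I_eq: "I = \<Omega> \<inter> {x. \<delta> < infdist x ?F}" by (auto simp: I_def inner_domain_def)
    have I: "open I" "I \<subseteq> \<Omega>"
      unfolding I_eq using op by (auto intro!: open_Int open_Collect_less continuous_intros)
    have "x0 \<in> I" using x0 \<delta> by (simp add: I_eq)
    then obtain \<rho> where \<rho>: "0 < \<rho>" "ball x0 \<rho> \<subseteq> I" using I(1) open_contains_ball by blast
    have "I \<in> lmeasurable"
      using I(1) bounded_subset[OF bd I(2)] by (rule lmeasurable_open[rotated])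
    then have "measure lebesgue (ball x0 \<rho>) \<le> measure lebesgue I"
      using \<rho>(2) by (intro measure_mono_fmeasurable) auto
    moreover have "0 < measure lebesgue (ball x0 \<rho>)"
      using content_ball_pos[OF \<rho>(1), of x0] by (simp add: measure_completion)
    ultimately have \<mu>: "0 < measure lebesgue I" by linarith

    have "open {x. infdist x ?F < \<delta>}" by (intro open_Collect_less continuous_intros)
    moreover have "?F \<subseteq> {x. infdist x ?F < \<delta>}" using \<delta> by auto
    ultimately obtain \<eta> where \<eta>: "test_function {x. infdist x ?F < \<delta>} \<eta>"
      "\<And>x. 0 \<le> \<eta> x \<and> \<eta> x \<le> 1" "\<And>x. x \<in> ?F \<Longrightarrow> \<eta> x = 1"
      using smooth_urysohn[OF Fc] by metis
    obtain K\<eta> where K\<eta>: "compact K\<eta>" "K\<eta> \<subseteq> {x. infdist x ?F < \<delta>}"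
      "\<And>x. x \<notin> K\<eta> \<Longrightarrow> \<eta> x = 0" "\<And>x. x \<notin> K\<eta> \<Longrightarrow> gradient \<eta> x = 0"
      using test_function_support[OF \<eta>(1)] by metis
    \<comment> \<open>This constant depends only on \<open>\<Omega>\<close> and \<open>\<delta>\<close>.\<close>
    obtain C where C: "0 \<le> C" "\<And>x. norm (gradient \<eta> x) \<le> C"
      using compact_support_bounded[OF test_function_continuous(2)[OF \<eta>(1)] K\<eta>(1,4)] by metis
    have \<eta>I: "\<eta> x = 0" if "x \<in> I" for x
      using that K\<eta>(2,3) by (force simp: I_eq)

    have a: "continuous_on \<Omega> a" "\<And>x. x \<in> \<Omega> \<Longrightarrow> 0 < a x" "bounded (a ` \<Omega>)" and i0: "0 < (INF x\<in>\<Omega>. a x)"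
      using data by (auto simp: admissible_weight_def)
    have ai: "(INF x\<in>\<Omega>. a x) \<le> a x" if "x \<in> \<Omega>" for x
      using bounded_imp_bdd_below[OF a(3)] that by (rule cINF_lower)
    obtain B where B: "\<And>x. x \<in> \<Omega> \<Longrightarrow> a x \<le> B"
      using bounded_imp_bdd_above[OF a(3)] by (auto simp: bdd_above_def)

    \<comment> \<open>Here \<open>q\<close> is the gain and \<open>c0 * H\<close> bounds the cost of the competitor in the layer, up to the weight. The first entry
      of the minimum in \<open>c0\<close> keeps the argument \<open>2 * b * C\<close> of \<open>G\<close> at most \<open>1\<close>, where \<open>G t \<le> t * G 1\<close>; the second gives
      \<open>c0 * H \<le> q / 2\<close>.\<close>
    define m where "m = measure lebesgue \<Omega>"
    define K where "K = 2 powr (1 + g0)"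
    define q where "q = (INF x\<in>\<Omega>. a x) * measure lebesgue I"
    define H where "H = K * (1 + 2 * C * \<bar>G1\<bar> * m)"
    define c0 where "c0 = min (1 / (2 * C + 1)) (q / (2 * H))"
    define \<kappa> where "\<kappa> = min 1 (c0 / (1 + \<bar>G1\<bar> * m))"
    have m: "0 \<le> m" by (simp add: m_def)
    have K: "0 < K" by (simp add: K_def)
    have q: "0 < q" unfolding q_def using i0 \<mu> by (rule mult_pos_pos)
    have H: "0 < H" unfolding H_def using K C(1) m by (intro mult_pos_pos add_pos_nonneg mult_nonneg_nonneg) auto
    have c0: "0 < c0" "c0 \<le> 1 / (2 * C + 1)" "c0 \<le> q / (2 * H)"
      unfolding c0_def using C(1) q H by auto
    have D: "0 < 1 + \<bar>G1\<bar> * m" using m by (intro add_pos_nonneg mult_nonneg_nonneg) auto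
    have \<kappa>: "0 < \<kappa>" "\<kappa> \<le> 1" "\<kappa> * (1 + \<bar>G1\<bar> * m) \<le> c0"
    proof -
      show "0 < \<kappa>" "\<kappa> \<le> 1" unfolding \<kappa>_def using c0(1) D by auto
      have "\<kappa> \<le> c0 / (1 + \<bar>G1\<bar> * m)" by (simp add: \<kappa>_def)
      then show "\<kappa> * (1 + \<bar>G1\<bar> * m) \<le> c0" using D by (simp add: pos_le_divide_eq)
    qed

    show "\<exists>c0>0. \<exists>\<kappa>>0. \<forall>G g \<epsilon> \<Gamma> \<psi>.
          N_function G \<and> lieberman \<delta>0 g0 G g \<and> G 1 = G1 \<and>
          0 < \<epsilon> \<and> smooth_cutoff \<epsilon> \<Gamma> \<and> admissible_datum G \<Omega> \<epsilon> \<psi> \<longrightarrow>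
          (C01_norm \<Omega> \<psi> \<le> ennreal \<kappa> \<longrightarrow> boundary_layer_size G \<Omega> \<delta> \<psi> \<le> ennreal c0) \<and>
          (boundary_layer_size G \<Omega> \<delta> \<psi> \<le> ennreal c0 \<longrightarrow>
             (\<forall>u0 u2. g_harmonic_solution G g \<Omega> \<psi> u0 \<and> energy_minimizer G \<Omega> a \<Gamma> \<psi> u2 \<longrightarrow>
                energy G \<Omega> a \<Gamma> u2 < energy G \<Omega> a \<Gamma> u0 \<and>
                \<not> (AE x in lebesgue_on \<Omega>. u2 x = u0 x)))"
    proof (rule exI[of _ c0], rule conjI[OF c0(1)], rule exI[of _ \<kappa>], rule conjI[OF \<kappa>(1)],
        intro allI impI conjI)
      fix G g :: "real \<Rightarrow> real" and \<epsilon> :: real and \<Gamma> and \<psi> :: "'a \<Rightarrow> real"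
      assume hyp: "N_function G \<and> lieberman \<delta>0 g0 G g \<and> G 1 = G1 \<and>
          0 < \<epsilon> \<and> smooth_cutoff \<epsilon> \<Gamma> \<and> admissible_datum G \<Omega> \<epsilon> \<psi>"
      interpret orlicz_setting G g \<delta>0 g0 \<Omega>
        using hyp data op bd by unfold_locales auto
      have G1: "\<bar>G1\<bar> = G 1" "0 < G 1" using hyp G_pos[of 1] by auto
      obtain \<alpha> where "0 < \<alpha>" "C1_holder_closure \<alpha> \<Omega> \<psi>"
        using hyp by (auto simp: admissible_datum_def)
      note h = C1_holder_closure_imp[OF this(2,1) bd]
      have \<psi>: "C1_on \<Omega> \<psi> (gradient \<psi>)" by (rule h(1))
      have \<psi>c: "continuous_on (closure \<Omega>) \<psi>"
        using \<open>C1_holder_closure \<alpha> \<Omega> \<psi>\<close> by (simp add: C1_holder_closure_def)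
      obtain L where L: "\<And>x. x \<in> \<Omega> \<Longrightarrow> norm (gradient \<psi> x) \<le> L" using h(2) by blast
      {
        assume "C01_norm \<Omega> \<psi> \<le> ennreal \<kappa>"
        then have "boundary_layer_size G \<Omega> \<delta> \<psi> \<le> ennreal (\<kappa> * (1 + G 1 * measure lebesgue \<Omega>))"
          using \<kappa> by (intro boundary_layer_size_le[OF \<psi> \<psi>c F]) auto
        also have "\<dots> \<le> ennreal c0" using \<kappa>(3) by (intro ennreal_leI) (simp add: G1(1) m_def)
        finally show "boundary_layer_size G \<Omega> \<delta> \<psi> \<le> ennreal c0" .
      }
      fix u0 u2
      assume small: "boundary_layer_size G \<Omega> \<delta> \<psi> \<le> ennreal c0"
        and u: "g_harmonic_solution G g \<Omega> \<psi> u0 \<and> energy_minimizer G \<Omega> a \<Gamma> \<psi> u2"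
      define b where "b = (SUP x\<in>?F. \<psi> x)"
      let ?L = "\<integral>\<^sup>+x\<in>\<Omega> - I. ennreal (G (norm (gradient \<psi> x))) \<partial>lebesgue"
      note bounds = continuous_boundary_bounds[OF \<psi>c bd]
      have \<psi>\<epsilon>: "\<epsilon> < \<psi> x" if "x \<in> ?F" for x
        using bounds(1)[OF that] hyp by (auto simp: admissible_datum_def)
      have \<psi>b: "\<psi> x \<le> b" if "x \<in> ?F" for x using bounds(2)[OF that] by (simp add: b_def)
      have b: "0 < b"
      proof -
        obtain p where "p \<in> ?F" using F by blast
        then show ?thesis using \<psi>\<epsilon>[of p] \<psi>b[of p] hyp by linarith
      qed
      have sum: "ennreal b + ?L \<le> ennreal c0"
        using small by (simp only: boundary_layer_size_def b_def I_def)
      have "ennreal b \<le> ennreal c0" by (rule order_trans[OF _ sum]) simp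
      then have bc: "b \<le> c0" using c0(1) by (simp add: ennreal_le_iff)
      have Lc: "?L \<le> ennreal c0" by (rule order_trans[OF _ sum]) simp

      have \<Gamma>: "0 \<le> \<Gamma> s \<and> \<Gamma> s \<le> 1" "\<Gamma> 0 = 0" "\<epsilon> \<le> s \<Longrightarrow> \<Gamma> s = 1" for s
      proof -
        have "\<Gamma> s \<in> {0..1}" using hyp unfolding smooth_cutoff_def by blast
        then show "0 \<le> \<Gamma> s \<and> \<Gamma> s \<le> 1" by simp
        show "\<Gamma> 0 = 0" "\<epsilon> \<le> s \<Longrightarrow> \<Gamma> s = 1" using hyp by (auto simp: smooth_cutoff_def)
      qed
      have bdry: "0 \<le> \<psi> x \<and> \<psi> x \<le> b" if "x \<in> ?F" for x
        using \<psi>\<epsilon>[OF that] \<psi>b[OF that] hyp by linarith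
      obtain v V where v: "v \<in> dirichlet_class G \<Omega> \<psi>" "has_weak_gradient \<Omega> v V"
        "\<And>x. norm (V x) \<le> norm (gradient \<psi> x) + 2 * b * C" "\<And>x. x \<in> I \<Longrightarrow> v x = 0 \<and> V x = 0"
        by (rule competitor[OF \<psi> \<psi>c L bdry b test_function_C1_on[OF \<eta>(1)] \<eta>(2,3) C(2) I \<eta>I])
          (assumption | rule that)+
      have t: "0 \<le> 2 * b * C" "2 * b * C \<le> 2 * c0 * C" "2 * c0 * C \<le> 1"
      proof -
        show "0 \<le> 2 * b * C" "2 * b * C \<le> 2 * c0 * C" using b bc C(1) by (auto intro: mult_right_mono)
        have "c0 * (2 * C + 1) \<le> 1" using c0(2) C(1) by (simp add: pos_le_divide_eq)
        then show "2 * c0 * C \<le> 1" using c0(1) by (simp add: algebra_simps)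
      qed
      have "G (2 * b * C) \<le> 2 * b * C * G 1" using t by (intro G_le_linear) auto
      also have "\<dots> \<le> 2 * c0 * C * G 1" by (rule mult_right_mono[OF t(2) less_imp_le[OF G1(2)]])
      finally have Gt: "G (2 * b * C) * m \<le> 2 * c0 * C * G 1 * m" using m by (intro mult_right_mono) auto
      have "energy G \<Omega> a \<Gamma> u2 \<le> energy G \<Omega> a \<Gamma> v"
        using u v(1) by (simp add: energy_minimizer_def)
      also have "\<dots> \<le> ennreal K * (?L + ennreal (G (2 * b * C) * m)) + (\<integral>\<^sup>+x\<in>\<Omega> - I. ennreal (a x) \<partial>lebesgue)"
        unfolding K_def m_def
        by (rule energy_competitor_le[where V = V, OF v(2,3,4) t(1) C1_on_continuous_gradient[OF \<psi>] I a(1)])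
           (use a(2) \<Gamma>(1,2) in \<open>auto intro: less_imp_le\<close>)
      also have "\<dots> \<le> ennreal K * (ennreal c0 + ennreal (2 * c0 * C * G 1 * m)) + (\<integral>\<^sup>+x\<in>\<Omega> - I. ennreal (a x) \<partial>lebesgue)"
        using Gt by (intro add_right_mono mult_left_mono add_mono Lc ennreal_leI) auto
      also have "ennreal K * (ennreal c0 + ennreal (2 * c0 * C * G 1 * m)) = ennreal (c0 * H)"
      proof -
        have "0 \<le> 2 * c0 * C * G 1 * m" using c0(1) C(1) G1(2) m by (intro mult_nonneg_nonneg) auto
        then have "ennreal K * (ennreal c0 + ennreal (2 * c0 * C * G 1 * m)) = ennreal (K * (c0 + 2 * c0 * C * G 1 * m))"
          using K c0(1) by (simp only: ennreal_plus[symmetric] ennreal_mult[symmetric] less_imp_le add_nonneg_nonneg)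
        also have "K * (c0 + 2 * c0 * C * G 1 * m) = c0 * H" by (simp add: H_def G1(1) algebra_simps)
        finally show ?thesis .
      qed
      also have "ennreal (c0 * H) + (\<integral>\<^sup>+x\<in>\<Omega> - I. ennreal (a x) \<partial>lebesgue) < (\<integral>\<^sup>+x\<in>\<Omega>. ennreal (a x) \<partial>lebesgue)"
      proof (rule integral_gap[OF I a(1) ai B i0])
        show "0 \<le> c0 * H" using c0(1) H by simp
        have "c0 * H \<le> q / 2" using c0(3) H by (simp add: field_simps)
        then show "c0 * H < (INF x\<in>\<Omega>. a x) * measure lebesgue I" using q unfolding q_def by linarith
      qed
      also have "\<dots> \<le> energy G \<Omega> a \<Gamma> u0"
        using u by (intro energy_solution_ge[OF g_harmonic_lower_bound[OF _ \<psi> \<psi>c \<psi>\<epsilon>] \<Gamma>(3)]) auto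
      finally have less: "energy G \<Omega> a \<Gamma> u2 < energy G \<Omega> a \<Gamma> u0" .
      then show "energy G \<Omega> a \<Gamma> u2 < energy G \<Omega> a \<Gamma> u0" .
      show "\<not> (AE x in lebesgue_on \<Omega>. u2 x = u0 x)"
        using less energy_cong_AE[OF op, of u2 u0 G a \<Gamma>] by auto
    qed
  qed
qed

end
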